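(* Let $m\ge 3$ and $s\ge 2$ be integers, and let $G=\operatorname{cor}(K_m,s)$ be the graph obtained from the complete graph $K_m$ on $m$ vertices by adding exactly $s$ pendants to each of its vertices. Let $J=J(G)$ be the cover ideal of $G$. Then for all $n\ge 0$: (1) $\operatorname{reg}(J^{(2n)})=\omega(J^{(2n)})=m(s+1)n$; (2) $\operatorname{reg}(J^{(2n+1)})=\omega(J^{(2n+1)})=m(s+1)n+m+s-1$. In particular, for all $n\ge 0$, $$\operatorname{reg}(J^{(n)})=\omega(J^{(n)})=(m+s-1)n+(m-2)(s-1)\left\lfloor\frac n2\right\rfloor,$$ which is not an eventually linear function of $n$.
   Context: Adding a pendant to a vertex $v$ means adding a new vertex of degree $1$ adjacent only to $v$. Let $k$ be a field and $R=k[x_v : v\in V(G)]$ with the standard grading. The cover ideal of $G$ is $J(G)=\bigcap_{\{u,v\}\in E(G)}(x_u,x_v)\subseteq R$. The $n$-th symbolic power of an ideal $I$ is $I^{(n)}=\bigcap_{\mathfrak p\in\operatorname{Min}(I)}(I^nR_{\mathfrak p}\cap R)$, where $\operatorname{Min}(I)$ is the set of minimal primes of $I$; here $J(G)^{(n)}=\bigcap_{\{u,v\}\in E(G)}(x_u,x_v)^n$, and $J(G)^{(0)}=R$. For a finitely generated graded $R$-module $M$, $\omega(M)$ is the maximal degree of a minimal homogeneous generator of $M$ and $\operatorname{reg}(M)$ is its Castelnuovo–Mumford regularity. *)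

theory Defs
  imports Complex_Main "HOL-Library.Poly_Mapping"
begin

section \<open>Ideals of a commutative ring\<close>

text \<open>Ideals are the submodules of the ring as a module over itself; the ideal generated
  by \<open>S\<close> is \<open>ring_module.span S\<close>.\<close>

interpretation ring_module: module "(*) :: 'a::comm_ring_1 \<Rightarrow> 'a \<Rightarrow> 'a"
  by unfold_locales (simp_all add: algebra_simps)

abbreviation is_ideal :: "'a::comm_ring_1 set \<Rightarrow> bool" where
  "is_ideal \<equiv> ring_module.subspace"

abbreviation ideal_gen :: "'a::comm_ring_1 set \<Rightarrow> 'a set" where
  "ideal_gen \<equiv> ring_module.span"

definition is_prime_ideal :: "'a::comm_ring_1 set \<Rightarrow> bool" where
  "is_prime_ideal P \<longleftrightarrow>
     is_ideal P \<and> P \<noteq> UNIV \<and> (\<forall>a b. a * b \<in> P \<longrightarrow> a \<in> P \<or> b \<in> P)"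

definition minimal_primes :: "'a::comm_ring_1 set \<Rightarrow> 'a set set" where
  "minimal_primes I =
     {P. is_prime_ideal P \<and> I \<subseteq> P \<and> (\<forall>Q. is_prime_ideal Q \<and> I \<subseteq> Q \<and> Q \<subseteq> P \<longrightarrow> Q = P)}"

fun ideal_power :: "'a::comm_ring_1 set \<Rightarrow> nat \<Rightarrow> 'a set" where
  "ideal_power I 0 = UNIV"
| "ideal_power I (Suc n) = ideal_gen {a * b | a b. a \<in> I \<and> b \<in> ideal_power I n}"

text \<open>The contraction of \<open>A R\<^sub>P\<close> to \<open>R\<close>: the image of \<open>f\<close> in the localization at \<open>P\<close> lies in
  the extension of the ideal \<open>A\<close> iff \<open>g f \<in> A\<close> for some \<open>g \<notin> P\<close>.\<close>

definition localization_contraction :: "'a::comm_ring_1 set \<Rightarrow> 'a set \<Rightarrow> 'a set" where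
  "localization_contraction A P = {f. \<exists>g. g \<notin> P \<and> g * f \<in> A}"

definition symbolic_power :: "'a::comm_ring_1 set \<Rightarrow> nat \<Rightarrow> 'a set" where
  "symbolic_power I n =
     (\<Inter>P\<in>minimal_primes I. localization_contraction (ideal_power I n) P)"


section \<open>The standard graded polynomial ring\<close>

text \<open>A polynomial with coefficients in \<open>'k\<close> and one variable for each element of \<open>'v\<close> is a
  finitely supported function from exponent vectors to coefficients.\<close>

type_synonym ('v, 'k) mpoly = "('v \<Rightarrow>\<^sub>0 nat) \<Rightarrow>\<^sub>0 'k"

definition Var :: "'v \<Rightarrow> ('v, 'k::comm_ring_1) mpoly" where
  "Var v = Poly_Mapping.single (Poly_Mapping.single v 1) 1"

definition monomial_degree :: "('v \<Rightarrow>\<^sub>0 nat) \<Rightarrow> nat" where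
  "monomial_degree t = (\<Sum>v\<in>Poly_Mapping.keys t. Poly_Mapping.lookup t v)"

text \<open>Degrees are integers, since they also occur as differences of twists. The zero polynomial
  is homogeneous of every degree, and it is the only one in negative degrees.\<close>

definition homogeneous :: "int \<Rightarrow> ('v, 'k::comm_ring_1) mpoly \<Rightarrow> bool" where
  "homogeneous d f \<longleftrightarrow> (\<forall>t\<in>Poly_Mapping.keys f. int (monomial_degree t) = d)"

definition irrelevant_ideal :: "('v, 'k::comm_ring_1) mpoly set" where
  "irrelevant_ideal = ideal_gen (range Var)"


section \<open>Maximal generating degree\<close>

definition minimal_homogeneous_generators ::
    "('v, 'k::comm_ring_1) mpoly set \<Rightarrow> ('v, 'k) mpoly set \<Rightarrow> bool" where
  "minimal_homogeneous_generators I S \<longleftrightarrow>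
     (\<forall>f\<in>S. \<exists>d. homogeneous d f) \<and> ideal_gen S = I \<and> (\<forall>T. T \<subset> S \<longrightarrow> ideal_gen T \<noteq> I)"

text \<open>Over a field and in finitely many variables the set below is finite for every homogeneous
  ideal, and nonempty for a nonzero one, so that the supremum is a maximum. A minimal generating set does not contain 0, so the degree
  \<open>d\<close> of \<open>f\<close> is determined by \<open>f\<close>.\<close>

definition max_generator_degree :: "('v, 'k::comm_ring_1) mpoly set \<Rightarrow> int" where
  "max_generator_degree I =
     Sup {d. \<exists>S f. minimal_homogeneous_generators I S \<and> f \<in> S \<and> homogeneous d f}"


section \<open>Minimal graded free resolutions and regularity\<close>

text \<open>
  The data of a complex \<open>\<dots> \<rightarrow> F\<^sub>2 \<rightarrow> F\<^sub>1 \<rightarrow> F\<^sub>0 \<rightarrow> R\<close> of finitely generated graded free modules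
  over the polynomial ring \<open>R\<close>. The module \<open>F\<^sub>i\<close> has a basis indexed by
  \<open>{..<rk F i}\<close>, whose element \<open>q\<close> has degree \<open>twist F i q\<close>; that is, \<open>F\<^sub>i\<close> is the direct sum of the
  modules \<open>R(- twist F i q)\<close>. The augmentation sends the basis element \<open>q\<close> of \<open>F\<^sub>0\<close> to \<open>aug F q\<close>, and
  \<open>diff F i p q\<close> is the entry in row \<open>p\<close> and column \<open>q\<close> of the matrix of the map from
  \<open>F\<^sub>i\<^sub>+\<^sub>1\<close> to \<open>F\<^sub>i\<close>. Values at indices out of range are irrelevant.
\<close>

record (overloaded) ('v, 'k::zero) free_complex =
  rk :: "nat \<Rightarrow> nat"
  twist :: "nat \<Rightarrow> nat \<Rightarrow> int"
  aug :: "nat \<Rightarrow> ('v, 'k) mpoly"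
  diff :: "nat \<Rightarrow> nat \<Rightarrow> nat \<Rightarrow> ('v, 'k) mpoly"

definition free_module :: "nat \<Rightarrow> (nat \<Rightarrow> 'a::comm_ring_1) set" where
  "free_module n = {c. \<forall>q\<ge>n. c q = 0}"

definition aug_map ::
    "('v, 'k::comm_ring_1) free_complex \<Rightarrow> (nat \<Rightarrow> ('v, 'k) mpoly) \<Rightarrow> ('v, 'k) mpoly" where
  "aug_map F c = (\<Sum>q<rk F 0. aug F q * c q)"

definition diff_map ::
    "('v, 'k::comm_ring_1) free_complex \<Rightarrow> nat \<Rightarrow> (nat \<Rightarrow> ('v, 'k) mpoly) \<Rightarrow> (nat \<Rightarrow> ('v, 'k) mpoly)"
  where
  "diff_map F i c = (\<lambda>p. if p < rk F i then \<Sum>q<rk F (Suc i). diff F i p q * c q else 0)"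

text \<open>The augmentation and the differentials are homogeneous of degree 0.\<close>

definition graded_complex :: "('v, 'k::comm_ring_1) free_complex \<Rightarrow> bool" where
  "graded_complex F \<longleftrightarrow>
     (\<forall>q<rk F 0. homogeneous (twist F 0 q) (aug F q)) \<and>
     (\<forall>i. \<forall>p<rk F i. \<forall>q<rk F (Suc i).
        homogeneous (twist F (Suc i) q - twist F i p) (diff F i p q))"

definition resolves :: "('v, 'k::comm_ring_1) free_complex \<Rightarrow> ('v, 'k) mpoly set \<Rightarrow> bool" where
  "resolves F I \<longleftrightarrow>
     aug_map F ` free_module (rk F 0) = I \<and>
     {c \<in> free_module (rk F 0). aug_map F c = 0} = diff_map F 0 ` free_module (rk F 1) \<and>
     (\<forall>i. {c \<in> free_module (rk F (Suc i)). diff_map F i c = (\<lambda>_. 0)}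
            = diff_map F (Suc i) ` free_module (rk F (Suc (Suc i))))"

definition minimal_graded_free_resolution ::
    "('v, 'k::comm_ring_1) free_complex \<Rightarrow> ('v, 'k) mpoly set \<Rightarrow> bool" where
  "minimal_graded_free_resolution F I \<longleftrightarrow>
     graded_complex F \<and> resolves F I \<and>
     (\<forall>i. \<forall>p<rk F i. \<forall>q<rk F (Suc i). diff F i p q \<in> irrelevant_ideal)"

text \<open>The degrees \<open>j\<close> with \<open>\<beta>\<^sub>i\<^sub>,\<^sub>j(I) \<noteq> 0\<close>. Minimal graded free resolutions are unique up to
  isomorphism, so each of them contributes the same degrees.\<close>

definition betti_degrees :: "('v, 'k::comm_ring_1) mpoly set \<Rightarrow> nat \<Rightarrow> int set" where
  "betti_degrees I i =
     {twist F i q | F q. minimal_graded_free_resolution F I \<and> q < rk F i}"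

text \<open>For a nonzero homogeneous ideal over a field in finitely many variables the supremum is a
  maximum, by Hilbert's syzygy theorem.\<close>

definition regularity :: "('v, 'k::comm_ring_1) mpoly set \<Rightarrow> int" where
  "regularity I = Sup {j - int i | i j. j \<in> betti_degrees I i}"


section \<open>Graphs and cover ideals\<close>

text \<open>A graph on the vertex set \<open>'v\<close> is given by its set of edges, each a two-element set.\<close>

definition complete_graph_edges :: "'v set \<Rightarrow> 'v set set" where
  "complete_graph_edges C = {{u, v} | u v. u \<in> C \<and> v \<in> C \<and> u \<noteq> v}"

text \<open>The graph with vertex set \<open>'v\<close> and edge set \<open>E\<close> is obtained from the graph with vertex set
  \<open>C\<close> and edge set \<open>H\<close> by adding exactly \<open>s\<close> pendants to each vertex of \<open>C\<close>: the vertices outside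
  \<open>C\<close> are the pendants, and \<open>base v\<close> is the vertex to which the pendant \<open>v\<close> is attached.\<close>

definition is_corona :: "'v::finite set \<Rightarrow> 'v set set \<Rightarrow> nat \<Rightarrow> 'v set set \<Rightarrow> bool" where
  "is_corona C H s E \<longleftrightarrow>
     (\<exists>base. (\<forall>v. v \<notin> C \<longrightarrow> base v \<in> C) \<and>
             (\<forall>c\<in>C. card {v. v \<notin> C \<and> base v = c} = s) \<and>
             E = H \<union> {{v, base v} | v. v \<notin> C})"

definition cover_ideal :: "'v set set \<Rightarrow> ('v, 'k::comm_ring_1) mpoly set" where
  "cover_ideal E = (\<Inter>e\<in>E. ideal_gen (Var ` e))"

definition eventually_linear :: "(nat \<Rightarrow> real) \<Rightarrow> bool" where
  "eventually_linear f \<longleftrightarrow> (\<exists>a b. \<forall>\<^sub>F n in sequentially. f n = a * real n + b)"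

end

theory Submission
  imports Defs
begin

text \<open>The ideals generated by \<open>x\<^sub>u, x\<^sub>v\<close>, one for each edge \<open>{u, v}\<close>, are the minimal primes of the cover
  ideal, because no edge contains another one. After localizing at one of them the other
  intersectands become trivial. Hence the symbolic power \<open>J\<^sup>(\<^sup>N\<^sup>)\<close> is spanned by the monomials
  with exponent vector \<open>t\<close> such that \<open>N \<le> t u + t v\<close> for every edge (\<open>symbolic_power_cover_ideal\<close>).

  For the corona of a complete graph with core vertices \<open>0, \<dots>, m - 1\<close>, let \<open>x\<^sub>i\<close> be the variable of the
  core vertex \<open>i\<close> and \<open>y\<^sub>i\<close> the product of the variables of its pendants. A monomial in \<open>J\<^sup>(\<^sup>N\<^sup>)\<close> is a multiple
  of \<open>f\<^sub>a\<close>, the product of all \<open>x\<^sub>i\<close> to the power \<open>a i\<close> and \<open>y\<^sub>i\<close> to the power \<open>N - a i\<close>, where \<open>a\<close> lies in the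
  set \<open>P\<close> of lattice points of the box \<open>[0, N]\<^sup>m\<close> with \<open>N \<le> a i + a j\<close> for all \<open>i \<noteq> j\<close>.
  Two features matter. The set \<open>P\<close> is closed upwards in the box, and
  neighbouring points satisfy \<open>x\<^sub>i f\<^sub>a = y\<^sub>i f\<^sub>b\<close> with \<open>b = a + e\<^sub>i\<close>. So the lattice cubes whose lower corner is in
  \<open>P\<close> carry a complex of free modules with entries \<open>\<plusminus>x\<^sub>i\<close> and \<open>\<plusminus>y\<^sub>i\<close>. In each multidegree it is the
  chain complex of an upward closed part of a box, which can be contracted to the top corner by
  pushing in one direction after the other (\<open>cycles_are_boundaries\<close>). Therefore the complex is a minimal
  graded free resolution (\<open>minimal_resolution\<close>). A cube of dimension \<open>n\<close> with lower corner \<open>a\<close> has degree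
  \<open>deg f\<^sub>a + n\<close>, so the regularity is the maximum of \<open>deg f\<^sub>a\<close>, and this is also the
  maximal degree of a minimal generator.

  The regularity takes all minimal resolutions into account. They have the same twists: lifting
  the identity of the ideal between two resolutions gives maps whose composition is homotopic to the identity,
  and over a minimal resolution a homotopy does not change constant coefficients
  (\<open>minimal_resolution_twist_occurs\<close>).

  It remains to maximize \<open>deg f\<^sub>a = m s N - (s - 1) (a 0 + \<dots> + a (m - 1))\<close>, that is, to minimize the sum of the
  \<open>a i\<close>. At most one \<open>a i\<close> is less than \<open>N / 2\<close>, and lowering it forces all the others up. So the minimum is
  attained with all \<open>a i = N / 2\<close> for even \<open>N\<close>, and with one \<open>a i = (N - 1) / 2\<close> and the others
  \<open>(N + 1) / 2\<close> for odd \<open>N\<close>. The increments from \<open>2 n\<close> to \<open>2 n + 1\<close> and from \<open>2 n + 1\<close> to \<open>2 n + 2\<close> differ by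
  \<open>(m - 2) (s - 1) \<noteq> 0\<close>, which excludes an eventually linear function.\<close>

section \<open>Monomials\<close>

text \<open>As a rewrite rule for multiplication, the module law reassociates products against \<open>mult.assoc\<close>.\<close>

declare ring_module.scale_scale [simp del]

abbreviation monomial :: "'a \<Rightarrow> 'a \<Rightarrow>\<^sub>0 'k::comm_ring_1" where
  "monomial t \<equiv> Poly_Mapping.single t 1"

lemma lookup_times_finite:
  fixes f g :: "'a::comm_monoid_add \<Rightarrow>\<^sub>0 'k::comm_ring_1"
  assumes "finite A" "finite B" "Poly_Mapping.keys f \<subseteq> A" "Poly_Mapping.keys g \<subseteq> B"
  shows "Poly_Mapping.lookup (f * g) t =
    (\<Sum>a\<in>A. \<Sum>b\<in>B. Poly_Mapping.lookup f a * Poly_Mapping.lookup g b when t = a + b)"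
proof -
  have inner: "(\<Sum>q. Poly_Mapping.lookup g q when t = l + q) =
      (\<Sum>b\<in>B. Poly_Mapping.lookup g b when t = l + b)" for l
    by (rule Sum_any.expand_superset) (use assms in \<open>auto simp: in_keys_iff\<close>)
  have "Poly_Mapping.lookup (f * g) t =
      (\<Sum>l. Poly_Mapping.lookup f l * (\<Sum>b\<in>B. Poly_Mapping.lookup g b when t = l + b))"
    by (simp add: lookup_mult inner)
  also have "\<dots> = (\<Sum>a\<in>A. Poly_Mapping.lookup f a * (\<Sum>b\<in>B. Poly_Mapping.lookup g b when t = a + b))"
    using assms(1) by (rule Sum_any.expand_superset)
      (auto intro!: subsetD[OF assms(3)] simp: in_keys_iff)
  finally show ?thesis
    by (simp add: sum_distrib_left mult_when)
qed

lemma lookup_single_times: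
  fixes f :: "'a::cancel_comm_monoid_add \<Rightarrow>\<^sub>0 'k::comm_ring_1"
  shows "Poly_Mapping.lookup (Poly_Mapping.single s x * f) (s + t) = x * Poly_Mapping.lookup f t"
proof -
  have "Poly_Mapping.lookup (Poly_Mapping.single s x * f) (s + t) =
      (\<Sum>a\<in>{s}. \<Sum>b\<in>insert t (Poly_Mapping.keys f).
        Poly_Mapping.lookup (Poly_Mapping.single s x) a * Poly_Mapping.lookup f b when s + t = a + b)"
    by (rule lookup_times_finite) auto
  also have "\<dots> = (\<Sum>b\<in>insert t (Poly_Mapping.keys f). x * Poly_Mapping.lookup f b when t = b)"
    by simp
  also have "\<dots> = x * Poly_Mapping.lookup f t"
    by (simp add: when_def sum.delta')
  finally show ?thesis .
qed

lemma keys_monomial_times: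
  fixes f :: "'a::cancel_comm_monoid_add \<Rightarrow>\<^sub>0 'k::comm_ring_1"
  shows "Poly_Mapping.keys (monomial s * f) = (+) s ` Poly_Mapping.keys f"
proof
  show "Poly_Mapping.keys (monomial s * f) \<subseteq> (+) s ` Poly_Mapping.keys f"
    using keys_mult[of "monomial s" f] by (force split: if_splits)
  show "(+) s ` Poly_Mapping.keys f \<subseteq> Poly_Mapping.keys (monomial s * f)"
    by (auto simp: in_keys_iff lookup_single_times)
qed

lemma monomial_times_cancel:
  fixes f g :: "'a::cancel_comm_monoid_add \<Rightarrow>\<^sub>0 'k::comm_ring_1"
  assumes "monomial s * f = monomial s * g"
  shows "f = g"
  by (rule poly_mapping_eqI) (metis assms lookup_single_times mult_1)

lemma poly_mapping_sum_singles:
  "(f :: 'a \<Rightarrow>\<^sub>0 'k::comm_monoid_add) =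
    (\<Sum>t\<in>Poly_Mapping.keys f. Poly_Mapping.single t (Poly_Mapping.lookup f t))"
proof (rule poly_mapping_eqI)
  fix k
  show "Poly_Mapping.lookup f k = Poly_Mapping.lookup
      (\<Sum>t\<in>Poly_Mapping.keys f. Poly_Mapping.single t (Poly_Mapping.lookup f t)) k"
    by (simp add: lookup_sum lookup_single when_def in_keys_iff)
qed

lemma monomial_dvd_iff:
  fixes f :: "('v \<Rightarrow>\<^sub>0 nat) \<Rightarrow>\<^sub>0 'k::comm_ring_1"
  shows "monomial s dvd f \<longleftrightarrow> (\<forall>t\<in>Poly_Mapping.keys f. \<exists>u. t = s + u)"
proof
  assume "monomial s dvd f"
  then show "\<forall>t\<in>Poly_Mapping.keys f. \<exists>u. t = s + u"
    by (auto simp: dvd_def keys_monomial_times)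
next
  assume *: "\<forall>t\<in>Poly_Mapping.keys f. \<exists>u. t = s + u"
  have "monomial s dvd (\<Sum>t\<in>Poly_Mapping.keys f. Poly_Mapping.single t (Poly_Mapping.lookup f t))"
  proof (rule dvd_sum)
    fix t assume "t \<in> Poly_Mapping.keys f"
    with * obtain u where "t = s + u" by blast
    then have "Poly_Mapping.single t (Poly_Mapping.lookup f t) =
        monomial s * Poly_Mapping.single u (Poly_Mapping.lookup f t)"
      by (simp add: mult_single)
    then show "monomial s dvd Poly_Mapping.single t (Poly_Mapping.lookup f t)" by simp
  qed
  then show "monomial s dvd f" using poly_mapping_sum_singles[of f] by simp
qed

lemma exponent_le_iff:
  fixes s t :: "'v \<Rightarrow>\<^sub>0 nat"
  shows "(\<exists>u. t = s + u) \<longleftrightarrow> (\<forall>v. Poly_Mapping.lookup s v \<le> Poly_Mapping.lookup t v)"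
proof
  assume "\<forall>v. Poly_Mapping.lookup s v \<le> Poly_Mapping.lookup t v"
  then have "t = s + (t - s)"
    by (intro poly_mapping_eqI) (simp add: lookup_add minus_poly_mapping.rep_eq)
  then show "\<exists>u. t = s + u" by blast
qed (auto simp: lookup_add)

section \<open>Degrees and homogeneous components\<close>

lemma monomial_degree_superset:
  "finite A \<Longrightarrow> Poly_Mapping.keys t \<subseteq> A \<Longrightarrow> monomial_degree t = (\<Sum>v\<in>A. Poly_Mapping.lookup t v)"
  unfolding monomial_degree_def by (rule sum.mono_neutral_left) (auto simp: in_keys_iff)

lemma monomial_degree_zero [simp]: "monomial_degree 0 = 0"
  by (simp add: monomial_degree_def)

lemma monomial_degree_single [simp]: "monomial_degree (Poly_Mapping.single v n) = n"
  by (simp add: monomial_degree_def)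

lemma monomial_degree_add [simp]:
  "monomial_degree (s + t) = monomial_degree s + monomial_degree t"
proof -
  let ?A = "Poly_Mapping.keys s \<union> Poly_Mapping.keys t"
  have "Poly_Mapping.keys (s + t) \<subseteq> ?A" by (rule keys_add)
  then show ?thesis
    by (simp add: monomial_degree_superset[of ?A] lookup_add sum.distrib)
qed

lemma monomial_degree_sum: "monomial_degree (sum f A) = (\<Sum>a\<in>A. monomial_degree (f a))"
  by (induction A rule: infinite_finite_induct) auto

lemma monomial_degree_eq_0_iff [simp]: "monomial_degree t = 0 \<longleftrightarrow> t = 0"
  by (auto simp: monomial_degree_def in_keys_iff intro!: poly_mapping_eqI)

lemma homogeneous_zero [simp]: "homogeneous d 0"
  by (simp add: homogeneous_def)

lemma homogeneous_add: "homogeneous d f \<Longrightarrow> homogeneous d g \<Longrightarrow> homogeneous d (f + g)"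
  unfolding homogeneous_def using keys_add[of f g] by blast

lemma homogeneous_uminus: "homogeneous d f \<Longrightarrow> homogeneous d (- f)"
  by (simp add: homogeneous_def in_keys_iff)

lemma homogeneous_diff: "homogeneous d f \<Longrightarrow> homogeneous d g \<Longrightarrow> homogeneous d (f - g)"
  using homogeneous_add[of d f "- g"] homogeneous_uminus[of d g] by simp

lemma homogeneous_sum: "(\<And>a. a \<in> A \<Longrightarrow> homogeneous d (f a)) \<Longrightarrow> homogeneous d (sum f A)"
  by (induction A rule: infinite_finite_induct) (auto intro: homogeneous_add)

lemma homogeneous_times:
  assumes "homogeneous d f" "homogeneous e g"
  shows "homogeneous (d + e) (f * g)"
  unfolding homogeneous_def
proof
  fix t assume "t \<in> Poly_Mapping.keys (f * g)"
  then obtain a b where "t = a + b" "a \<in> Poly_Mapping.keys f" "b \<in> Poly_Mapping.keys g"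
    using keys_mult[of f g] by blast
  then show "int (monomial_degree t) = d + e"
    using assms by (auto simp: homogeneous_def)
qed

lemma homogeneous_monomial: "homogeneous d (monomial t) \<longleftrightarrow> int (monomial_degree t) = d"
  by (simp add: homogeneous_def)

lemma homogeneous_one: "homogeneous 0 1"
  by (simp add: homogeneous_def)

lemma homogeneous_unique: "homogeneous d f \<Longrightarrow> homogeneous e f \<Longrightarrow> f \<noteq> 0 \<Longrightarrow> d = e"
  by (auto simp: homogeneous_def poly_mapping_eq_iff fun_eq_iff in_keys_iff)

definition homogeneous_component :: "int \<Rightarrow> ('v, 'k::comm_ring_1) mpoly \<Rightarrow> ('v, 'k) mpoly" where
  "homogeneous_component d f = (\<Sum>t\<in>{t\<in>Poly_Mapping.keys f. int (monomial_degree t) = d}.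
      Poly_Mapping.single t (Poly_Mapping.lookup f t))"

lemma lookup_homogeneous_component:
  "Poly_Mapping.lookup (homogeneous_component d f) t = (Poly_Mapping.lookup f t when int (monomial_degree t) = d)"
  by (auto simp: homogeneous_component_def lookup_sum lookup_single when_def in_keys_iff sum.delta)

lemma keys_homogeneous_component: "Poly_Mapping.keys (homogeneous_component d f) = {t\<in>Poly_Mapping.keys f. int (monomial_degree t) = d}"
  by (auto simp: in_keys_iff lookup_homogeneous_component)

lemma homogeneous_homogeneous_component: "homogeneous d (homogeneous_component d f)"
  by (auto simp: homogeneous_def keys_homogeneous_component)

lemma homogeneous_component_zero [simp]: "homogeneous_component d 0 = 0"
  by (simp add: homogeneous_component_def)

lemma homogeneous_component_sum: "homogeneous_component d (sum f A) = (\<Sum>a\<in>A. homogeneous_component d (f a))"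
  by (intro poly_mapping_eqI) (simp add: lookup_homogeneous_component lookup_sum when_def)

lemma homogeneous_component_homogeneous: "homogeneous d f \<Longrightarrow> homogeneous_component d f = f"
  by (rule poly_mapping_eqI) (auto simp: lookup_homogeneous_component when_def homogeneous_def in_keys_iff)

text \<open>Multiplication by a homogeneous polynomial shifts degrees. This is what makes it possible to pass
  from solutions of a homogeneous linear system to homogeneous solutions.\<close>

lemma homogeneous_component_times:
  assumes "homogeneous e D"
  shows "homogeneous_component d (D * c) = D * homogeneous_component (d - e) c"
proof (rule poly_mapping_eqI)
  fix t
  let ?K = "Poly_Mapping.keys D" and ?L = "Poly_Mapping.keys c"
  have 1: "Poly_Mapping.lookup (D * c) t =
      (\<Sum>a\<in>?K. \<Sum>b\<in>?L. Poly_Mapping.lookup D a * Poly_Mapping.lookup c b when t = a + b)"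
    by (rule lookup_times_finite) auto
  have 2: "Poly_Mapping.lookup (D * homogeneous_component (d - e) c) t =
      (\<Sum>a\<in>?K. \<Sum>b\<in>?L. Poly_Mapping.lookup D a * Poly_Mapping.lookup (homogeneous_component (d - e) c) b when t = a + b)"
    by (rule lookup_times_finite) (auto simp: keys_homogeneous_component)
  have 3: "int (monomial_degree a) = e" if "a \<in> ?K" for a
    using assms that by (auto simp: homogeneous_def)
  show "Poly_Mapping.lookup (homogeneous_component d (D * c)) t = Poly_Mapping.lookup (D * homogeneous_component (d - e) c) t"
  proof (cases "int (monomial_degree t) = d")
    case True
    then show ?thesis unfolding lookup_homogeneous_component 1 2
      by (auto intro!: sum.cong simp: when_def 3)
  next
    case False
    then show ?thesis unfolding lookup_homogeneous_component 1 2
      by (auto intro!: sum.neutral[symmetric] sum.neutral simp: when_def 3)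
  qed
qed

section \<open>Constant coefficients and the irrelevant ideal\<close>

lemma exponent_add_eq_0_iff: "s + t = 0 \<longleftrightarrow> s = 0 \<and> t = (0 :: 'v \<Rightarrow>\<^sub>0 nat)"
  by (metis add_is_0 monomial_degree_add monomial_degree_eq_0_iff)

lemma lookup_times_0:
  fixes f g :: "('v, 'k::comm_ring_1) mpoly"
  shows "Poly_Mapping.lookup (f * g) 0 = Poly_Mapping.lookup f 0 * Poly_Mapping.lookup g 0"
proof -
  let ?A = "insert 0 (Poly_Mapping.keys f)" and ?B = "insert 0 (Poly_Mapping.keys g)"
  have "Poly_Mapping.lookup (f * g) 0 =
      (\<Sum>a\<in>?A. \<Sum>b\<in>?B. Poly_Mapping.lookup f a * Poly_Mapping.lookup g b when 0 = a + b)"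
    by (rule lookup_times_finite) auto
  also have "\<dots> = (\<Sum>a\<in>?A. \<Sum>b\<in>?B. if b = 0 then (if a = 0 then Poly_Mapping.lookup f a * Poly_Mapping.lookup g b else 0) else 0)"
    by (intro sum.cong refl) (auto simp: when_def exponent_add_eq_0_iff eq_commute[of 0])
  also have "\<dots> = Poly_Mapping.lookup f 0 * Poly_Mapping.lookup g 0"
    by (simp add: sum.delta del: sum.insert)
  finally show ?thesis .
qed

text \<open>Minimality of a resolution is used only through this consequence: taking constant coefficients is
  a ring homomorphism (\<open>lookup_times_0\<close>), and it kills the differentials.\<close>

lemma irrelevant_ideal_lookup_0:
  fixes f :: "('v, 'k::comm_ring_1) mpoly"
  assumes "f \<in> irrelevant_ideal"
  shows "Poly_Mapping.lookup f 0 = 0"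
proof -
  have "ring_module.subspace {f :: ('v, 'k) mpoly. Poly_Mapping.lookup f 0 = 0}"
    by (auto simp: ring_module.subspace_def lookup_add lookup_times_0)
  moreover have "range Var \<subseteq> {f :: ('v, 'k) mpoly. Poly_Mapping.lookup f 0 = 0}"
    by (auto simp: Var_def lookup_single when_def poly_mapping_eq_iff fun_eq_iff)
  ultimately show ?thesis
    using assms ring_module.span_minimal unfolding irrelevant_ideal_def by blast
qed

lemma monomial_in_irrelevant_ideal:
  assumes "t \<noteq> 0"
  shows "monomial t \<in> irrelevant_ideal"
proof -
  obtain v where "Poly_Mapping.lookup t v \<noteq> 0"
    using assms by (auto simp: poly_mapping_eq_iff fun_eq_iff)
  then have "\<exists>u. t = Poly_Mapping.single v 1 + u"
    unfolding exponent_le_iff by (auto simp: lookup_single when_def)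
  then obtain u where "t = Poly_Mapping.single v 1 + u" ..
  then have "monomial t = monomial u * Var v"
    by (simp add: Var_def mult_single add.commute)
  also have "\<dots> \<in> irrelevant_ideal"
    unfolding irrelevant_ideal_def
    by (intro ring_module.span_scale ring_module.span_base) auto
  finally show ?thesis .
qed

section \<open>Ideals spanned by monomials\<close>

text \<open>All ideals of the proof are of this kind. Membership is then a condition on the
  exponents, and ideals can be compared by comparing sets of exponents.\<close>

lemma subspace_keys_subset:
  assumes "\<And>t u. t \<in> M \<Longrightarrow> u + t \<in> M"
  shows "is_ideal {f :: 'a::comm_monoid_add \<Rightarrow>\<^sub>0 'k::comm_ring_1. Poly_Mapping.keys f \<subseteq> M}"
proof (rule ring_module.subspaceI)
  fix f g :: "'a \<Rightarrow>\<^sub>0 'k"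
  show "f + g \<in> {f. Poly_Mapping.keys f \<subseteq> M}"
    if "f \<in> {f. Poly_Mapping.keys f \<subseteq> M}" "g \<in> {f. Poly_Mapping.keys f \<subseteq> M}"
    using that keys_add[of f g] by blast
  show "g * f \<in> {f. Poly_Mapping.keys f \<subseteq> M}" if "f \<in> {f. Poly_Mapping.keys f \<subseteq> M}"
    using that keys_mult[of g f] assms by fastforce
qed auto

lemma in_ideal_if_monomials:
  fixes I :: "('a::comm_monoid_add \<Rightarrow>\<^sub>0 'k::comm_ring_1) set"
  assumes "is_ideal I" "\<And>t. t \<in> Poly_Mapping.keys f \<Longrightarrow> monomial t \<in> I"
  shows "f \<in> I"
proof -
  have "(\<Sum>t\<in>Poly_Mapping.keys f. Poly_Mapping.single t (Poly_Mapping.lookup f t)) \<in> I"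
  proof (rule ring_module.subspace_sum[OF assms(1)])
    fix t assume "t \<in> Poly_Mapping.keys f"
    then have "Poly_Mapping.single 0 (Poly_Mapping.lookup f t) * monomial t \<in> I"
      by (intro ring_module.subspace_scale assms)
    then show "Poly_Mapping.single t (Poly_Mapping.lookup f t) \<in> I"
      by (simp add: mult_single)
  qed
  then show ?thesis using poly_mapping_sum_singles[of f] by simp
qed

section \<open>Symbolic powers of cover ideals\<close>

definition degree_in :: "'v set \<Rightarrow> ('v::finite \<Rightarrow>\<^sub>0 nat) \<Rightarrow> nat" where
  "degree_in e t = (\<Sum>v\<in>e. Poly_Mapping.lookup t v)"

lemma degree_in_add: "degree_in e (s + t) = degree_in e s + degree_in e t"
  by (simp add: degree_in_def lookup_add sum.distrib)

lemma degree_in_pos_iff: "0 < degree_in e t \<longleftrightarrow> (\<exists>v\<in>e. 0 < Poly_Mapping.lookup t v)"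
  unfolding degree_in_def zero_less_iff_neq_zero by (subst sum_eq_0_iff) auto

text \<open>The support of a product of polynomials can be controlled at extremal exponents: maximizing one
  coordinate after the other shrinks the two supports to faces such that a sum of two elements
  of the faces has no other representation. This replaces a monomial order, for which the
  variables would have to be ordered.\<close>

lemma extremal_faces:
  fixes K L :: "('v \<Rightarrow>\<^sub>0 nat) set"
  assumes "finite V" "finite K" "K \<noteq> {}" "finite L" "L \<noteq> {}"
  shows "\<exists>K' L'. K' \<subseteq> K \<and> L' \<subseteq> L \<and> K' \<noteq> {} \<and> L' \<noteq> {} \<and>
    (\<forall>s\<in>K'. \<forall>t\<in>K'. \<forall>v\<in>V. Poly_Mapping.lookup s v = Poly_Mapping.lookup t v) \<and>
    (\<forall>s\<in>L'. \<forall>t\<in>L'. \<forall>v\<in>V. Poly_Mapping.lookup s v = Poly_Mapping.lookup t v) \<and>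
    (\<forall>s\<in>K'. \<forall>t\<in>L'. \<forall>s'\<in>K. \<forall>t'\<in>L. s' + t' = s + t \<longrightarrow> s' \<in> K' \<and> t' \<in> L')"
  using assms(1)
proof (induction V)
  case empty
  show ?case using assms by (intro exI[of _ K] exI[of _ L]) simp
next
  case (insert v V)
  then obtain K' L' where *: "K' \<subseteq> K" "L' \<subseteq> L" "K' \<noteq> {}" "L' \<noteq> {}"
    "\<forall>s\<in>K'. \<forall>t\<in>K'. \<forall>v\<in>V. Poly_Mapping.lookup s v = Poly_Mapping.lookup t v"
    "\<forall>s\<in>L'. \<forall>t\<in>L'. \<forall>v\<in>V. Poly_Mapping.lookup s v = Poly_Mapping.lookup t v"
    "\<forall>s\<in>K'. \<forall>t\<in>L'. \<forall>s'\<in>K. \<forall>t'\<in>L. s' + t' = s + t \<longrightarrow> s' \<in> K' \<and> t' \<in> L'"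
    by (elim exE conjE)
  let ?l = "\<lambda>s. Poly_Mapping.lookup s v"
  have fin: "finite K'" "finite L'" using *(1,2) assms(2,4) by (auto intro: finite_subset)
  define k where "k = Max (?l ` K')"
  define l where "l = Max (?l ` L')"
  have k: "?l s \<le> k" if "s \<in> K'" for s using that fin by (simp add: k_def)
  have l: "?l s \<le> l" if "s \<in> L'" for s using that fin by (simp add: l_def)
  have "k \<in> ?l ` K'" "l \<in> ?l ` L'" unfolding k_def l_def using fin *(3,4) by (intro Max_in; simp)+
  then have ne: "{s\<in>K'. ?l s = k} \<noteq> {}" "{s\<in>L'. ?l s = l} \<noteq> {}" by auto
  have step: "s' \<in> {s\<in>K'. ?l s = k} \<and> t' \<in> {s\<in>L'. ?l s = l}"
    if "s \<in> {s\<in>K'. ?l s = k}" "t \<in> {s\<in>L'. ?l s = l}" "s' \<in> K" "t' \<in> L" "s' + t' = s + t" for s t s' t'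
  proof -
    have m: "s' \<in> K'" "t' \<in> L'" using that *(7) by blast+
    have "?l s' + ?l t' = k + l" using that(1,2) arg_cong[OF that(5), of ?l] by (simp add: lookup_add)
    then show ?thesis using k[OF m(1)] l[OF m(2)] m by auto
  qed
  have face: "\<forall>s\<in>{s\<in>K'. ?l s = k}. \<forall>t\<in>{s\<in>L'. ?l s = l}. \<forall>s'\<in>K. \<forall>t'\<in>L. s' + t' = s + t \<longrightarrow>
      s' \<in> {s\<in>K'. ?l s = k} \<and> t' \<in> {s\<in>L'. ?l s = l}"
    by (intro ballI impI, rule step; assumption)
  show ?case
  proof (intro exI conjI)
    show "{s\<in>K'. ?l s = k} \<subseteq> K" "{s\<in>L'. ?l s = l} \<subseteq> L" using *(1,2) by auto
    show "{s\<in>K'. ?l s = k} \<noteq> {}" "{s\<in>L'. ?l s = l} \<noteq> {}" by (fact ne)+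
    show "\<forall>s\<in>{s\<in>K'. ?l s = k}. \<forall>t\<in>{s\<in>K'. ?l s = k}. \<forall>w\<in>insert v V.
        Poly_Mapping.lookup s w = Poly_Mapping.lookup t w"
    proof (intro ballI)
      fix s t w
      assume "s \<in> {s\<in>K'. ?l s = k}" "t \<in> {s\<in>K'. ?l s = k}" "w \<in> insert v V"
      then show "Poly_Mapping.lookup s w = Poly_Mapping.lookup t w"
        using *(5)[rule_format, of s t w] by (cases "w = v") auto
    qed
    show "\<forall>s\<in>{s\<in>L'. ?l s = l}. \<forall>t\<in>{s\<in>L'. ?l s = l}. \<forall>w\<in>insert v V.
        Poly_Mapping.lookup s w = Poly_Mapping.lookup t w"
    proof (intro ballI)
      fix s t w
      assume "s \<in> {s\<in>L'. ?l s = l}" "t \<in> {s\<in>L'. ?l s = l}" "w \<in> insert v V"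
      then show "Poly_Mapping.lookup s w = Poly_Mapping.lookup t w"
        using *(6)[rule_format, of s t w] by (cases "w = v") auto
    qed
  qed (fact face)
qed

lemma unique_sum_pair:
  fixes K L :: "('v::finite \<Rightarrow>\<^sub>0 nat) set"
  assumes "finite K" "K \<noteq> {}" "finite L" "L \<noteq> {}"
  obtains s t where "s \<in> K" "t \<in> L" "\<And>s' t'. s' \<in> K \<Longrightarrow> t' \<in> L \<Longrightarrow> s' + t' = s + t \<Longrightarrow> s' = s \<and> t' = t"
proof -
  obtain K' L' where *: "K' \<subseteq> K" "L' \<subseteq> L" "K' \<noteq> {}" "L' \<noteq> {}"
    "\<forall>s\<in>K'. \<forall>t\<in>K'. \<forall>v\<in>UNIV. Poly_Mapping.lookup s v = Poly_Mapping.lookup t v"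
    "\<forall>s\<in>L'. \<forall>t\<in>L'. \<forall>v\<in>UNIV. Poly_Mapping.lookup s v = Poly_Mapping.lookup t v"
    "\<forall>s\<in>K'. \<forall>t\<in>L'. \<forall>s'\<in>K. \<forall>t'\<in>L. s' + t' = s + t \<longrightarrow> s' \<in> K' \<and> t' \<in> L'"
    using extremal_faces[OF finite_UNIV assms] by (elim exE conjE)
  obtain s t where st: "s \<in> K'" "t \<in> L'" using *(3,4) by blast
  have K: "s' = s" if "s' \<in> K'" for s'
    by (rule poly_mapping_eqI) (rule *(5)[rule_format, OF that st(1) UNIV_I])
  have L: "t' = t" if "t' \<in> L'" for t'
    by (rule poly_mapping_eqI) (rule *(6)[rule_format, OF that st(2) UNIV_I])
  show ?thesis
  proof (rule that[of s t])
    show "s \<in> K" "t \<in> L" using st *(1,2) by blast+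
    show "s' = s \<and> t' = t" if "s' \<in> K" "t' \<in> L" "s' + t' = s + t" for s' t'
      using *(7)[rule_format, OF st that] K L by simp
  qed
qed

text \<open>This is the \<open>N\<close>-th power of the prime ideal generated by the variables in \<open>e\<close>.\<close>

definition order_ideal :: "'v set \<Rightarrow> nat \<Rightarrow> ('v::finite, 'k::comm_ring_1) mpoly set" where
  "order_ideal e N = {f. \<forall>t\<in>Poly_Mapping.keys f. N \<le> degree_in e t}"

lemma order_ideal_alt: "order_ideal e N = {f. Poly_Mapping.keys f \<subseteq> {t. N \<le> degree_in e t}}"
  by (auto simp: order_ideal_def)

lemma is_ideal_order_ideal: "is_ideal (order_ideal e N)"
  unfolding order_ideal_alt by (rule subspace_keys_subset) (auto simp: degree_in_add)

text \<open>The order of vanishing along the variables in \<open>e\<close> is additive, because the leading forms of the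
  factors have a nonzero product. This one lemma shows that the ideal generated by the variables in \<open>e\<close> is
  prime and that its powers are primary.\<close>

lemma order_ideal_cancel:
  fixes f g :: "('v::finite, 'k::idom) mpoly"
  assumes "g * f \<in> order_ideal e N" "g \<notin> order_ideal e 1"
  shows "f \<in> order_ideal e N"
proof (rule ccontr)
  assume "f \<notin> order_ideal e N"
  then obtain t0 where t0: "t0 \<in> Poly_Mapping.keys f" "degree_in e t0 < N"
    by (auto simp: order_ideal_def not_le)
  \<comment> \<open>Compare the part of least order of \<open>f\<close> with the part of order 0 of \<open>g\<close>.\<close>
  define r where "r = Min (degree_in e ` Poly_Mapping.keys f)"
  have r: "r \<le> degree_in e t" if "t \<in> Poly_Mapping.keys f" for t using that by (simp add: r_def)
  have "r < N" using r t0 by (meson le_less_trans)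
  have "r \<in> degree_in e ` Poly_Mapping.keys f" unfolding r_def using t0 by (intro Min_in) auto
  then have L: "{t\<in>Poly_Mapping.keys f. degree_in e t = r} \<noteq> {}" by auto
  have K: "{t\<in>Poly_Mapping.keys g. degree_in e t = 0} \<noteq> {}"
    using assms(2) by (auto simp: order_ideal_def not_le)
  obtain s t where st: "s \<in> {t\<in>Poly_Mapping.keys g. degree_in e t = 0}"
    "t \<in> {t\<in>Poly_Mapping.keys f. degree_in e t = r}"
    "\<And>s' t'. s' \<in> {t\<in>Poly_Mapping.keys g. degree_in e t = 0} \<Longrightarrow>
      t' \<in> {t\<in>Poly_Mapping.keys f. degree_in e t = r} \<Longrightarrow> s' + t' = s + t \<Longrightarrow> s' = s \<and> t' = t"
    by (rule unique_sum_pair[OF _ K _ L]) auto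
  have uniq: "a = s \<and> b = t" if "a \<in> Poly_Mapping.keys g" "b \<in> Poly_Mapping.keys f" "s + t = a + b" for a b
  proof -
    have "degree_in e a + degree_in e b = r"
      using st(1,2) arg_cong[OF that(3), of "degree_in e"] by (simp add: degree_in_add)
    with r[OF that(2)] show ?thesis using that by (intro st(3)) auto
  qed
  have "Poly_Mapping.lookup (g * f) (s + t) = (\<Sum>a\<in>Poly_Mapping.keys g. \<Sum>b\<in>Poly_Mapping.keys f.
      Poly_Mapping.lookup g a * Poly_Mapping.lookup f b when s + t = a + b)"
    by (rule lookup_times_finite) auto
  also have "\<dots> = (\<Sum>a\<in>Poly_Mapping.keys g. \<Sum>b\<in>Poly_Mapping.keys f.
      if b = t then (if a = s then Poly_Mapping.lookup g a * Poly_Mapping.lookup f b else 0) else 0)"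
    by (intro sum.cong refl) (use uniq in \<open>auto simp: when_def\<close>)
  also have "\<dots> = Poly_Mapping.lookup g s * Poly_Mapping.lookup f t"
    using st(1,2) by (simp add: sum.delta)
  also have "\<dots> \<noteq> 0" using st(1,2) by (simp add: in_keys_iff)
  finally have "s + t \<in> Poly_Mapping.keys (g * f)" by (simp add: in_keys_iff)
  with assms(1) have "N \<le> degree_in e (s + t)" by (simp add: order_ideal_def)
  with st(1,2) \<open>r < N\<close> show False by (simp add: degree_in_add)
qed

lemma prime_order_ideal_1: "is_prime_ideal (order_ideal e 1 :: ('v::finite, 'k::idom) mpoly set)"
proof -
  have "(1 :: ('v, 'k) mpoly) \<notin> order_ideal e 1"
    by (simp add: order_ideal_def degree_in_def)
  then show ?thesis
    unfolding is_prime_ideal_def using is_ideal_order_ideal order_ideal_cancel by blast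
qed

lemma ideal_gen_Var: "ideal_gen (Var ` e) = order_ideal e 1"
proof
  have "Var ` e \<subseteq> order_ideal e 1"
    by (auto simp: order_ideal_def Var_def degree_in_def lookup_single when_def sum.delta)
  then show "ideal_gen (Var ` e) \<subseteq> order_ideal e 1"
    by (rule ring_module.span_minimal[OF _ is_ideal_order_ideal])
  show "order_ideal e 1 \<subseteq> (ideal_gen (Var ` e) :: ('a::finite, 'b::comm_ring_1) mpoly set)"
  proof
    fix f :: "('a, 'b) mpoly" assume f: "f \<in> order_ideal e 1"
    show "f \<in> ideal_gen (Var ` e)"
    proof (rule in_ideal_if_monomials)
      fix t assume "t \<in> Poly_Mapping.keys f"
      with f have "1 \<le> degree_in e t" by (auto simp: order_ideal_def)
      then obtain v where v: "v \<in> e" "Poly_Mapping.lookup t v \<noteq> 0"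
        by (auto simp: Suc_le_eq degree_in_pos_iff)
      then have "\<exists>u. t = Poly_Mapping.single v 1 + u"
        unfolding exponent_le_iff by (auto simp: lookup_single when_def)
      then obtain u where "t = Poly_Mapping.single v 1 + u" ..
      then have "monomial t = monomial u * Var v"
        by (simp add: Var_def mult_single add.commute)
      also have "\<dots> \<in> ideal_gen (Var ` e)"
        using v by (intro ring_module.span_scale ring_module.span_base) auto
      finally show "monomial t \<in> ideal_gen (Var ` e)" .
    qed simp
  qed
qed

lemma cover_ideal_eq: "cover_ideal E = (\<Inter>e\<in>E. order_ideal e 1)"
  by (simp add: cover_ideal_def ideal_gen_Var)

lemma prime_ideal_prod_notin:
  assumes "is_prime_ideal Q" "finite A" "\<And>a. a \<in> A \<Longrightarrow> f a \<notin> Q"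
  shows "prod f A \<notin> Q"
  using assms(2,3)
proof (induction A)
  case empty
  show ?case
  proof
    assume "prod f {} \<in> Q"
    then have "x * 1 \<in> Q" for x
      using assms(1) ring_module.subspace_scale[of Q] unfolding is_prime_ideal_def by fastforce
    then show False using assms(1) by (auto simp: is_prime_ideal_def)
  qed
next
  case (insert a A)
  then show ?case using assms(1) by (auto simp: is_prime_ideal_def)
qed

text \<open>Otherwise the product of elements \<open>f e\<close> of \<open>I e\<close> outside \<open>Q\<close> would lie in the intersection.\<close>

lemma prime_over_finite_Inter:
  assumes Q: "is_prime_ideal Q" and "finite E" and sub: "(\<Inter>e\<in>E. I e) \<subseteq> Q"
    and I: "\<And>e. e \<in> E \<Longrightarrow> is_ideal (I e)"
  shows "\<exists>e\<in>E. I e \<subseteq> Q"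
proof (rule ccontr)
  assume "\<not> (\<exists>e\<in>E. I e \<subseteq> Q)"
  then have "\<forall>e\<in>E. \<exists>f. f \<in> I e \<and> f \<notin> Q" by blast
  then obtain f where f: "\<And>e. e \<in> E \<Longrightarrow> f e \<in> I e \<and> f e \<notin> Q" by metis
  have "prod f E \<in> I e" if "e \<in> E" for e
  proof -
    have "prod f E = prod f (E - {e}) * f e"
      using \<open>finite E\<close> that by (simp add: prod.remove mult.commute)
    then show ?thesis using f[OF that] ring_module.subspace_scale[OF I[OF that]] by simp
  qed
  then have "prod f E \<in> Q" using sub by blast
  then show False using prime_ideal_prod_notin[OF Q \<open>finite E\<close>] f by blast
qed

lemma order_ideal_1_subset:
  assumes "order_ideal e 1 \<subseteq> (order_ideal e' 1 :: ('v::finite, 'k::comm_ring_1) mpoly set)"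
  shows "e \<subseteq> e'"
proof
  fix v assume v: "v \<in> e"
  have "(Var v :: ('v, 'k) mpoly) \<in> order_ideal e' 1"
    using assms v by (subst (asm) ideal_gen_Var[symmetric]) (auto intro: ring_module.span_base)
  then show "v \<in> e'"
    by (auto simp: order_ideal_def Var_def degree_in_def lookup_single when_def sum.delta split: if_splits)
qed

lemma minimal_primes_cover_ideal:
  assumes "\<And>e. e \<in> E \<Longrightarrow> card e = 2"
  shows "minimal_primes (cover_ideal E :: ('v::finite, 'k::idom) mpoly set) = (\<lambda>e. order_ideal e 1) ` E"
proof -
  let ?J = "cover_ideal E :: ('v, 'k) mpoly set"
  have sub: "?J \<subseteq> order_ideal e 1" if "e \<in> E" for e
    using that by (auto simp: cover_ideal_eq)
  have over: "\<exists>e\<in>E. order_ideal e 1 \<subseteq> Q" if "is_prime_ideal Q" "?J \<subseteq> Q" for Q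
    using prime_over_finite_Inter[OF that(1) finite that(2)[unfolded cover_ideal_eq]] is_ideal_order_ideal
    by blast
  show ?thesis
  proof (intro equalityI subsetI)
    fix P assume P: "P \<in> minimal_primes ?J"
    then obtain e where "e \<in> E" "order_ideal e 1 \<subseteq> P"
      using over unfolding minimal_primes_def by blast
    then have "order_ideal e 1 = P"
      using P sub prime_order_ideal_1 unfolding minimal_primes_def by blast
    then show "P \<in> (\<lambda>e. order_ideal e 1) ` E" using \<open>e \<in> E\<close> by blast
  next
    fix P assume "P \<in> (\<lambda>e. order_ideal e 1 :: ('v, 'k) mpoly set) ` E"
    then obtain e where e: "e \<in> E" "P = order_ideal e 1" by blast
    have minimal: "Q = P" if Q: "is_prime_ideal Q" "?J \<subseteq> Q" "Q \<subseteq> P" for Q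
    proof -
      obtain e' where e': "e' \<in> E" "order_ideal e' 1 \<subseteq> Q" using over Q by blast
      then have "e' \<subseteq> e" using Q e order_ideal_1_subset by blast
      then have "e' = e" using assms e e' by (metis card_subset_eq finite)
      then show ?thesis using e e' Q by blast
    qed
    have "is_prime_ideal P" "?J \<subseteq> P"
      using prime_order_ideal_1 sub[OF e(1)] by (simp_all only: e(2))
    then show "P \<in> minimal_primes ?J"
      using minimal by (simp add: minimal_primes_def)
  qed
qed

lemma is_ideal_ideal_power: "is_ideal (ideal_power I n)"
  by (cases n) auto

lemma ideal_power_cover_ideal_subset:
  assumes "e \<in> E"
  shows "ideal_power (cover_ideal E) N \<subseteq> (order_ideal e N :: ('v::finite, 'k::comm_ring_1) mpoly set)"
proof (induction N)
  case 0
  show ?case by (auto simp: order_ideal_def)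
next
  case (Suc N)
  have "{a * b |a b. a \<in> cover_ideal E \<and> b \<in> ideal_power (cover_ideal E) N} \<subseteq>
      (order_ideal e (Suc N) :: ('v, 'k) mpoly set)"
  proof clarify
    fix a b :: "('v, 'k) mpoly" assume ab: "a \<in> cover_ideal E" "b \<in> ideal_power (cover_ideal E) N"
    then have "a \<in> order_ideal e 1" using assms unfolding cover_ideal_eq by blast
    moreover have "b \<in> order_ideal e N" using Suc ab by blast
    ultimately show "a * b \<in> order_ideal e (Suc N)"
      using keys_mult[of a b] by (fastforce simp: order_ideal_def degree_in_add)
  qed
  then show ?case by (simp add: ring_module.span_minimal is_ideal_order_ideal)
qed

text \<open>The complement of \<open>e\<close> together with one vertex of \<open>e\<close> is a vertex cover, since no other edge is
  contained in \<open>e\<close>. The product of its variables lies in the cover ideal, and the hypotheses allow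
  to split off \<open>N\<close> such products.\<close>

lemma monomial_in_ideal_power_cover_ideal:
  assumes E: "\<And>e. e \<in> E \<Longrightarrow> card e = 2" and "e \<in> E"
    and "N \<le> degree_in e t" "\<And>w. w \<notin> e \<Longrightarrow> N \<le> Poly_Mapping.lookup t w"
  shows "(monomial t :: ('v::finite, 'k::comm_ring_1) mpoly) \<in> ideal_power (cover_ideal E) N"
  using assms(3,4)
proof (induction N arbitrary: t)
  case 0
  show ?case by simp
next
  case (Suc N)
  have "degree_in e t > 0" using Suc.prems by linarith
  then obtain u where u: "u \<in> e" "Poly_Mapping.lookup t u > 0"
    by (auto simp: degree_in_pos_iff)
  \<comment> \<open>The indicator of a vertex cover.\<close>
  define s :: "'v \<Rightarrow>\<^sub>0 nat" where "s = (\<Sum>w\<in>insert u (- e). Poly_Mapping.single w 1)"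
  have s: "Poly_Mapping.lookup s x = (if x = u \<or> x \<notin> e then 1 else 0)" for x
    by (auto simp: s_def lookup_sum lookup_single when_def sum.delta)
  have "\<exists>t'. t = s + t'"
    unfolding exponent_le_iff using u Suc.prems by (auto simp: s intro: order_trans[of _ "Suc N"])
  then obtain t' where t': "t = s + t'" ..
  have ds: "degree_in e s = 1"
    using u by (simp add: degree_in_def s sum.delta)
  have "(monomial t' :: ('v, 'k) mpoly) \<in> ideal_power (cover_ideal E) N"
  proof (rule Suc.IH)
    show "N \<le> degree_in e t'" using Suc.prems(1) ds by (simp add: t' degree_in_add)
    show "N \<le> Poly_Mapping.lookup t' w" if "w \<notin> e" for w
      using Suc.prems(2)[OF that] that by (simp add: t' lookup_add s)
  qed
  moreover have "(monomial s :: ('v, 'k) mpoly) \<in> cover_ideal E"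
  proof -
    have "\<exists>w\<in>e'. Poly_Mapping.lookup s w > 0" if "e' \<in> E" for e'
    proof (cases "e' \<subseteq> e")
      case True
      then have "e' = e" using E that \<open>e \<in> E\<close> by (metis card_subset_eq finite)
      then show ?thesis using u by (auto simp: s)
    qed (auto simp: s)
    then have "degree_in e' s \<ge> 1" if "e' \<in> E" for e'
      using that by (simp add: Suc_le_eq degree_in_pos_iff)
    then show ?thesis by (auto simp: cover_ideal_eq order_ideal_def)
  qed
  moreover have "monomial t = (monomial s * monomial t' :: ('v, 'k) mpoly)"
    by (simp add: t' mult_single)
  ultimately show ?case by (auto intro: ring_module.span_base)
qed

text \<open>The variables outside \<open>e\<close> are units after localization. Conversely, multiplication by a
  polynomial outside the prime ideal of \<open>e\<close> does not change the order of vanishing.\<close>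

lemma localization_contraction_cover_ideal:
  assumes E: "\<And>e. e \<in> E \<Longrightarrow> card e = 2" and "e \<in> E"
  shows "localization_contraction (ideal_power (cover_ideal E) N) (order_ideal e 1) =
    (order_ideal e N :: ('v::finite, 'k::idom) mpoly set)"
proof (intro equalityI subsetI)
  fix f :: "('v, 'k) mpoly"
  assume "f \<in> localization_contraction (ideal_power (cover_ideal E) N) (order_ideal e 1)"
  then obtain g where "g \<notin> order_ideal e 1" "g * f \<in> ideal_power (cover_ideal E) N"
    by (auto simp: localization_contraction_def)
  then show "f \<in> order_ideal e N"
    using ideal_power_cover_ideal_subset[OF \<open>e \<in> E\<close>] order_ideal_cancel by blast
next
  fix f :: "('v, 'k) mpoly"
  assume f: "f \<in> order_ideal e N"
  define s :: "'v \<Rightarrow>\<^sub>0 nat" where "s = (\<Sum>w\<in>- e. Poly_Mapping.single w N)"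
  have s: "Poly_Mapping.lookup s x = (if x \<notin> e then N else 0)" for x
    by (auto simp: s_def lookup_sum lookup_single when_def sum.delta)
  have ds: "degree_in e s = 0" by (simp add: degree_in_def s)
  have "monomial s * f \<in> ideal_power (cover_ideal E) N"
  proof (rule in_ideal_if_monomials[OF is_ideal_ideal_power])
    fix t assume "t \<in> Poly_Mapping.keys (monomial s * f)"
    then obtain u where u: "t = s + u" "u \<in> Poly_Mapping.keys f" by (auto simp: keys_monomial_times)
    show "monomial t \<in> ideal_power (cover_ideal E) N"
      by (rule monomial_in_ideal_power_cover_ideal[OF E \<open>e \<in> E\<close>])
        (use u f in \<open>auto simp: degree_in_add ds order_ideal_def lookup_add s\<close>)
  qed
  moreover have "monomial s \<notin> (order_ideal e 1 :: ('v, 'k) mpoly set)"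
    by (simp add: order_ideal_def ds)
  ultimately show "f \<in> localization_contraction (ideal_power (cover_ideal E) N) (order_ideal e 1)"
    by (auto simp: localization_contraction_def)
qed

theorem symbolic_power_cover_ideal:
  assumes "\<And>e. e \<in> E \<Longrightarrow> card e = 2"
  shows "symbolic_power (cover_ideal E) N =
    {f :: ('v::finite, 'k::idom) mpoly. Poly_Mapping.keys f \<subseteq> {t. \<forall>e\<in>E. N \<le> degree_in e t}}"
proof -
  have primes: "minimal_primes (cover_ideal E :: ('v, 'k) mpoly set) = (\<lambda>e. order_ideal e 1) ` E"
    using assms by (rule minimal_primes_cover_ideal)
  have "symbolic_power (cover_ideal E) N =
      (\<Inter>e\<in>E. localization_contraction (ideal_power (cover_ideal E) N) (order_ideal e 1 :: ('v, 'k) mpoly set))"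
    by (simp only: symbolic_power_def primes image_image)
  also have "\<dots> = (\<Inter>e\<in>E. order_ideal e N)"
    using assms by (intro INF_cong refl localization_contraction_cover_ideal)
  finally have "symbolic_power (cover_ideal E) N = (\<Inter>e\<in>E. order_ideal e N :: ('v, 'k) mpoly set)" .
  then show ?thesis by (auto simp: order_ideal_def)
qed

section \<open>Comparison of graded free resolutions\<close>

definition unit_vec :: "nat \<Rightarrow> nat \<Rightarrow> 'a::comm_ring_1" where
  "unit_vec q = (\<lambda>p. if p = q then 1 else 0)"

text \<open>Maps between free modules are handled as functions on sequences instead of matrices, so that
  composition needs no sums. The values on the unit vectors are the columns of the matrix.\<close>

definition module_map :: "((nat \<Rightarrow> 'a::comm_ring_1) \<Rightarrow> nat \<Rightarrow> 'a) \<Rightarrow> bool" where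
  "module_map f \<longleftrightarrow>
     (\<forall>x y. f (\<lambda>p. x p + y p) = (\<lambda>p. f x p + f y p)) \<and>
     (\<forall>a x. f (\<lambda>p. a * x p) = (\<lambda>p. a * f x p))"

lemma module_map_add: "module_map f \<Longrightarrow> f (\<lambda>p. x p + y p) p = f x p + f y p"
  and module_map_scale: "module_map f \<Longrightarrow> f (\<lambda>p. a * x p) p = a * f x p"
  by (simp_all add: module_map_def)

lemma module_map_zero: "module_map f \<Longrightarrow> f (\<lambda>_. 0) = (\<lambda>_. 0)"
  using module_map_scale[of f 0 "\<lambda>_. 0"] by (simp add: fun_eq_iff)

lemma module_map_diff:
  assumes "module_map f"
  shows "f (\<lambda>p. x p - y p) p = f x p - f y p"
proof -
  have "f (\<lambda>p. x p + (- 1) * y p) p = f x p + (- 1) * f y p"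
    using module_map_add[OF assms, of x "\<lambda>p. - 1 * y p"] module_map_scale[OF assms, of "-1" y]
    by simp
  then show ?thesis by simp
qed

lemma module_map_sum:
  assumes "module_map f"
  shows "f (\<lambda>p. \<Sum>q\<in>A. a q * u q p) p = (\<Sum>q\<in>A. a q * f (u q) p)"
proof (induction A arbitrary: p rule: infinite_finite_induct)
  case (insert q A)
  then show ?case
    using module_map_add[OF assms, of "\<lambda>p. a q * u q p" "\<lambda>p. \<Sum>q\<in>A. a q * u q p" p]
    by (simp add: module_map_scale[OF assms])
qed (simp_all add: module_map_zero[OF assms])

lemma module_map_comp: "module_map f \<Longrightarrow> module_map g \<Longrightarrow> module_map (\<lambda>c. f (g c))"
  by (simp add: module_map_def)

lemma module_map_columns: "module_map (\<lambda>c p. \<Sum>q<n. c q * u q p)"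
  unfolding module_map_def
  by (intro conjI allI ext) (simp_all add: distrib_right sum.distrib sum_distrib_left mult.assoc)

lemma unit_vec_in_free_module: "q < n \<Longrightarrow> unit_vec q \<in> free_module n"
  by (auto simp: unit_vec_def free_module_def)

lemma sum_unit_vec: "q < n \<Longrightarrow> (\<Sum>p<n. unit_vec q p * f p) = f q"
  by (simp add: unit_vec_def if_distrib[of "\<lambda>x. x * _"] sum.delta cong: if_cong)

lemma sum_unit_vec': "q < n \<Longrightarrow> (\<Sum>p<n. f p * unit_vec q p) = f q"
  using sum_unit_vec[of q n f] by (simp add: mult.commute)

lemma free_module_expand: "c \<in> free_module n \<Longrightarrow> c = (\<lambda>p. \<Sum>q<n. c q * unit_vec q p)"
  by (auto simp: free_module_def unit_vec_def fun_eq_iff if_distrib sum.delta not_less cong: if_cong)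

lemma module_map_expand:
  assumes "module_map f" "c \<in> free_module n"
  shows "f c p = (\<Sum>q<n. c q * f (unit_vec q) p)"
  using module_map_sum[OF assms(1), where A = "{..<n}" and a = c and u = unit_vec and p = p] free_module_expand[OF assms(2)] by simp

definition homogeneous_vec ::
    "(nat \<Rightarrow> int) \<Rightarrow> int \<Rightarrow> (nat \<Rightarrow> ('v, 'k::comm_ring_1) mpoly) \<Rightarrow> bool" where
  "homogeneous_vec t d c \<longleftrightarrow> (\<forall>p. homogeneous (d - t p) (c p))"

lemma homogeneous_vec_image:
  assumes "module_map f" "\<And>q. q < n \<Longrightarrow> homogeneous_vec t' (t q) (f (unit_vec q))"
    and "c \<in> free_module n" "homogeneous_vec t d c"
  shows "homogeneous_vec t' d (f c)"
  unfolding homogeneous_vec_def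
proof
  fix p
  have "homogeneous (d - t' p) (\<Sum>q<n. c q * f (unit_vec q) p)"
  proof (rule homogeneous_sum)
    fix q assume "q \<in> {..<n}"
    then have "homogeneous (d - t q + (t q - t' p)) (c q * f (unit_vec q) p)"
      using assms by (intro homogeneous_times) (auto simp: homogeneous_vec_def)
    then show "homogeneous (d - t' p) (c q * f (unit_vec q) p)" by simp
  qed
  then show "homogeneous (d - t' p) (f c p)"
    by (simp add: module_map_expand[OF assms(1,3)])
qed

text \<open>Replace each coordinate of a preimage by its component in the degree that the twists prescribe.\<close>

lemma homogeneous_preimage:
  assumes "module_map f" "\<And>q. q < n \<Longrightarrow> homogeneous_vec t' (t q) (f (unit_vec q))"
    and "c \<in> free_module n" "homogeneous_vec t' d (f c)"
  shows "\<exists>c'\<in>free_module n. homogeneous_vec t d c' \<and> f c' = f c"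
proof -
  define c' where "c' = (\<lambda>q. homogeneous_component (d - t q) (c q))"
  have c': "c' \<in> free_module n" using assms(3) by (simp add: c'_def free_module_def)
  have "f c' p = f c p" for p
  proof -
    have "homogeneous_component (d - t' p) (f (unit_vec q) p * c q) = f (unit_vec q) p * c' q" if "q < n" for q
      using homogeneous_component_times[of "t q - t' p" "f (unit_vec q) p" "d - t' p" "c q"] assms(2)[OF that]
      by (simp add: homogeneous_vec_def c'_def)
    then have "f c' p = (\<Sum>q<n. homogeneous_component (d - t' p) (c q * f (unit_vec q) p))"
      by (simp add: module_map_expand[OF assms(1) c'] mult.commute)
    also have "\<dots> = homogeneous_component (d - t' p) (f c p)"
      by (simp add: module_map_expand[OF assms(1,3)] homogeneous_component_sum)
    also have "\<dots> = f c p"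
      using assms(4) by (intro homogeneous_component_homogeneous) (simp add: homogeneous_vec_def)
    finally show ?thesis .
  qed
  moreover have "homogeneous_vec t d c'"
    by (simp add: homogeneous_vec_def c'_def homogeneous_homogeneous_component)
  ultimately show ?thesis using c' by blast
qed

text \<open>An augmented resolution with the augmentation counted as the differential \<open>D 0\<close>. Constructions by
  recursion along the resolution then need no separate treatment of the augmentation.\<close>

locale graded_exact =
  fixes r :: "nat \<Rightarrow> nat" and t :: "nat \<Rightarrow> nat \<Rightarrow> int"
    and D :: "nat \<Rightarrow> (nat \<Rightarrow> ('v, 'k::comm_ring_1) mpoly) \<Rightarrow> nat \<Rightarrow> ('v, 'k) mpoly"
  assumes D_map: "module_map (D i)"
    and D_in: "c \<in> free_module (r (Suc i)) \<Longrightarrow> D i c \<in> free_module (r i)"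
    and exact: "{c \<in> free_module (r (Suc i)). D i c = (\<lambda>_. 0)} = D (Suc i) ` free_module (r (Suc (Suc i)))"
    and D_homogeneous: "q < r (Suc i) \<Longrightarrow> homogeneous_vec (t i) (t (Suc i) q) (D i (unit_vec q))"
begin

lemma D_comp_D: "c \<in> free_module (r (Suc (Suc i))) \<Longrightarrow> D i (D (Suc i) c) = (\<lambda>_. 0)"
  using exact[of i] by blast

end

text \<open>The usual lifting along a resolution: the images of the unit vectors are chosen by exactness of the
  target, and homogeneity of the choice comes from \<open>homogeneous_preimage\<close>.\<close>

lemma graded_chain_map:
  assumes "graded_exact r t (D :: nat \<Rightarrow> (nat \<Rightarrow> ('v, 'k::comm_ring_1) mpoly) \<Rightarrow> nat \<Rightarrow> ('v, 'k) mpoly)"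
    and "graded_exact r' t' D'"
    and "r 0 = r' 0" "t 0 = t' 0" "D 0 ` free_module (r 1) \<subseteq> D' 0 ` free_module (r' 1)"
  obtains \<phi> where "\<phi> 0 = (\<lambda>c. c)" "\<And>i. module_map (\<phi> i)"
    "\<And>i c. c \<in> free_module (r i) \<Longrightarrow> \<phi> i c \<in> free_module (r' i)"
    "\<And>i c. c \<in> free_module (r (Suc i)) \<Longrightarrow> D' i (\<phi> (Suc i) c) = \<phi> i (D i c)"
    "\<And>i q. q < r i \<Longrightarrow> homogeneous_vec (t' i) (t i q) (\<phi> i (unit_vec q))"
proof -
  interpret A: graded_exact r t D by fact
  interpret B: graded_exact r' t' D' by fact
  define P where "P = (\<lambda>i \<phi>. module_map \<phi> \<and> (\<forall>c\<in>free_module (r i). \<phi> c \<in> free_module (r' i)) \<and>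
      (\<forall>q<r i. homogeneous_vec (t' i) (t i q) (\<phi> (unit_vec q))) \<and>
      (\<forall>c\<in>free_module (r (Suc i)). \<phi> (D i c) \<in> D' i ` free_module (r' (Suc i))) \<and>
      (i = 0 \<longrightarrow> \<phi> = (\<lambda>c. c)))"
  define Q where "Q = (\<lambda>i \<phi> \<psi>. \<forall>c\<in>free_module (r (Suc i)). D' i (\<psi> c) = \<phi> (D i c))"
  have "\<exists>\<phi>. \<forall>i. P i (\<phi> i) \<and> Q i (\<phi> i) (\<phi> (Suc i))"
  proof (rule dependent_nat_choice)
    have "homogeneous_vec (t' 0) (t 0 q) (unit_vec q)" for q
      by (auto simp: homogeneous_vec_def unit_vec_def assms(4) homogeneous_one)
    moreover have "module_map (\<lambda>c. c)" by (simp add: module_map_def)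
    ultimately show "\<exists>\<phi>. P 0 \<phi>"
      unfolding P_def using assms(3,5) by (intro exI[of _ "\<lambda>c. c"]) auto
  next
    fix \<phi> i assume P: "P i \<phi>"
    have "\<forall>q<r (Suc i). \<exists>u. u \<in> free_module (r' (Suc i)) \<and> homogeneous_vec (t' (Suc i)) (t (Suc i) q) u \<and>
        D' i u = \<phi> (D i (unit_vec q))"
    proof (intro allI impI)
      fix q assume q: "q < r (Suc i)"
      have "homogeneous_vec (t' i) (t (Suc i) q) (\<phi> (D i (unit_vec q)))"
        by (rule homogeneous_vec_image[where f = \<phi> and c = "D i (unit_vec q)" and n = "r i" and t = "t i"])
          (use P q A.D_in[OF unit_vec_in_free_module[OF q]] A.D_homogeneous in \<open>auto simp: P_def\<close>)
      moreover obtain u0 where "u0 \<in> free_module (r' (Suc i))" "D' i u0 = \<phi> (D i (unit_vec q))"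
        using P unit_vec_in_free_module[OF q] unfolding P_def by fastforce
      ultimately show "\<exists>u. u \<in> free_module (r' (Suc i)) \<and>
          homogeneous_vec (t' (Suc i)) (t (Suc i) q) u \<and> D' i u = \<phi> (D i (unit_vec q))"
        using homogeneous_preimage[OF B.D_map B.D_homogeneous, of "r' (Suc i)" i u0 "t (Suc i) q"]
        by auto
    qed
    then obtain u where u: "\<And>q. q < r (Suc i) \<Longrightarrow> u q \<in> free_module (r' (Suc i))"
      "\<And>q. q < r (Suc i) \<Longrightarrow> homogeneous_vec (t' (Suc i)) (t (Suc i) q) (u q)"
      "\<And>q. q < r (Suc i) \<Longrightarrow> D' i (u q) = \<phi> (D i (unit_vec q))"
      by metis
    define \<psi> where "\<psi> = (\<lambda>c p. \<Sum>q<r (Suc i). c q * u q p)"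
    have \<psi>: "module_map \<psi>" unfolding \<psi>_def by (rule module_map_columns)
    have \<psi>_in: "\<psi> c \<in> free_module (r' (Suc i))" for c
      using u(1) by (auto simp: \<psi>_def free_module_def intro!: sum.neutral)
    have \<psi>_unit: "\<psi> (unit_vec q) = u q" if "q < r (Suc i)" for q
      using that by (simp add: \<psi>_def sum_unit_vec)
    have Q: "D' i (\<psi> c) = \<phi> (D i c)" if "c \<in> free_module (r (Suc i))" for c
    proof
      fix p
      have "D' i (\<psi> c) p = (\<Sum>q<r (Suc i). c q * \<phi> (D i (unit_vec q)) p)"
        unfolding \<psi>_def by (simp add: module_map_sum[OF B.D_map] u(3))
      also have "\<dots> = \<phi> (D i c) p"
        by (rule module_map_expand[symmetric, OF module_map_comp[OF _ A.D_map] that])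
          (use P in \<open>simp add: P_def\<close>)
      finally show "D' i (\<psi> c) p = \<phi> (D i c) p" .
    qed
    have "\<psi> (D (Suc i) c) \<in> D' (Suc i) ` free_module (r' (Suc (Suc i)))"
      if c: "c \<in> free_module (r (Suc (Suc i)))" for c
    proof -
      have "D' i (\<psi> (D (Suc i) c)) = (\<lambda>_. 0)"
        using P by (simp add: Q A.D_in c A.D_comp_D module_map_zero P_def)
      then show ?thesis using B.exact[of i] \<psi>_in by blast
    qed
    then have "P (Suc i) \<psi>"
      unfolding P_def using \<psi> \<psi>_in \<psi>_unit u(2) by auto
    then show "\<exists>\<psi>. P (Suc i) \<psi> \<and> Q i \<phi> \<psi>"
      using Q unfolding Q_def by blast
  qed
  then obtain \<phi> where \<phi>: "\<And>i. P i (\<phi> i)" "\<And>i. Q i (\<phi> i) (\<phi> (Suc i))" by blast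
  show thesis
    by (rule that[of \<phi>]) (use \<phi> in \<open>simp_all add: P_def Q_def\<close>)
qed

text \<open>A lift \<open>\<chi>\<close> of the identity is homotopic to the identity: \<open>\<chi> c - c = D (h c) + h (D c)\<close>. When
  \<open>D\<close> is minimal, the right-hand side has no constant coefficients, so the diagonal of \<open>\<chi>\<close>
  has constant coefficients 1.\<close>

lemma (in graded_exact) lift_of_identity:
  assumes minimal: "\<And>i p q. p < r (Suc i) \<Longrightarrow> q < r (Suc (Suc i)) \<Longrightarrow>
      Poly_Mapping.lookup (D (Suc i) (unit_vec q) p) 0 = 0"
    and \<chi>: "\<chi> 0 = (\<lambda>c. c)" "\<And>i. module_map (\<chi> i)"
    "\<And>i c. c \<in> free_module (r i) \<Longrightarrow> \<chi> i c \<in> free_module (r i)"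
    "\<And>i c. c \<in> free_module (r (Suc i)) \<Longrightarrow> D i (\<chi> (Suc i) c) = \<chi> i (D i c)"
    and "q < r (Suc i)"
  shows "Poly_Mapping.lookup (\<chi> (Suc i) (unit_vec q) q) 0 = 1"
proof -
  \<comment> \<open>The homotopy is built degree by degree. Each step only needs \<open>h\<close> on the boundaries from the previous step.
    It starts with 0 because \<open>\<chi> 0\<close> is the identity; this matters for constant coefficients,
    as the augmentation itself may have some.\<close>
  have "\<exists>h. module_map h \<and> (\<forall>c\<in>free_module (r i). h c \<in> free_module (r (Suc i))) \<and>
      (i = 0 \<longrightarrow> h = (\<lambda>_ _. 0)) \<and>
      (\<forall>c\<in>free_module (r (Suc i)). \<forall>p. \<chi> i (D i c) p - D i c p - D i (h (D i c)) p = 0) \<and>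
      (\<forall>j q. i = Suc j \<longrightarrow> q < r i \<longrightarrow> Poly_Mapping.lookup (\<chi> i (unit_vec q) q) 0 = 1)" for i
  proof (induction i)
    case 0
    show ?case
      by (intro exI[of _ "\<lambda>_ _. 0"])
        (auto simp: module_map_def \<chi>(1) module_map_zero[OF D_map] free_module_def)
  next
    case (Suc i)
    then obtain h where h: "module_map h" "\<And>c. c \<in> free_module (r i) \<Longrightarrow> h c \<in> free_module (r (Suc i))"
      "i = 0 \<Longrightarrow> h = (\<lambda>_ _. 0)"
      "\<And>c p. c \<in> free_module (r (Suc i)) \<Longrightarrow> \<chi> i (D i c) p - D i c p - D i (h (D i c)) p = 0"
      by blast
    \<comment> \<open>The defect that the next part of the homotopy has to correct; it consists of cycles.\<close>
    define w where "w = (\<lambda>c p. \<chi> (Suc i) c p - c p - h (D i c) p)"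
    have w_in: "w c \<in> free_module (r (Suc i))" if "c \<in> free_module (r (Suc i))" for c
      using that \<chi>(3)[OF that] h(2)[OF D_in[OF that]] by (auto simp: w_def free_module_def)
    have w_map: "module_map w"
      using \<chi>(2)[of "Suc i"] module_map_comp[OF h(1) D_map]
      by (auto simp: module_map_def w_def algebra_simps)
    have "\<forall>q<r (Suc i). \<exists>v. v \<in> free_module (r (Suc (Suc i))) \<and> D (Suc i) v = w (unit_vec q)"
    proof (intro allI impI)
      fix q assume "q < r (Suc i)"
      then have u: "unit_vec q \<in> free_module (r (Suc i))" by (rule unit_vec_in_free_module)
      have "D i (w (unit_vec q)) = (\<lambda>_. 0)"
        using h(4)[OF u] by (simp add: w_def fun_eq_iff module_map_diff[OF D_map] \<chi>(4)[OF u])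
      with w_in[OF u] have "w (unit_vec q) \<in> {c \<in> free_module (r (Suc i)). D i c = (\<lambda>_. 0)}" by simp
      then have "w (unit_vec q) \<in> D (Suc i) ` free_module (r (Suc (Suc i)))" by (simp only: exact)
      then show "\<exists>v. v \<in> free_module (r (Suc (Suc i))) \<and> D (Suc i) v = w (unit_vec q)"
        by (elim imageE) (intro exI conjI, assumption, simp)
    qed
    then obtain v where v: "\<And>q. q < r (Suc i) \<Longrightarrow> v q \<in> free_module (r (Suc (Suc i)))"
      "\<And>q. q < r (Suc i) \<Longrightarrow> D (Suc i) (v q) = w (unit_vec q)"
      by metis
    define h' where "h' = (\<lambda>c p. \<Sum>q<r (Suc i). c q * v q p)"
    have Dh': "D (Suc i) (h' c) p = w c p" if "c \<in> free_module (r (Suc i))" for c p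
      unfolding h'_def by (simp add: module_map_sum[OF D_map] v(2) module_map_expand[OF w_map that])
    show ?case
    proof (intro exI[of _ h'] conjI ballI allI impI)
      show "module_map h'" unfolding h'_def by (rule module_map_columns)
      show "h' c \<in> free_module (r (Suc (Suc i)))" for c :: "nat \<Rightarrow> ('v, 'k) mpoly"
        using v(1) by (auto simp: h'_def free_module_def intro!: sum.neutral)
    next
      fix c :: "nat \<Rightarrow> ('v, 'k) mpoly" and p
      assume c: "c \<in> free_module (r (Suc (Suc i)))"
      show "\<chi> (Suc i) (D (Suc i) c) p - D (Suc i) c p - D (Suc i) (h' (D (Suc i) c)) p = 0"
        by (simp add: Dh'[OF D_in[OF c]] w_def D_comp_D[OF c] module_map_zero[OF h(1)])
    next
      fix q assume q: "q < r (Suc i)"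
      then have u: "unit_vec q \<in> free_module (r (Suc i))" by (rule unit_vec_in_free_module)
      have "Poly_Mapping.lookup (w (unit_vec q) q) 0 = 0"
        using q by (simp add: v(2)[symmetric] module_map_expand[OF D_map v(1)] lookup_sum
            lookup_times_0 minimal)
      moreover have "Poly_Mapping.lookup (h (D i (unit_vec q)) q) 0 = 0"
      proof (cases i)
        case 0
        then show ?thesis by (simp add: h(3))
      next
        case (Suc j)
        have "h (D i (unit_vec q)) q = (\<Sum>p<r i. D i (unit_vec q) p * h (unit_vec p) q)"
          by (rule module_map_expand[OF h(1) D_in[OF u]])
        then show ?thesis
          using q by (simp add: Suc lookup_sum lookup_times_0 minimal)
      qed
      ultimately show "Poly_Mapping.lookup (\<chi> (Suc i) (unit_vec q) q) 0 = 1"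
        by (simp add: w_def lookup_minus unit_vec_def)
    qed simp_all
  qed
  then show ?thesis using assms(6) by blast
qed

text \<open>Lift the identity from the first complex to the second and back. The composition has constant
  coefficient 1 at \<open>q\<close>, so some entry of the first lift in column \<open>q\<close> has a nonzero constant
  coefficient. As the lift is graded, the twists of its row and its column agree.\<close>

lemma minimal_twist_occurs:
  assumes F: "graded_exact r t (D :: nat \<Rightarrow> (nat \<Rightarrow> ('v, 'k::comm_ring_1) mpoly) \<Rightarrow> nat \<Rightarrow> ('v, 'k) mpoly)"
    and G: "graded_exact r' t' D'"
    and "r 0 = r' 0" "t 0 = t' 0" "D 0 ` free_module (r 1) = D' 0 ` free_module (r' 1)"
    and minimal: "\<And>i p q. p < r (Suc i) \<Longrightarrow> q < r (Suc (Suc i)) \<Longrightarrow>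
      Poly_Mapping.lookup (D (Suc i) (unit_vec q) p) 0 = 0"
    and q: "q < r (Suc i)"
  shows "\<exists>p<r' (Suc i). t' (Suc i) p = t (Suc i) q"
proof -
  interpret A: graded_exact r t D by fact
  obtain \<phi> where \<phi>: "\<phi> 0 = (\<lambda>c. c)" "\<And>i. module_map (\<phi> i)"
    "\<And>i c. c \<in> free_module (r i) \<Longrightarrow> \<phi> i c \<in> free_module (r' i)"
    "\<And>i c. c \<in> free_module (r (Suc i)) \<Longrightarrow> D' i (\<phi> (Suc i) c) = \<phi> i (D i c)"
    "\<And>i q. q < r i \<Longrightarrow> homogeneous_vec (t' i) (t i q) (\<phi> i (unit_vec q))"
    using graded_chain_map[OF F G] assms(3-5) by (metis order_refl)
  obtain \<psi> where \<psi>: "\<psi> 0 = (\<lambda>c. c)" "\<And>i. module_map (\<psi> i)"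
    "\<And>i c. c \<in> free_module (r' i) \<Longrightarrow> \<psi> i c \<in> free_module (r i)"
    "\<And>i c. c \<in> free_module (r' (Suc i)) \<Longrightarrow> D i (\<psi> (Suc i) c) = \<psi> i (D' i c)"
    using graded_chain_map[OF G F] assms(3-5) by (metis order_refl)
  have u: "unit_vec q \<in> free_module (r (Suc i))" using q by (rule unit_vec_in_free_module)
  have "Poly_Mapping.lookup (\<psi> (Suc i) (\<phi> (Suc i) (unit_vec q)) q) 0 = 1"
    by (rule A.lift_of_identity[where \<chi> = "\<lambda>i c. \<psi> i (\<phi> i c)", OF minimal])
      (simp_all add: \<phi>(1,3,4) \<psi>(1,3,4) q module_map_comp[OF \<psi>(2) \<phi>(2)])
  moreover have "Poly_Mapping.lookup (\<psi> (Suc i) (\<phi> (Suc i) (unit_vec q)) q) 0 =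
      (\<Sum>p<r' (Suc i). Poly_Mapping.lookup (\<phi> (Suc i) (unit_vec q) p) 0 *
        Poly_Mapping.lookup (\<psi> (Suc i) (unit_vec p) q) 0)"
    by (simp add: module_map_expand[OF \<psi>(2) \<phi>(3)[OF u]] lookup_sum lookup_times_0)
  ultimately obtain p where p: "p < r' (Suc i)" "Poly_Mapping.lookup (\<phi> (Suc i) (unit_vec q) p) 0 \<noteq> 0"
    by (metis (no_types, lifting) lessThan_iff mult_zero_left sum.neutral zero_neq_one)
  then have "0 \<in> Poly_Mapping.keys (\<phi> (Suc i) (unit_vec q) p)" by (simp add: in_keys_iff)
  moreover have "homogeneous (t (Suc i) q - t' (Suc i) p) (\<phi> (Suc i) (unit_vec q) p)"
    using \<phi>(5)[OF q] by (simp add: homogeneous_vec_def)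
  ultimately have "int (monomial_degree (0 :: 'v \<Rightarrow>\<^sub>0 nat)) = t (Suc i) q - t' (Suc i) p"
    unfolding homogeneous_def by blast
  then show ?thesis using p(1) by auto
qed

definition augmented_rank :: "('v, 'k::comm_ring_1) free_complex \<Rightarrow> nat \<Rightarrow> nat" where
  "augmented_rank F i = (case i of 0 \<Rightarrow> 1 | Suc j \<Rightarrow> rk F j)"

definition augmented_twist :: "('v, 'k::comm_ring_1) free_complex \<Rightarrow> nat \<Rightarrow> nat \<Rightarrow> int" where
  "augmented_twist F i = (case i of 0 \<Rightarrow> (\<lambda>_. 0) | Suc j \<Rightarrow> twist F j)"

definition augmented_diff :: "('v, 'k::comm_ring_1) free_complex \<Rightarrow>
    nat \<Rightarrow> (nat \<Rightarrow> ('v, 'k) mpoly) \<Rightarrow> nat \<Rightarrow> ('v, 'k) mpoly" where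
  "augmented_diff F i c = (case i of 0 \<Rightarrow> (\<lambda>p. if p = 0 then aug_map F c else 0) | Suc j \<Rightarrow> diff_map F j c)"

lemma graded_exact_augmented:
  assumes "graded_complex F" "resolves F I"
  shows "graded_exact (augmented_rank F) (augmented_twist F) (augmented_diff F)"
proof
  fix i
  show "module_map (augmented_diff F i)"
    by (cases i) (auto simp: augmented_diff_def module_map_def aug_map_def diff_map_def fun_eq_iff
        distrib_left sum.distrib sum_distrib_left mult.left_commute)
  show "augmented_diff F i c \<in> free_module (augmented_rank F i)" for c
    by (cases i) (auto simp: augmented_diff_def augmented_rank_def free_module_def diff_map_def)
  show "{c \<in> free_module (augmented_rank F (Suc i)). augmented_diff F i c = (\<lambda>_. 0)} =
      augmented_diff F (Suc i) ` free_module (augmented_rank F (Suc (Suc i)))"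
    using assms(2) unfolding resolves_def
    by (cases i) (auto simp: augmented_diff_def[abs_def] augmented_rank_def fun_eq_iff[of _ "\<lambda>_. 0"])
  show "homogeneous_vec (augmented_twist F i) (augmented_twist F (Suc i) q) (augmented_diff F i (unit_vec q))"
    if "q < augmented_rank F (Suc i)" for q
    using assms(1) that unfolding graded_complex_def homogeneous_vec_def
    by (cases i) (auto simp: augmented_diff_def augmented_twist_def augmented_rank_def aug_map_def
        diff_map_def sum_unit_vec')
qed

theorem minimal_resolution_twist_occurs:
  assumes F: "minimal_graded_free_resolution F I"
    and G: "graded_complex G" "resolves G I"
    and q: "q < rk F i"
  shows "\<exists>p<rk G i. twist G i p = twist F i q"
proof -
  have F': "graded_complex F" "resolves F I"
    using F by (auto simp: minimal_graded_free_resolution_def)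
  have image: "augmented_diff H 0 ` free_module (augmented_rank H 1) = (\<lambda>f p. if p = 0 then f else 0) ` I"
    if "resolves H I" for H
    using that unfolding resolves_def augmented_rank_def augmented_diff_def[abs_def] by (auto simp: image_image)
  have "\<exists>p<augmented_rank G (Suc i). augmented_twist G (Suc i) p = augmented_twist F (Suc i) q"
  proof (rule minimal_twist_occurs[OF graded_exact_augmented[OF F'] graded_exact_augmented[OF G]])
    show "augmented_diff F 0 ` free_module (augmented_rank F 1) =
        augmented_diff G 0 ` free_module (augmented_rank G 1)"
      using image F' G by simp
    show "Poly_Mapping.lookup (augmented_diff F (Suc i) (unit_vec q) p) 0 = 0"
      if "p < augmented_rank F (Suc i)" "q < augmented_rank F (Suc (Suc i))" for i p q
      using that F irrelevant_ideal_lookup_0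
      by (auto simp: minimal_graded_free_resolution_def augmented_rank_def augmented_diff_def
          diff_map_def sum_unit_vec')
  qed (use q in \<open>auto simp: augmented_rank_def augmented_twist_def\<close>)
  then show ?thesis by (simp add: augmented_rank_def augmented_twist_def)
qed

section \<open>Acyclicity of cubical complexes that are closed upwards in a box\<close>

definition cube_sign :: "nat \<Rightarrow> nat set \<Rightarrow> 'b::comm_ring_1" where
  "cube_sign c S = (- 1) ^ card {d \<in> S. d < c}"

definition step_down :: "nat \<Rightarrow> ((nat \<Rightarrow> nat) \<Rightarrow> 'b::comm_ring_1) \<Rightarrow> (nat \<Rightarrow> nat) \<Rightarrow> 'b" where
  "step_down c z a = z a - (if a c = 0 then 0 else z (a(c := a c - 1)))"

text \<open>A chain gives a coefficient \<open>z a S\<close> to the lattice cube with lower corner \<open>a\<close> and edges in the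
  directions \<open>S\<close>, and its boundary is described by coefficients: the cube \<open>(a, S)\<close> is the
  lower facet in direction \<open>c\<close> of \<open>(a, insert c S)\<close> and the upper facet of the same cube moved down
  by one step. No cube reaches below 0, which is the case distinction in \<open>step_down\<close>.\<close>

definition cube_boundary ::
    "nat \<Rightarrow> ((nat \<Rightarrow> nat) \<Rightarrow> nat set \<Rightarrow> 'b::comm_ring_1) \<Rightarrow> (nat \<Rightarrow> nat) \<Rightarrow> nat set \<Rightarrow> 'b" where
  "cube_boundary m z a S =
     (\<Sum>c\<in>{..<m} - S. cube_sign c S * step_down c (\<lambda>b. z b (insert c S)) a)"

lemma step_down_diff: "step_down c (\<lambda>b. y b - z b) a = step_down c y a - step_down c z a"
  and step_down_add: "step_down c (\<lambda>b. y b + z b) a = step_down c y a + step_down c z a"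
  and step_down_scale: "step_down c (\<lambda>b. x * z b) a = x * step_down c z a"
  by (simp_all add: step_down_def algebra_simps)

lemma step_down_sum: "step_down c (\<lambda>b. \<Sum>i\<in>I. f i b) a = (\<Sum>i\<in>I. step_down c (f i) a)"
  by (simp add: step_down_def sum_subtractf)

lemma step_down_commute: "c \<noteq> d \<Longrightarrow> step_down c (step_down d z) a = step_down d (step_down c z) a"
  by (auto simp: step_down_def fun_upd_twist)

lemma cube_boundary_diff:
  "cube_boundary m (\<lambda>a S. y a S - z a S) a S = cube_boundary m y a S - cube_boundary m z a S"
  by (simp add: cube_boundary_def step_down_diff right_diff_distrib sum_subtractf)

lemma cube_boundary_add:
  "cube_boundary m (\<lambda>a S. y a S + z a S) a S = cube_boundary m y a S + cube_boundary m z a S"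
  by (simp add: cube_boundary_def step_down_add distrib_left sum.distrib)

lemma cube_boundary_nonzero:
  assumes "cube_boundary m z a S \<noteq> 0"
  obtains c where "c < m" "c \<notin> S" "z a (insert c S) \<noteq> 0"
  | c where "c < m" "c \<notin> S" "a c \<noteq> 0" "z (a(c := a c - 1)) (insert c S) \<noteq> 0"
proof -
  obtain c where "c \<in> {..<m} - S" "cube_sign c S * step_down c (\<lambda>b. z b (insert c S)) a \<noteq> 0"
    using assms unfolding cube_boundary_def by (rule sum.not_neutral_contains_not_neutral)
  then have c: "c < m" "c \<notin> S" "step_down c (\<lambda>b. z b (insert c S)) a \<noteq> 0" by auto
  show thesis
  proof (cases "z a (insert c S) = 0")
    case True
    with c(3) have "a c \<noteq> 0" "z (a(c := a c - 1)) (insert c S) \<noteq> 0"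
      by (auto simp: step_down_def split: if_splits)
    with c show thesis using that(2) by blast
  qed (use c that(1) in blast)
qed

lemma cube_sign_insert:
  assumes "finite S" "c \<notin> S"
  shows "(cube_sign d (insert c S) :: 'b::comm_ring_1) = (if c < d then - cube_sign d S else cube_sign d S)"
proof (cases "c < d")
  case True
  then have "{e \<in> insert c S. e < d} = insert c {e \<in> S. e < d}" by auto
  then show ?thesis using assms True by (simp add: cube_sign_def)
next
  case False
  then have "{e \<in> insert c S. e < d} = {e \<in> S. e < d}" by auto
  then show ?thesis using False by (simp add: cube_sign_def)
qed

lemma cube_sign_eq_1: "(\<And>d. d < c \<Longrightarrow> d \<notin> S) \<Longrightarrow> cube_sign c S = 1"
proof -
  assume "\<And>d. d < c \<Longrightarrow> d \<notin> S"
  then have "{d \<in> S. d < c} = {}" by auto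
  then show ?thesis by (simp only: cube_sign_def card.empty power_0)
qed

lemma sum_antisymmetric:
  fixes f :: "nat \<Rightarrow> nat \<Rightarrow> 'b::ab_group_add"
  assumes "finite A" "\<And>c d. c \<in> A \<Longrightarrow> d \<in> A \<Longrightarrow> c < d \<Longrightarrow> f c d + f d c = 0"
  shows "(\<Sum>c\<in>A. \<Sum>d\<in>A - {c}. f c d) = 0"
proof -
  have "(\<Sum>d\<in>A - {c}. f c d) = (\<Sum>d\<in>A. (if c < d then f c d else 0) + (if d < c then f c d else 0))"
    if "c \<in> A" for c
    using assms(1) by (intro sum.mono_neutral_cong_left) auto
  then have "(\<Sum>c\<in>A. \<Sum>d\<in>A - {c}. f c d) =
      (\<Sum>c\<in>A. \<Sum>d\<in>A. if c < d then f c d else 0) + (\<Sum>c\<in>A. \<Sum>d\<in>A. if d < c then f c d else 0)"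
    by (simp add: sum.distrib)
  also have "(\<Sum>c\<in>A. \<Sum>d\<in>A. if d < c then f c d else 0) = (\<Sum>d\<in>A. \<Sum>c\<in>A. if d < c then f c d else 0)"
    by (rule sum.swap)
  also have "(\<Sum>c\<in>A. \<Sum>d\<in>A. if c < d then f c d else 0) + (\<Sum>d\<in>A. \<Sum>c\<in>A. if d < c then f c d else 0) =
      (\<Sum>c\<in>A. \<Sum>d\<in>A. if c < d then f c d + f d c else 0)"
    by (simp add: sum.distrib[symmetric] if_distrib cong: if_cong sum.cong)
  also have "\<dots> = 0" using assms(2) by (auto intro!: sum.neutral)
  finally show ?thesis .
qed

lemma cube_boundary_boundary:
  assumes "finite S"
  shows "cube_boundary m (cube_boundary m z) a S = (0 :: 'b::comm_ring_1)"
proof -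
  let ?A = "{..<m} - S"
  define f where "f = (\<lambda>c d. cube_sign c S * (cube_sign d (insert c S) *
      step_down c (step_down d (\<lambda>b. z b (insert d (insert c S)))) a))"
  have "cube_boundary m (cube_boundary m z) a S = (\<Sum>c\<in>?A. \<Sum>d\<in>?A - {c}. f c d)"
    unfolding cube_boundary_def f_def step_down_sum step_down_scale sum_distrib_left
    by (intro sum.cong refl) auto
  also have "\<dots> = 0"
  proof (rule sum_antisymmetric)
    fix c d assume "c \<in> ?A" "d \<in> ?A" "c < d"
    then show "f c d + f d c = 0"
      using assms step_down_commute[of c d "\<lambda>b. z b (insert d (insert c S))" a]
      by (simp add: f_def cube_sign_insert insert_commute mult.left_commute)
  qed simp
  finally show ?thesis .
qed

text \<open>An edge contributes its coefficient to one end and its negative to the other end. The hypothesis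
  says that both ends of every edge of \<open>w\<close> belong to \<open>X\<close>.\<close>

lemma sum_cube_boundary:
  assumes "finite X" "\<And>a c. c < m \<Longrightarrow> w a {c} \<noteq> 0 \<Longrightarrow> a \<in> X \<and> a(c := Suc (a c)) \<in> X"
  shows "(\<Sum>a\<in>X. cube_boundary m w a {}) = (0 :: 'b::comm_ring_1)"
proof -
  have "(\<Sum>a\<in>X. cube_boundary m w a {}) = (\<Sum>a\<in>X. \<Sum>c<m. step_down c (\<lambda>b. w b {c}) a)"
    by (simp add: cube_boundary_def cube_sign_def)
  also have "\<dots> = (\<Sum>c<m. \<Sum>a\<in>X. step_down c (\<lambda>b. w b {c}) a)"
    by (rule sum.swap)
  also have "\<dots> = 0"
  proof (rule sum.neutral, rule ballI)
    fix c assume c: "c \<in> {..<m}"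
    have "(\<Sum>a\<in>X. if a c = 0 then 0 else w (a(c := a c - 1)) {c}) = (\<Sum>a\<in>X. w a {c})"
      (is "sum ?g X = _")
    proof -
      let ?Y = "{a \<in> X. w a {c} \<noteq> 0}" and ?f = "\<lambda>a. a(c := Suc (a c))"
      have inj: "inj_on ?f ?Y"
        by (rule inj_on_inverseI[where g = "\<lambda>a. a(c := a c - 1)"]) simp
      have zero: "?g b = 0" if b: "b \<in> X - ?f ` ?Y" for b
      proof (rule ccontr)
        assume "?g b \<noteq> 0"
        then have nz: "b c \<noteq> 0" "w (b(c := b c - 1)) {c} \<noteq> 0" by (auto split: if_splits)
        then have "b(c := b c - 1) \<in> ?Y" using assms(2) c by blast
        then have "?f (b(c := b c - 1)) \<in> ?f ` ?Y" by (rule imageI)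
        then show False using b nz(1) by simp
      qed
      have "(\<Sum>a\<in>X. w a {c}) = (\<Sum>a\<in>?Y. ?g (?f a))"
        using assms(1) by (intro sum.mono_neutral_cong_right) auto
      also have "\<dots> = sum ?g (?f ` ?Y)"
        using sum.reindex[OF inj, of ?g] by simp
      also have "\<dots> = sum ?g X"
        using assms c zero by (intro sum.mono_neutral_left) auto
      finally show ?thesis by (rule sym)
    qed
    then show "(\<Sum>a\<in>X. step_down c (\<lambda>b. w b {c}) a) = 0"
      by (simp add: step_down_def sum_subtractf)
  qed
  finally show ?thesis .
qed

lemma telescope:
  fixes g :: "nat \<Rightarrow> 'b::comm_ring_1"
  shows "(\<Sum>k\<le>n. g k - (if k = 0 then 0 else g (k - 1))) = g n"
  by (induction n) auto

text \<open>The lattice points of a region that is closed upwards inside a box with upper corner \<open>r\<close>. The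
  lower boundary of the region is arbitrary.\<close>

locale upward_closed_cubes =
  fixes m :: nat and r :: "nat \<Rightarrow> nat" and corner :: "(nat \<Rightarrow> nat) \<Rightarrow> bool"
  assumes corner_zero: "corner a \<Longrightarrow> m \<le> i \<Longrightarrow> a i = 0"
    and corner_up: "corner a \<Longrightarrow> (\<And>i. a i \<le> b i) \<Longrightarrow> (\<And>i. i < m \<Longrightarrow> b i \<le> r i) \<Longrightarrow>
      (\<And>i. m \<le> i \<Longrightarrow> b i = 0) \<Longrightarrow> corner b"
begin

definition cube :: "(nat \<Rightarrow> nat) \<Rightarrow> nat set \<Rightarrow> bool" where
  "cube a S \<longleftrightarrow> corner a \<and> S \<subseteq> {..<m} \<and> (\<forall>i<m. a i + (if i \<in> S then 1 else 0) \<le> r i)"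

definition supported :: "((nat \<Rightarrow> nat) \<Rightarrow> nat set \<Rightarrow> 'b::comm_ring_1) \<Rightarrow> bool" where
  "supported z \<longleftrightarrow> (\<forall>a S. z a S \<noteq> 0 \<longrightarrow> cube a S)"

text \<open>The chain lives on the part of the region where the first \<open>j\<close> coordinates have reached the upper
  corner of the box.\<close>

definition reduced :: "nat \<Rightarrow> ((nat \<Rightarrow> nat) \<Rightarrow> nat set \<Rightarrow> 'b::comm_ring_1) \<Rightarrow> bool" where
  "reduced j z \<longleftrightarrow> (\<forall>a S. z a S \<noteq> 0 \<longrightarrow> (\<forall>i<j. i \<notin> S \<and> a i = r i))"

definition dimension :: "nat \<Rightarrow> ((nat \<Rightarrow> nat) \<Rightarrow> nat set \<Rightarrow> 'b::comm_ring_1) \<Rightarrow> bool" where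
  "dimension n z \<longleftrightarrow> (\<forall>a S. z a S \<noteq> 0 \<longrightarrow> card S = n)"

lemma cube_faces:
  assumes "cube a (insert c S)" "c \<notin> S"
  shows "cube a S" "cube (a(c := Suc (a c))) S"
proof -
  have c: "c < m" "S \<subseteq> {..<m}" "corner a" using assms by (auto simp: cube_def)
  have le: "a i + (if i \<in> insert c S then 1 else 0) \<le> r i" if "i < m" for i
    using assms that by (auto simp: cube_def)
  show "cube a S"
    using c le unfolding cube_def by (auto intro: order_trans[OF _ le])
  have "(a(c := Suc (a c))) i + (if i \<in> S then 1 else 0) \<le> r i" if "i < m" for i
    using le[OF that] assms(2) by (auto split: if_splits)
  moreover from this have "corner (a(c := Suc (a c)))"
  proof (intro corner_up[OF c(3)])
    show "(a(c := Suc (a c))) i \<le> r i" if "i < m" for i using calculation[OF that] by (rule add_leD1)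
  qed (use c corner_zero[OF c(3)] in auto)
  ultimately show "cube (a(c := Suc (a c))) S"
    using c by (simp add: cube_def)
qed

lemma supported_boundary:
  assumes "supported z"
  shows "supported (cube_boundary m z)"
  unfolding supported_def
proof (intro allI impI)
  fix a S assume "cube_boundary m z a S \<noteq> 0"
  then show "cube a S"
  proof (cases rule: cube_boundary_nonzero)
    case (1 c)
    then show ?thesis using assms cube_faces(1)[of a c S] by (simp add: supported_def)
  next
    case (2 c)
    then have "cube (a(c := a c - 1)) (insert c S)" using assms by (auto simp: supported_def)
    from cube_faces(2)[OF this 2(2)] 2(3) show ?thesis by simp
  qed
qed

lemma dimension_boundary:
  assumes "supported w" "dimension (Suc n) w"
  shows "dimension n (cube_boundary m w)"
  unfolding dimension_def
proof (intro allI impI)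
  fix a S assume nz: "cube_boundary m w a S \<noteq> 0"
  have "finite S"
    using supported_boundary[OF assms(1)] nz by (auto simp: supported_def cube_def intro: finite_subset)
  from nz show "card S = n"
    by (cases rule: cube_boundary_nonzero)
      (use assms(2) \<open>finite S\<close> in \<open>fastforce simp: dimension_def card_insert_disjoint\<close>)+
qed

text \<open>Pushing in direction \<open>j\<close>. The chain \<open>w\<close> is the prism swept out by \<open>z\<close> when it moves upwards in this
  direction until the face \<open>a j = r j\<close> of the box is reached; it stays in the region
  because the region is closed upwards. Its boundary is \<open>z\<close> minus the pushed chain, as \<open>z\<close> is a cycle.\<close>

lemma push_step:
  fixes z :: "(nat \<Rightarrow> nat) \<Rightarrow> nat set \<Rightarrow> 'b::comm_ring_1"
  assumes z: "supported z" "dimension n z" "reduced j z" "\<And>a S. finite S \<Longrightarrow> cube_boundary m z a S = 0"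
    and j: "j < m"
  shows "\<exists>w. supported w \<and> dimension (Suc n) w \<and> reduced (Suc j) (\<lambda>a S. z a S - cube_boundary m w a S)"
proof -
  \<comment> \<open>No sign is needed: when \<open>z\<close> is reduced, \<open>j\<close> is the least direction of the cube \<open>(b, T)\<close>.\<close>
  define w where "w = (\<lambda>b T. if j \<in> T \<and> b j < r j then \<Sum>k\<le>b j. z (b(j := k)) (T - {j}) else 0)"
  have w_nz: "j \<in> T \<and> b j < r j \<and> (\<exists>k\<le>b j. z (b(j := k)) (T - {j}) \<noteq> 0)" if "w b T \<noteq> 0" for b T
    using that by (auto simp: w_def split: if_splits elim: sum.not_neutral_contains_not_neutral)
  have w_supp: "supported w"
    unfolding supported_def
  proof (intro allI impI)
    fix b T assume "w b T \<noteq> 0"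
    from w_nz[OF this] obtain k where k: "j \<in> T" "b j < r j" "k \<le> b j" "z (b(j := k)) (T - {j}) \<noteq> 0"
      by blast
    then have cube: "cube (b(j := k)) (T - {j})" using z(1) by (auto simp: supported_def)
    then have le: "b i + (if i \<in> T then 1 else 0) \<le> r i" if "i < m" for i
      using that k(2) by (cases "i = j") (force simp: cube_def)+
    have zero: "b i = 0" if "m \<le> i" for i
      using corner_zero[of "b(j := k)" i] cube that j by (auto simp: cube_def)
    have "corner b"
    proof (rule corner_up)
      show "corner (b(j := k))" using cube by (simp add: cube_def)
      show "(b(j := k)) i \<le> b i" for i using k by simp
      show "b i \<le> r i" if "i < m" for i using le[OF that] by (rule add_leD1)
    qed (rule zero)
    moreover have "T \<subseteq> {..<m}" using cube j by (auto simp: cube_def)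
    ultimately show "cube b T" using le by (simp add: cube_def)
  qed
  have w_dim: "dimension (Suc n) w"
    unfolding dimension_def
  proof (intro allI impI)
    fix b T assume nz: "w b T \<noteq> 0"
    then have "finite T" using w_supp by (auto simp: supported_def cube_def intro: finite_subset)
    moreover from w_nz[OF nz] z(2) have "j \<in> T" "card (T - {j}) = n" unfolding dimension_def by blast+
    ultimately show "card T = Suc n" by (metis card_Suc_Diff1)
  qed
  have w_red: "i \<notin> T \<and> b i = r i" if nz: "w b T \<noteq> 0" and "i < j" for b T i
  proof -
    obtain k where "z (b(j := k)) (T - {j}) \<noteq> 0" using w_nz[OF nz] by blast
    then have "i \<notin> T - {j} \<and> (b(j := k)) i = r i" using z(3) \<open>i < j\<close> unfolding reduced_def by blast
    then show ?thesis using \<open>i < j\<close> by auto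
  qed
  have bw_red: "i \<notin> S \<and> a i = r i" if "cube_boundary m w a S \<noteq> 0" "i < j" for a S i
    using that(1)
  proof (cases rule: cube_boundary_nonzero)
    case (1 c)
    then show ?thesis using w_red[OF _ that(2)] by blast
  next
    case (2 c)
    then show ?thesis using w_red[OF 2(4) that(2)] by (auto split: if_splits)
  qed
  have j_in: "z a S - cube_boundary m w a S = 0" if "j \<in> S" "finite S" for a S
  proof (cases "a j < r j")
    case False
    have "cube_boundary m w a S = 0"
    proof (rule ccontr)
      assume "cube_boundary m w a S \<noteq> 0"
      then show False
        by (cases rule: cube_boundary_nonzero) (use False \<open>j \<in> S\<close> in \<open>auto simp: w_def split: if_splits\<close>)
    qed
    moreover have "\<not> cube a S" using that False j by (auto simp: cube_def)
    ultimately show ?thesis using z(1) by (auto simp: supported_def)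
  next
    case True
    define S' where "S' = S - {j}"
    have S: "S = insert j S'" "j \<notin> S'" "finite S'" using that by (auto simp: S'_def)
    define u where "u = (\<lambda>k c. step_down c (\<lambda>b. z b (insert c S')) (a(j := k)))"
    have w_eq: "step_down c (\<lambda>b. w b (insert c S)) a = (\<Sum>k\<le>a j. u k c)" if "c \<in> {..<m} - S" for c
    proof -
      have "insert c S - {j} = insert c S'" "c \<noteq> j" using that S by auto
      then show ?thesis
        using True S by (auto simp: u_def step_down_def w_def sum_subtractf fun_upd_twist)
    qed
    \<comment> \<open>Removing \<open>j\<close> from \<open>S\<close> changes the sign of all later directions, and earlier ones do not occur.\<close>
    have sign: "cube_sign c S * u k c = - (cube_sign c S' * u k c)" if "c \<in> {..<m} - S" for c k
    proof (cases "j < c")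
      case True
      then show ?thesis using S by (simp add: cube_sign_insert)
    next
      case False
      then have "c < j" using that S by auto
      then have "z b (insert c S') = 0" for b
        using z(3) unfolding reduced_def by blast
      then show ?thesis by (simp add: u_def step_down_def)
    qed
    have uj: "(\<Sum>c\<in>{..<m} - S. cube_sign c S' * u k c) = - (cube_sign j S' * u k j)" for k
    proof -
      have "0 = cube_boundary m z (a(j := k)) S'" using z(4) S by simp
      also have "\<dots> = (\<Sum>c\<in>insert j ({..<m} - S). cube_sign c S' * u k c)"
        unfolding cube_boundary_def u_def using S j by (intro sum.cong) auto
      also have "\<dots> = cube_sign j S' * u k j + (\<Sum>c\<in>{..<m} - S. cube_sign c S' * u k c)"
        using S by simp
      finally show ?thesis by (simp add: eq_neg_iff_add_eq_0 add.commute)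
    qed
    have "cube_boundary m w a S = (\<Sum>c\<in>{..<m} - S. \<Sum>k\<le>a j. cube_sign c S * u k c)"
      by (simp add: cube_boundary_def w_eq sum_distrib_left)
    also have "\<dots> = (\<Sum>k\<le>a j. \<Sum>c\<in>{..<m} - S. cube_sign c S * u k c)"
      by (rule sum.swap)
    also have "\<dots> = (\<Sum>k\<le>a j. cube_sign j S' * u k j)"
      by (simp add: sign sum_negf uj)
    also have "\<dots> = cube_sign j S' * (\<Sum>k\<le>a j. z (a(j := k)) S - (if k = 0 then 0 else z (a(j := k - 1)) S))"
      by (simp add: sum_distrib_left u_def step_down_def S(1)[symmetric] cong: if_cong)
    also have "\<dots> = cube_sign j S' * z a S"
      by (subst telescope[of "\<lambda>k. z (a(j := k)) S"]) simp
    also have "\<dots> = z a S"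
    proof (cases "z a S = 0")
      case False
      then have "d \<notin> S'" if "d < j" for d
        using z(3) that S unfolding reduced_def by blast
      then show ?thesis by (simp add: cube_sign_eq_1)
    qed simp
    finally show ?thesis by simp
  qed
  have j_notin: "z a S - cube_boundary m w a S = 0" if "j \<notin> S" "finite S" "a j \<noteq> r j" for a S
  proof -
    have w0: "w b (insert c S) = 0" if "c \<noteq> j" for b c
      using that \<open>j \<notin> S\<close> by (auto simp: w_def)
    have "cube_boundary m w a S = (\<Sum>c\<in>{j}. cube_sign c S * step_down c (\<lambda>b. w b (insert c S)) a)"
      unfolding cube_boundary_def using j that
      by (intro sum.mono_neutral_right) (auto simp: step_down_def w0)
    also have "\<dots> = cube_sign j S * step_down j (\<lambda>b. w b (insert j S)) a" by simp
    also have "step_down j (\<lambda>b. w b (insert j S)) a = z a S"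
    proof (cases "a j < r j")
      case True
      then show ?thesis
        using that(1) by (cases "a j") (auto simp: step_down_def w_def fun_upd_idem)
    next
      case False
      then have "\<not> cube a S" using that(3) j by (auto simp: cube_def)
      then show ?thesis
        using False that z(1) by (auto simp: step_down_def w_def supported_def)
    qed
    also have "cube_sign j S * z a S = z a S"
    proof (cases "z a S = 0")
      case False
      then have "d \<notin> S" if "d < j" for d
        using z(3) that unfolding reduced_def by blast
      then show ?thesis by (simp add: cube_sign_eq_1)
    qed simp
    finally show ?thesis by simp
  qed
  have "reduced (Suc j) (\<lambda>a S. z a S - cube_boundary m w a S)"
    unfolding reduced_def
  proof (intro allI impI)
    fix a S i assume nz: "z a S - cube_boundary m w a S \<noteq> 0" and "i < Suc j"
    then have "z a S \<noteq> 0 \<or> cube_boundary m w a S \<noteq> 0" by auto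
    then have "cube a S" using z(1) supported_boundary[OF w_supp] by (auto simp: supported_def)
    then have "finite S" by (auto simp: cube_def intro: finite_subset)
    show "i \<notin> S \<and> a i = r i"
    proof (cases "i = j")
      case True
      then show ?thesis using j_in[OF _ \<open>finite S\<close>] j_notin[OF _ \<open>finite S\<close>] nz by blast
    next
      case False
      then have "i < j" using \<open>i < Suc j\<close> by simp
      then show ?thesis
        using \<open>z a S \<noteq> 0 \<or> _\<close> bw_red z(3) unfolding reduced_def by blast
    qed
  qed
  then show ?thesis using w_supp w_dim by blast
qed

lemma supported_add:
  "supported y \<Longrightarrow> supported z \<Longrightarrow> supported (\<lambda>a S. y a S + z a S)"
  and supported_diff:
  "supported y \<Longrightarrow> supported z \<Longrightarrow> supported (\<lambda>a S. y a S - z a S)"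
  unfolding supported_def by (metis add.right_neutral) (metis diff_zero)

lemma dimension_add:
  "dimension n y \<Longrightarrow> dimension n z \<Longrightarrow> dimension n (\<lambda>a S. y a S + z a S)"
  and dimension_diff:
  "dimension n y \<Longrightarrow> dimension n z \<Longrightarrow> dimension n (\<lambda>a S. y a S - z a S)"
  unfolding dimension_def by (metis add.right_neutral) (metis diff_zero)

lemma push_all:
  fixes z :: "(nat \<Rightarrow> nat) \<Rightarrow> nat set \<Rightarrow> 'b::comm_ring_1"
  assumes z: "supported z" "dimension n z" "\<And>a S. finite S \<Longrightarrow> cube_boundary m z a S = 0"
    and "j \<le> m"
  shows "\<exists>w. supported w \<and> dimension (Suc n) w \<and> reduced j (\<lambda>a S. z a S - cube_boundary m w a S)"
  using \<open>j \<le> m\<close>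
proof (induction j)
  case 0
  show ?case by (intro exI[of _ "\<lambda>_ _. 0"]) (simp add: supported_def dimension_def reduced_def)
next
  case (Suc j)
  then obtain w where w: "supported w" "dimension (Suc n) w"
      "reduced j (\<lambda>a S. z a S - cube_boundary m w a S)" by auto
  have "\<exists>w'. supported w' \<and> dimension (Suc n) w' \<and>
      reduced (Suc j) (\<lambda>a S. (z a S - cube_boundary m w a S) - cube_boundary m w' a S)"
  proof (rule push_step)
    show "supported (\<lambda>a S. z a S - cube_boundary m w a S)"
      by (rule supported_diff[OF z(1) supported_boundary[OF w(1)]])
    show "dimension n (\<lambda>a S. z a S - cube_boundary m w a S)"
      by (rule dimension_diff[OF z(2) dimension_boundary[OF w(1,2)]])
    show "cube_boundary m (\<lambda>a S. z a S - cube_boundary m w a S) a S = 0" if "finite S" for a S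
      using that by (simp add: cube_boundary_diff z(3) cube_boundary_boundary)
  qed (use w Suc.prems in auto)
  then obtain w' where w': "supported w'" "dimension (Suc n) w'"
      "reduced (Suc j) (\<lambda>a S. (z a S - cube_boundary m w a S) - cube_boundary m w' a S)" by blast
  then show ?case
    using w by (intro exI[of _ "\<lambda>a S. w a S + w' a S"])
      (simp add: supported_add dimension_add cube_boundary_add diff_diff_add)
qed

text \<open>After pushing in all directions only the upper corner of the box is left. A chain of positive dimension
  vanishes there, and a chain of points is determined by its augmentation.\<close>

theorem cycles_are_boundaries:
  fixes z :: "(nat \<Rightarrow> nat) \<Rightarrow> nat set \<Rightarrow> 'b::comm_ring_1"
  assumes z: "supported z" "dimension n z" "\<And>a S. finite S \<Longrightarrow> cube_boundary m z a S = 0"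
    and X: "finite X" "{a. cube a {}} \<subseteq> X"
    and aug: "n = 0 \<Longrightarrow> (\<Sum>a\<in>X. z a {}) = 0"
  shows "\<exists>w. supported w \<and> dimension (Suc n) w \<and> cube_boundary m w = z"
proof -
  obtain w where w: "supported w" "dimension (Suc n) w"
      "reduced m (\<lambda>a S. z a S - cube_boundary m w a S)"
    using push_all[OF z order_refl] by blast
  define y where "y = (\<lambda>a S. z a S - cube_boundary m w a S)"
  have y: "supported y" "dimension n y" "reduced m y"
    using w supported_diff[OF z(1) supported_boundary[OF w(1)]]
      dimension_diff[OF z(2) dimension_boundary[OF w(1,2)]] by (simp_all add: y_def)
  define top where "top = (\<lambda>i. if i < m then r i else 0)"
  have y_nz: "S = {} \<and> a = top \<and> n = 0 \<and> cube a S" if "y a S \<noteq> 0" for a S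
  proof -
    have cube: "cube a S" using that y(1) by (simp add: supported_def)
    have red: "i \<notin> S \<and> a i = r i" if "i < m" for i
      using that \<open>y a S \<noteq> 0\<close> y(3) by (simp add: reduced_def)
    have "S = {}" using red cube by (auto simp: cube_def)
    moreover have "a = top"
      using red cube corner_zero[of a] by (auto simp: top_def cube_def fun_eq_iff)
    moreover have "card S = n" using that y(2) by (simp add: dimension_def)
    ultimately show ?thesis using cube by simp
  qed
  have "y a S = 0" for a S
  proof (rule ccontr)
    assume nz: "y a S \<noteq> 0"
    from y_nz[OF this] have *: "S = {}" "a = top" "n = 0" "cube top {}" by auto
    have "(\<Sum>a\<in>X. cube_boundary m w a {}) = 0"
    proof (rule sum_cube_boundary[OF X(1)])
      fix a c assume "c < m" "w a {c} \<noteq> 0"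
      then have "cube a (insert c {})" using w(1) by (simp add: supported_def)
      from cube_faces[OF this] show "a \<in> X \<and> a(c := Suc (a c)) \<in> X" using X(2) by auto
    qed
    then have "(\<Sum>a\<in>X. y a {}) = 0" using aug * by (simp add: y_def sum_subtractf)
    moreover have "(\<Sum>a\<in>X. y a {}) = (\<Sum>a\<in>{top}. y a {})"
      using X * y_nz by (intro sum.mono_neutral_right) auto
    ultimately show False using nz * by simp
  qed
  then have "cube_boundary m w = z" by (simp add: y_def fun_eq_iff)
  then show ?thesis using w by blast
qed

end

section \<open>The cubical resolution\<close>

text \<open>Exponent vector of the \<open>n\<close>-th power of a monomial.\<close>

definition exp_mult :: "nat \<Rightarrow> ('v \<Rightarrow>\<^sub>0 nat) \<Rightarrow> 'v \<Rightarrow>\<^sub>0 nat" where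
  "exp_mult n t = (\<Sum>_<n. t)"

lemma lookup_exp_mult [simp]: "Poly_Mapping.lookup (exp_mult n t) v = n * Poly_Mapping.lookup t v"
  by (simp add: exp_mult_def lookup_sum)

lemma exp_mult_Suc: "exp_mult (Suc n) t = t + exp_mult n t"
  by (simp add: exp_mult_def add.commute)

lemma monomial_degree_exp_mult [simp]: "monomial_degree (exp_mult n t) = n * monomial_degree t"
  by (simp add: exp_mult_def monomial_degree_sum)

definition divides_exp :: "('v \<Rightarrow>\<^sub>0 nat) \<Rightarrow> ('v \<Rightarrow>\<^sub>0 nat) \<Rightarrow> bool" where
  "divides_exp s t \<longleftrightarrow> (\<forall>v. Poly_Mapping.lookup s v \<le> Poly_Mapping.lookup t v)"

lemma divides_exp_iff: "divides_exp s t \<longleftrightarrow> (\<exists>u. t = s + u)"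
  by (simp add: divides_exp_def exponent_le_iff)

lemma cube_sign_values:
  "((cube_sign c S :: 'a::comm_ring_1) = 1 \<and> (cube_sign c S :: 'b::comm_ring_1) = 1) \<or>
    ((cube_sign c S :: 'a) = -1 \<and> (cube_sign c S :: 'b) = -1)"
  unfolding cube_sign_def by (cases "even (card {d \<in> S. d < c})") auto

lemma lookup_cube_sign_times:
  fixes f :: "('v, 'k::comm_ring_1) mpoly"
  shows "Poly_Mapping.lookup (cube_sign c S * f) t = cube_sign c S * Poly_Mapping.lookup f t"
  using cube_sign_values[of c S, where 'a = 'k and 'b = "('v, 'k) mpoly"] by auto

lemma homogeneous_cube_sign_times:
  fixes f :: "('w, 'k::comm_ring_1) mpoly"
  shows "homogeneous d f \<Longrightarrow> homogeneous d (cube_sign c S * f)"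
  using cube_sign_values[of c S, where 'a = "('w, 'k) mpoly" and 'b = "('w, 'k) mpoly"]
    homogeneous_uminus[of d f] by auto

lemma lookup_cube_boundary:
  fixes z :: "(nat \<Rightarrow> nat) \<Rightarrow> nat set \<Rightarrow> ('v, 'k::comm_ring_1) mpoly"
  shows "Poly_Mapping.lookup (cube_boundary m z a S) t =
    cube_boundary m (\<lambda>a S. Poly_Mapping.lookup (z a S) t) a S"
  by (simp add: cube_boundary_def step_down_def lookup_sum lookup_cube_sign_times lookup_minus
      if_distrib[where f = "\<lambda>f. Poly_Mapping.lookup f t"] cong: if_cong)

text \<open>Monomials \<open>X i\<close> and \<open>Y i\<close> in separate sets of variables and a set \<open>P\<close> of lattice points that is closed
  upwards in the box \<open>[0, N]\<^sup>m\<close>. For the corona, \<open>X i\<close> is the variable of a core vertex and \<open>Y i\<close> the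
  product of the variables of its pendants.\<close>

locale cubical_ideal =
  fixes m N :: nat and X Y :: "nat \<Rightarrow> 'v \<Rightarrow>\<^sub>0 nat" and P :: "(nat \<Rightarrow> nat) set"
  assumes P_le: "a \<in> P \<Longrightarrow> i < m \<Longrightarrow> a i \<le> N"
    and P_zero: "a \<in> P \<Longrightarrow> m \<le> i \<Longrightarrow> a i = 0"
    and P_up: "a \<in> P \<Longrightarrow> (\<And>i. a i \<le> b i) \<Longrightarrow> (\<And>i. i < m \<Longrightarrow> b i \<le> N) \<Longrightarrow>
      (\<And>i. m \<le> i \<Longrightarrow> b i = 0) \<Longrightarrow> b \<in> P"
    and X_X: "i < m \<Longrightarrow> j < m \<Longrightarrow> i \<noteq> j \<Longrightarrow> Poly_Mapping.keys (X i) \<inter> Poly_Mapping.keys (X j) = {}"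
    and Y_Y: "i < m \<Longrightarrow> j < m \<Longrightarrow> i \<noteq> j \<Longrightarrow> Poly_Mapping.keys (Y i) \<inter> Poly_Mapping.keys (Y j) = {}"
    and X_Y: "i < m \<Longrightarrow> j < m \<Longrightarrow> Poly_Mapping.keys (X i) \<inter> Poly_Mapping.keys (Y j) = {}"
    and X_nonzero: "i < m \<Longrightarrow> X i \<noteq> 0"
    and Y_nonzero: "i < m \<Longrightarrow> Y i \<noteq> 0"
begin

text \<open>For empty \<open>S\<close> this is the generator at the lattice point \<open>a\<close>. In general it is the least common
  multiple of the generators at the vertices of the cube \<open>(a, S)\<close>, since moving up in direction \<open>i\<close>
  trades one factor \<open>Y i\<close> for one factor \<open>X i\<close>.\<close>

definition label :: "(nat \<Rightarrow> nat) \<Rightarrow> nat set \<Rightarrow> 'v \<Rightarrow>\<^sub>0 nat" where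
  "label a S = (\<Sum>i<m. exp_mult (a i + (if i \<in> S then 1 else 0)) (X i) + exp_mult (N - a i) (Y i))"

text \<open>The cubes of dimension \<open>n\<close> with lower corner in \<open>P\<close>. Since \<open>P\<close> is closed upwards, the condition
  \<open>a i < N\<close> says that all vertices of the cube belong to \<open>P\<close>.\<close>

definition basis :: "nat \<Rightarrow> ((nat \<Rightarrow> nat) \<times> nat set) set" where
  "basis n = {(a, S). a \<in> P \<and> S \<subseteq> {..<m} \<and> card S = n \<and> (\<forall>i\<in>S. a i < N)}"

lemma finite_P: "finite P"
proof (rule finite_subset)
  show "P \<subseteq> {a. \<forall>i. (i \<in> {..<m} \<longrightarrow> a i \<in> {..N}) \<and> (i \<notin> {..<m} \<longrightarrow> a i = 0)}"
    using P_le P_zero by auto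
  show "finite {a. \<forall>i. (i \<in> {..<m} \<longrightarrow> a i \<in> {..N}) \<and> (i \<notin> {..<m} \<longrightarrow> a i = 0)}"
    by (rule finite_set_of_finite_funs) auto
qed

lemma finite_basis: "finite (basis n)"
  by (rule finite_subset[of _ "P \<times> Pow {..<m}"]) (auto simp: basis_def finite_P)

lemma basis_0: "basis 0 = (\<lambda>a. (a, {})) ` P"
  by (auto simp: basis_def card_eq_0_iff dest: finite_subset)

lemma lookup_label:
  "Poly_Mapping.lookup (label a S) v =
    (\<Sum>i<m. (a i + (if i \<in> S then 1 else 0)) * Poly_Mapping.lookup (X i) v + (N - a i) * Poly_Mapping.lookup (Y i) v)"
  by (simp add: label_def lookup_sum lookup_add)

lemma lookup_label_at:
  assumes "i < m" "Poly_Mapping.lookup (X i) v \<noteq> 0 \<or> Poly_Mapping.lookup (Y i) v \<noteq> 0"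
  shows "Poly_Mapping.lookup (label a S) v =
    (a i + (if i \<in> S then 1 else 0)) * Poly_Mapping.lookup (X i) v + (N - a i) * Poly_Mapping.lookup (Y i) v"
proof -
  let ?f = "\<lambda>j. (a j + (if j \<in> S then 1 else 0)) * Poly_Mapping.lookup (X j) v + (N - a j) * Poly_Mapping.lookup (Y j) v"
  have "Poly_Mapping.lookup (X j) v = 0 \<and> Poly_Mapping.lookup (Y j) v = 0" if "j < m" "j \<noteq> i" for j
    using assms X_X[of i j] X_Y[of i j] X_Y[of j i] Y_Y[of i j] that by (auto simp: in_keys_iff disjoint_iff)
  then have "sum ?f {..<m} = sum ?f {i}"
    using assms(1) by (intro sum.mono_neutral_right) auto
  then show ?thesis by (simp add: lookup_label)
qed

text \<open>Because the \<open>X i\<close> and \<open>Y i\<close> use separate variables, divisibility can be tested one coordinate at a time.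
  This is why the cubes whose label divides a given monomial fill a region of a box.\<close>

lemma divides_label_iff:
  "divides_exp (label a S) t \<longleftrightarrow> (\<forall>i<m. divides_exp (exp_mult (a i + (if i \<in> S then 1 else 0)) (X i)) t \<and>
      divides_exp (exp_mult (N - a i) (Y i)) t)"
proof -
  let ?s = "\<lambda>i. exp_mult (a i + (if i \<in> S then 1 else 0)) (X i)" and ?u = "\<lambda>i. exp_mult (N - a i) (Y i)"
  have lk: "Poly_Mapping.lookup (label a S) v =
      (\<Sum>i<m. Poly_Mapping.lookup (?s i) v + Poly_Mapping.lookup (?u i) v)" for v
    by (simp add: lookup_label)
  show ?thesis
  proof (intro iffI allI impI conjI)
    fix i assume le: "divides_exp (label a S) t" and i: "i < m"
    have "Poly_Mapping.lookup (?s i) v + Poly_Mapping.lookup (?u i) v \<le> Poly_Mapping.lookup t v" for v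
    proof -
      have "Poly_Mapping.lookup (?s i) v + Poly_Mapping.lookup (?u i) v \<le> Poly_Mapping.lookup (label a S) v"
        unfolding lk using i
        by (intro member_le_sum[of i "{..<m}" "\<lambda>i. Poly_Mapping.lookup (?s i) v + Poly_Mapping.lookup (?u i) v"]) auto
      then show ?thesis using le unfolding divides_exp_def by (meson order_trans)
    qed
    then show "divides_exp (?s i) t" "divides_exp (?u i) t"
      unfolding divides_exp_def by (meson add_leD1 add_leD2)+
  next
    assume le: "\<forall>i<m. divides_exp (?s i) t \<and> divides_exp (?u i) t"
    show "divides_exp (label a S) t"
      unfolding divides_exp_def
    proof
      fix v
      show "Poly_Mapping.lookup (label a S) v \<le> Poly_Mapping.lookup t v"
      proof (cases "\<exists>i<m. Poly_Mapping.lookup (X i) v \<noteq> 0 \<or> Poly_Mapping.lookup (Y i) v \<noteq> 0")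
        case True
        then obtain i where i: "i < m" "Poly_Mapping.lookup (X i) v \<noteq> 0 \<or> Poly_Mapping.lookup (Y i) v \<noteq> 0"
          by blast
        have "Poly_Mapping.lookup (label a S) v = Poly_Mapping.lookup (?s i) v + Poly_Mapping.lookup (?u i) v"
          using lookup_label_at[OF i] by simp
        moreover have "Poly_Mapping.lookup (X i) v = 0 \<or> Poly_Mapping.lookup (Y i) v = 0"
          using X_Y[of i i] i by (auto simp: in_keys_iff disjoint_iff)
        ultimately show ?thesis using le i(1) unfolding divides_exp_def by auto
      next
        case False
        then show ?thesis by (simp add: lk)
      qed
    qed
  qed
qed

lemma label_insert:
  assumes "c < m" "c \<notin> S"
  shows "label a (insert c S) = X c + label a S"
proof -
  have "label b T = exp_mult (b c + (if c \<in> T then 1 else 0)) (X c) + exp_mult (N - b c) (Y c) +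
      (\<Sum>i\<in>{..<m} - {c}. exp_mult (b i + (if i \<in> T then 1 else 0)) (X i) + exp_mult (N - b i) (Y i))" for b T
    unfolding label_def using assms by (subst sum.remove[of _ c]) auto
  moreover have "(\<Sum>i\<in>{..<m} - {c}. exp_mult (a i + (if i \<in> insert c S then 1 else 0)) (X i) + exp_mult (N - a i) (Y i))
      = (\<Sum>i\<in>{..<m} - {c}. exp_mult (a i + (if i \<in> S then 1 else 0)) (X i) + exp_mult (N - a i) (Y i))"
    by (intro sum.cong) auto
  ultimately show ?thesis using assms by (simp add: exp_mult_Suc add.assoc)
qed

lemma label_down_insert:
  assumes "c < m" "c \<notin> S" "a c \<noteq> 0" "a c \<le> N"
  shows "label (a(c := a c - 1)) (insert c S) = Y c + label a S"
proof -
  have "label b T = exp_mult (b c + (if c \<in> T then 1 else 0)) (X c) + exp_mult (N - b c) (Y c) +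
      (\<Sum>i\<in>{..<m} - {c}. exp_mult (b i + (if i \<in> T then 1 else 0)) (X i) + exp_mult (N - b i) (Y i))" for b T
    unfolding label_def using assms by (subst sum.remove[of _ c]) auto
  moreover have "(\<Sum>i\<in>{..<m} - {c}. exp_mult ((a(c := a c - 1)) i + (if i \<in> insert c S then 1 else 0)) (X i) +
        exp_mult (N - (a(c := a c - 1)) i) (Y i))
      = (\<Sum>i\<in>{..<m} - {c}. exp_mult (a i + (if i \<in> S then 1 else 0)) (X i) + exp_mult (N - a i) (Y i))"
    by (intro sum.cong) auto
  moreover have "N - (a c - 1) = Suc (N - a c)" "a c - 1 + 1 = a c" using assms by auto
  ultimately show ?thesis using assms by (simp add: exp_mult_Suc ac_simps)
qed

lemma monomial_degree_label:
  assumes "S \<subseteq> {..<m}"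
  shows "monomial_degree (label a S) = monomial_degree (label a {}) + (\<Sum>i\<in>S. monomial_degree (X i))"
proof -
  have "finite S" using assms finite_subset by blast
  then show ?thesis using assms
    by (induction S) (auto simp: label_insert)
qed

definition chain :: "nat \<Rightarrow> ((nat \<Rightarrow> nat) \<Rightarrow> nat set \<Rightarrow> ('v, 'k::comm_ring_1) mpoly) \<Rightarrow> bool" where
  "chain n z \<longleftrightarrow> (\<forall>a S. z a S \<noteq> 0 \<longrightarrow> (a, S) \<in> basis n)"

text \<open>Multiplying each coefficient by the label of its cube embeds the complex of free modules into
  the cubical chain complex with polynomial coefficients, where the factors \<open>X i\<close> and \<open>Y i\<close> of the
  differential have disappeared (\<open>translate_boundary\<close>).\<close>

definition translate ::
    "((nat \<Rightarrow> nat) \<Rightarrow> nat set \<Rightarrow> ('v, 'k::comm_ring_1) mpoly) \<Rightarrow> (nat \<Rightarrow> nat) \<Rightarrow> nat set \<Rightarrow> ('v, 'k) mpoly" where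
  "translate z a S = monomial (label a S) * z a S"

definition boundary ::
    "((nat \<Rightarrow> nat) \<Rightarrow> nat set \<Rightarrow> ('v, 'k::comm_ring_1) mpoly) \<Rightarrow> (nat \<Rightarrow> nat) \<Rightarrow> nat set \<Rightarrow> ('v, 'k) mpoly" where
  "boundary z a S = (\<Sum>c\<in>{..<m} - S. cube_sign c S * (monomial (X c) * z a (insert c S) -
     (if a c = 0 then 0 else monomial (Y c) * z (a(c := a c - 1)) (insert c S))))"

lemma translate_inject: "translate y = translate z \<longleftrightarrow> y = z"
  by (auto simp: translate_def fun_eq_iff dest: monomial_times_cancel)

lemma translate_eq_0_iff: "translate z a S = 0 \<longleftrightarrow> z a S = 0"
  using monomial_times_cancel[of "label a S" "z a S" 0] by (auto simp: translate_def)

lemma translate_boundary: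
  assumes "chain n z"
  shows "translate (boundary z) = cube_boundary m (translate z)"
proof (intro ext)
  fix a S
  have "monomial (label a S) * (cube_sign c S * (monomial (X c) * z a (insert c S) -
        (if a c = 0 then 0 else monomial (Y c) * z (a(c := a c - 1)) (insert c S)))) =
      cube_sign c S * step_down c (\<lambda>b. translate z b (insert c S)) a" if c: "c \<in> {..<m} - S" for c
  proof -
    have 1: "monomial (label a S) * (monomial (X c) * z a (insert c S)) = translate z a (insert c S)"
      using c label_insert[of c S a]
      by (simp add: translate_def mult_single mult.assoc[symmetric] add.commute)
    have 2: "monomial (label a S) * (monomial (Y c) * z (a(c := a c - 1)) (insert c S)) =
        translate z (a(c := a c - 1)) (insert c S)" if "a c \<noteq> 0"
    proof (cases "z (a(c := a c - 1)) (insert c S) = 0")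
      case False
      then have "(a(c := a c - 1), insert c S) \<in> basis n" using assms by (auto simp: chain_def)
      then have "a c \<le> N" using that by (auto simp: basis_def)
      then show ?thesis
        using c that label_down_insert[of c S a]
        by (simp add: translate_def mult_single mult.assoc[symmetric] add.commute)
    qed (simp add: translate_def)
    have "monomial (label a S) * (cube_sign c S * (monomial (X c) * z a (insert c S) -
        (if a c = 0 then 0 else monomial (Y c) * z (a(c := a c - 1)) (insert c S)))) =
      cube_sign c S * (monomial (label a S) * (monomial (X c) * z a (insert c S)) -
        (if a c = 0 then 0 else monomial (label a S) * (monomial (Y c) * z (a(c := a c - 1)) (insert c S))))"
      by (simp add: right_diff_distrib mult.left_commute)
    also have "\<dots> = cube_sign c S * step_down c (\<lambda>b. translate z b (insert c S)) a"
      unfolding 1 step_down_def using 2 by simp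
    finally show ?thesis .
  qed
  then show "translate (boundary z) a S = cube_boundary m (translate z) a S"
    by (simp add: translate_def[of "boundary z"] boundary_def sum_distrib_left cube_boundary_def)
qed

lemma chain_boundary:
  assumes "chain (Suc n) z"
  shows "chain n (boundary z)"
  unfolding chain_def
proof (intro allI impI)
  fix a S assume "boundary z a S \<noteq> 0"
  then have "cube_boundary m (translate z) a S \<noteq> 0"
    by (metis assms translate_boundary translate_eq_0_iff)
  then show "(a, S) \<in> basis n"
  proof (cases rule: cube_boundary_nonzero)
    case (1 c)
    then have "(a, insert c S) \<in> basis (Suc n)"
      using assms by (simp add: chain_def translate_eq_0_iff)
    moreover from this have "finite S" by (auto simp: basis_def intro: finite_subset)
    ultimately show ?thesis using 1 by (auto simp: basis_def)
  next
    case (2 c)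
    then have b: "(a(c := a c - 1), insert c S) \<in> basis (Suc n)"
      using assms by (simp add: chain_def translate_eq_0_iff)
    moreover from this have "finite S" by (auto simp: basis_def intro: finite_subset)
    moreover have "a \<in> P"
    proof (rule P_up)
      show P: "a(c := a c - 1) \<in> P" using b by (simp add: basis_def)
      show "(a(c := a c - 1)) i \<le> a i" for i by simp
      show "a i \<le> N" if "i < m" for i
        using P_le[OF P that] b by (auto simp: basis_def split: if_splits)
      show "a i = 0" if "m \<le> i" for i
        using P_zero[OF P that] that 2(1) by (auto split: if_splits)
    qed
    ultimately show ?thesis using 2 by (auto simp: basis_def split: if_splits)
  qed
qed

lemma boundary_boundary:
  assumes "chain (Suc (Suc n)) z"
  shows "boundary (boundary z) = (\<lambda>_ _. 0)"
proof (intro ext)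
  fix a S
  show "boundary (boundary z) a S = 0"
  proof (cases "finite S")
    case True
    have "translate (boundary (boundary z)) a S = cube_boundary m (cube_boundary m (translate z)) a S"
      using translate_boundary[OF chain_boundary[OF assms]] translate_boundary[OF assms] by simp
    then show ?thesis using cube_boundary_boundary[OF True] translate_eq_0_iff by metis
  next
    case False
    then have "(a, S) \<notin> basis n" by (auto simp: basis_def intro: finite_subset)
    then show ?thesis using chain_boundary[OF chain_boundary[OF assms]] by (auto simp: chain_def)
  qed
qed

lemma augmentation_boundary:
  assumes "chain 1 z"
  shows "(\<Sum>a\<in>P. translate (boundary z) a {}) = 0"
  unfolding translate_boundary[OF assms]
proof (rule sum_cube_boundary[OF finite_P])
  fix a c assume c: "c < m" and "translate z a {c} \<noteq> 0"
  then have b: "a \<in> P" "a c < N" using assms by (auto simp: chain_def translate_eq_0_iff basis_def)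
  have "a(c := Suc (a c)) \<in> P"
    by (rule P_up[OF b(1)]) (use b c P_le[OF b(1)] P_zero[OF b(1)] in auto)
  with b show "a \<in> P \<and> a(c := Suc (a c)) \<in> P" by simp
qed

definition corner_at :: "('v \<Rightarrow>\<^sub>0 nat) \<Rightarrow> (nat \<Rightarrow> nat) \<Rightarrow> bool" where
  "corner_at t a \<longleftrightarrow> a \<in> P \<and> (\<forall>i<m. divides_exp (exp_mult (N - a i) (Y i)) t)"

text \<open>Upper corner of the box that belongs to the multidegree \<open>t\<close>.\<close>

definition top_at :: "('v \<Rightarrow>\<^sub>0 nat) \<Rightarrow> nat \<Rightarrow> nat" where
  "top_at t i = Max {u. u \<le> N \<and> divides_exp (exp_mult u (X i)) t}"

lemma le_top_at_iff: "u \<le> top_at t i \<longleftrightarrow> u \<le> N \<and> divides_exp (exp_mult u (X i)) t"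
proof -
  let ?U = "{u. u \<le> N \<and> divides_exp (exp_mult u (X i)) t}"
  have fin: "finite ?U" by (rule finite_subset[of _ "{..N}"]) auto
  have "0 \<in> ?U" by (simp add: divides_exp_def)
  then have top: "top_at t i \<in> ?U" unfolding top_at_def using fin by (intro Max_in) auto
  show ?thesis
  proof
    assume "u \<le> top_at t i"
    moreover from this have "u * Poly_Mapping.lookup (X i) v \<le> top_at t i * Poly_Mapping.lookup (X i) v" for v
      by (rule mult_le_mono1)
    ultimately show "u \<le> N \<and> divides_exp (exp_mult u (X i)) t"
      using top unfolding divides_exp_def lookup_exp_mult mem_Collect_eq by (meson order_trans)
  next
    assume "u \<le> N \<and> divides_exp (exp_mult u (X i)) t"
    then show "u \<le> top_at t i" unfolding top_at_def using fin by (intro Max_ge) auto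
  qed
qed

lemma upward_closed_at: "upward_closed_cubes m (top_at t) (corner_at t)"
proof
  show "a i = 0" if "corner_at t a" "m \<le> i" for a i
    using that P_zero by (simp add: corner_at_def)
  show "corner_at t b" if a: "corner_at t a" and "\<And>i. a i \<le> b i" "\<And>i. i < m \<Longrightarrow> b i \<le> top_at t i"
    "\<And>i. m \<le> i \<Longrightarrow> b i = 0" for a b
    unfolding corner_at_def
  proof (intro conjI allI impI)
    show "b \<in> P"
      by (rule P_up[of a]) (use that in \<open>auto simp: corner_at_def le_top_at_iff\<close>)
    fix i assume "i < m"
    then have "(N - a i) * Poly_Mapping.lookup (Y i) v \<le> Poly_Mapping.lookup t v" for v
      using a by (simp add: corner_at_def divides_exp_def)
    moreover have "(N - b i) * Poly_Mapping.lookup (Y i) v \<le> (N - a i) * Poly_Mapping.lookup (Y i) v" for v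
      using that(2)[of i] by (intro mult_le_mono1 diff_le_mono2)
    ultimately show "divides_exp (exp_mult (N - b i) (Y i)) t"
      unfolding divides_exp_def lookup_exp_mult by (meson order_trans)
  qed
qed

text \<open>The cubes that contribute to the multidegree \<open>t\<close> are those of an upward closed region: the
  conditions on the powers of \<open>X i\<close> bound the cube from above, the conditions on the powers of
  \<open>Y i\<close> only bound its lower corner from below.\<close>

lemma cube_at_iff:
  "upward_closed_cubes.cube m (top_at t) (corner_at t) a S \<longleftrightarrow>
    (a, S) \<in> basis (card S) \<and> divides_exp (label a S) t"
proof -
  interpret upward_closed_cubes m "top_at t" "corner_at t" by (rule upward_closed_at)
  show ?thesis
  proof (cases "a \<in> P \<and> S \<subseteq> {..<m}")
    case True
    then have "(\<forall>i<m. a i + (if i \<in> S then 1 else 0) \<le> N) \<longleftrightarrow> (\<forall>i\<in>S. a i < N)"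
      using P_le by (auto simp: subset_iff Suc_le_eq)
    with True show ?thesis
      unfolding cube_def corner_at_def le_top_at_iff divides_label_iff basis_def by blast
  next
    case False
    then show ?thesis by (auto simp: cube_def corner_at_def basis_def)
  qed
qed

text \<open>Exactness is checked in each multidegree separately, where it is \<open>cycles_are_boundaries\<close>. The
  solutions in the various multidegrees are assembled to polynomials; these are divisible by the
  labels, so they come from elements of the free module.\<close>

theorem cycle_is_boundary:
  fixes z :: "(nat \<Rightarrow> nat) \<Rightarrow> nat set \<Rightarrow> ('v, 'k::comm_ring_1) mpoly"
  assumes z: "chain n z" and cycle: "cube_boundary m (translate z) = (\<lambda>_ _. 0)"
    and aug: "n = 0 \<Longrightarrow> (\<Sum>a\<in>P. translate z a {}) = 0"
  shows "\<exists>w. chain (Suc n) w \<and> boundary w = z"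
proof -
  define strand where "strand = (\<lambda>t a S. Poly_Mapping.lookup (translate z a S) t)"
  have "\<exists>w :: (nat \<Rightarrow> nat) \<Rightarrow> nat set \<Rightarrow> 'k. (\<forall>a S. w a S \<noteq> 0 \<longrightarrow> (a, S) \<in> basis (Suc n) \<and> divides_exp (label a S) t) \<and>
      cube_boundary m w = strand t" for t
  proof -
    interpret upward_closed_cubes m "top_at t" "corner_at t" by (rule upward_closed_at)
    have "\<exists>w. supported w \<and> dimension (Suc n) w \<and> cube_boundary m w = strand t"
    proof (rule cycles_are_boundaries[where n = n])
      have nz: "(a, S) \<in> basis n \<and> divides_exp (label a S) t" if nz: "strand t a S \<noteq> 0" for a S
      proof
        have "translate z a S \<noteq> 0" using nz by (auto simp: strand_def)
        then show "(a, S) \<in> basis n" using z by (simp add: chain_def translate_eq_0_iff)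
        have "t \<in> Poly_Mapping.keys (translate z a S)" using nz by (simp add: strand_def in_keys_iff)
        then show "divides_exp (label a S) t"
          by (auto simp: translate_def keys_monomial_times divides_exp_iff)
      qed
      then show "supported (strand t)" "dimension n (strand t)"
        unfolding supported_def dimension_def cube_at_iff by (auto simp: basis_def)
      show "cube_boundary m (strand t) a S = 0" for a S
        using cycle unfolding strand_def lookup_cube_boundary[symmetric] by simp
      show "{a. cube a {}} \<subseteq> P" by (auto simp: cube_at_iff basis_def)
      show "(\<Sum>a\<in>P. strand t a {}) = 0" if "n = 0"
        using aug[OF that] unfolding strand_def lookup_sum[symmetric] by simp
    qed (rule finite_P)
    then show ?thesis
      unfolding supported_def dimension_def cube_at_iff by metis
  qed
  then obtain w where w: "\<And>t a S. w t a S \<noteq> 0 \<Longrightarrow> (a, S) \<in> basis (Suc n) \<and> divides_exp (label a S) t"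
    "\<And>t. cube_boundary m (w t :: (nat \<Rightarrow> nat) \<Rightarrow> nat set \<Rightarrow> 'k) = strand t"
    by metis
  \<comment> \<open>Outside these finitely many multidegrees the strand of \<open>z\<close> is zero and 0 is taken as its primitive.\<close>
  define T where "T = (\<Union>(a, S)\<in>basis n. Poly_Mapping.keys (translate z a S))"
  have T: "finite T" unfolding T_def by (intro finite_UN_I finite_basis) auto
  have strand_T: "strand t a S = 0" if "t \<notin> T" for t a S
  proof (cases "(a, S) \<in> basis n")
    case True
    then show ?thesis using that by (auto simp: strand_def T_def in_keys_iff)
  next
    case False
    then show ?thesis using z translate_eq_0_iff[of z a S] by (auto simp: strand_def chain_def)
  qed
  define w' where "w' = (\<lambda>a S. \<Sum>t\<in>T. Poly_Mapping.single t (w t a S))"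
  have lookup_w': "Poly_Mapping.lookup (w' a S) t = (if t \<in> T then w t a S else 0)" for a S t
    using T by (simp add: w'_def lookup_sum lookup_single when_def sum.delta)
  have "\<exists>y. w' a S = monomial (label a S) * y" for a S
  proof -
    have "\<forall>t\<in>Poly_Mapping.keys (w' a S). \<exists>u. t = label a S + u"
      using w(1) by (auto simp: in_keys_iff lookup_w' divides_exp_iff split: if_splits)
    then show ?thesis using monomial_dvd_iff[of "label a S" "w' a S"] by (auto simp: dvd_def)
  qed
  then obtain y where y: "\<And>a S. w' a S = monomial (label a S) * y a S" by metis
  have w'_y: "w' = translate y" using y by (simp add: translate_def fun_eq_iff)
  have chain_y: "chain (Suc n) y"
    unfolding chain_def
  proof (intro allI impI)
    fix a S assume "y a S \<noteq> 0"
    then have "w' a S \<noteq> 0" by (simp add: w'_y translate_eq_0_iff)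
    then obtain t where "Poly_Mapping.lookup (w' a S) t \<noteq> 0" by (auto simp: poly_mapping_eq_iff fun_eq_iff)
    then show "(a, S) \<in> basis (Suc n)" using w(1) by (auto simp: lookup_w' split: if_splits)
  qed
  have "cube_boundary m w' = translate z"
  proof (intro ext poly_mapping_eqI)
    fix a S t
    have "Poly_Mapping.lookup (cube_boundary m w' a S) t =
        cube_boundary m (\<lambda>a S. if t \<in> T then w t a S else 0) a S"
      by (simp add: lookup_cube_boundary lookup_w')
    also have "\<dots> = strand t a S"
    proof (cases "t \<in> T")
      case True
      then show ?thesis by (simp add: w(2))
    next
      case False
      then show ?thesis by (simp add: strand_T cube_boundary_def step_down_def)
    qed
    finally show "Poly_Mapping.lookup (cube_boundary m w' a S) t = Poly_Mapping.lookup (translate z a S) t"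
      by (simp add: strand_def)
  qed
  then have "translate (boundary y) = translate z"
    by (simp add: translate_boundary[OF chain_y] w'_y)
  then show ?thesis using chain_y by (auto simp: translate_inject)
qed

end

section \<open>Degrees of minimal generators\<close>

text \<open>The maximal degree does not depend on the minimal generating set. By homogeneity, the
  elements of degree at most \<open>d\<close> in any other minimal generating set \<open>S\<close> generate \<open>S0\<close>, hence the
  ideal, so by minimality there are no further elements in \<open>S\<close>.\<close>

lemma max_generator_degree_eq:
  fixes I :: "('v, 'k::comm_ring_1) mpoly set"
  assumes S0: "minimal_homogeneous_generators I S0"
    and attained: "f0 \<in> S0" "homogeneous d f0"
    and bound: "\<And>f. f \<in> S0 \<Longrightarrow> \<exists>e\<le>d. homogeneous e f"
  shows "max_generator_degree I = d"
  unfolding max_generator_degree_def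
proof (rule cSup_eq_maximum)
  show "d \<in> {d. \<exists>S f. minimal_homogeneous_generators I S \<and> f \<in> S \<and> homogeneous d f}"
    using assms by blast
  fix e assume "e \<in> {d. \<exists>S f. minimal_homogeneous_generators I S \<and> f \<in> S \<and> homogeneous d f}"
  then obtain S f where S: "minimal_homogeneous_generators I S" and f: "f \<in> S" "homogeneous e f" by blast
  \<comment> \<open>It will turn out that \<open>T = S\<close>.\<close>
  define T where "T = {g \<in> S. \<exists>k\<le>d. homogeneous k g}"
  obtain dg where dg: "\<And>g. g \<in> S \<Longrightarrow> homogeneous (dg g) g"
    using S unfolding minimal_homogeneous_generators_def by metis
  have "S0 \<subseteq> ideal_gen T"
  proof
    fix h assume h: "h \<in> S0"
    obtain k where k: "k \<le> d" "homogeneous k h" using bound[OF h] by blast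
    have "h \<in> ideal_gen S"
      using S S0 h unfolding minimal_homogeneous_generators_def by (metis ring_module.span_base)
    then obtain A r where A: "finite A" "A \<subseteq> S" "h = (\<Sum>g\<in>A. r g * g)"
      unfolding ring_module.span_explicit by blast
    have "h = homogeneous_component k h" using k(2) by (simp add: homogeneous_component_homogeneous)
    also have "\<dots> = (\<Sum>g\<in>A. g * homogeneous_component (k - dg g) (r g))"
      unfolding A(3) homogeneous_component_sum using A(2) dg by (intro sum.cong refl) (auto simp: mult.commute[of "r _"] intro!: homogeneous_component_times)
    also have "\<dots> \<in> ideal_gen T"
    proof (rule ring_module.span_sum)
      fix g assume g: "g \<in> A"
      show "g * homogeneous_component (k - dg g) (r g) \<in> ideal_gen T"
      proof (cases "g \<in> T")
        case True
        then have "homogeneous_component (k - dg g) (r g) * g \<in> ideal_gen T"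
          by (intro ring_module.span_scale ring_module.span_base)
        then show ?thesis by (simp add: mult.commute)
      next
        case False
        \<comment> \<open>A generator of degree above \<open>d\<close> would need a coefficient of negative degree.\<close>
        then have "\<not> dg g \<le> d" using g A(2) dg unfolding T_def by blast
        then have "homogeneous_component (k - dg g) (r g) = 0"
          using k(1) by (intro poly_mapping_eqI) (auto simp: lookup_homogeneous_component when_def)
        then show ?thesis by (simp add: ring_module.span_zero)
      qed
    qed
    finally show "h \<in> ideal_gen T" .
  qed
  then have "I \<subseteq> ideal_gen T"
    using S0 ring_module.span_minimal[of S0 "ideal_gen T"] unfolding minimal_homogeneous_generators_def by simp
  moreover have "ideal_gen T \<subseteq> I"
    using S ring_module.span_mono[of T S] unfolding minimal_homogeneous_generators_def T_def by auto
  ultimately have "ideal_gen T = I" by blast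
  then have "\<not> T \<subset> S" using S unfolding minimal_homogeneous_generators_def by blast
  moreover have "T \<subseteq> S" by (auto simp: T_def)
  ultimately have "T = S" by blast
  then obtain k where k: "k \<le> d" "homogeneous k f" using f unfolding T_def by blast
  have "f \<noteq> 0"
  proof
    assume "f = 0"
    have "S \<subseteq> ideal_gen (S - {f})"
    proof
      fix g assume "g \<in> S"
      then show "g \<in> ideal_gen (S - {f})"
        using \<open>f = 0\<close> by (cases "g = f") (simp_all add: ring_module.span_zero ring_module.span_base)
    qed
    then have "ideal_gen S \<subseteq> ideal_gen (S - {f})"
      by (rule ring_module.span_minimal) simp
    moreover have "ideal_gen (S - {f}) \<subseteq> ideal_gen S" by (rule ring_module.span_mono) blast
    ultimately have "ideal_gen (S - {f}) = I"
      using S by (simp add: minimal_homogeneous_generators_def)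
    moreover have "S - {f} \<subset> S" using f(1) by blast
    ultimately show False using S by (simp add: minimal_homogeneous_generators_def)
  qed
  then show "e \<le> d" using homogeneous_unique[OF f(2) k(2)] k(1) by simp
qed

section \<open>The cubical complex as a complex of free modules\<close>

context cubical_ideal
begin

definition enum :: "nat \<Rightarrow> nat \<Rightarrow> (nat \<Rightarrow> nat) \<times> nat set" where
  "enum n = (SOME e. bij_betw e {..<card (basis n)} (basis n))"

lemma bij_enum: "bij_betw (enum n) {..<card (basis n)} (basis n)"
proof -
  have "\<exists>e. bij_betw e {..<card (basis n)} (basis n)"
    using ex_bij_betw_nat_finite[OF finite_basis[of n]] by (simp add: atLeast0LessThan)
  then show ?thesis unfolding enum_def by (rule someI_ex)
qed

lemma enum_in: "q < card (basis n) \<Longrightarrow> enum n q \<in> basis n"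
  using bij_betwE[OF bij_enum] by blast

text \<open>Matrix entry of the boundary map in row \<open>x\<close> and column \<open>y\<close>. At most one summand is nonzero.\<close>

definition entry :: "(nat \<Rightarrow> nat) \<times> nat set \<Rightarrow> (nat \<Rightarrow> nat) \<times> nat set \<Rightarrow> ('v, 'k::comm_ring_1) mpoly" where
  "entry x y = (\<Sum>c\<in>{..<m} - snd x. if snd y = insert c (snd x) then cube_sign c (snd x) *
      ((if fst y = fst x then monomial (X c) else 0) -
       (if fst x c \<noteq> 0 \<and> fst y = (fst x)(c := fst x c - 1) then monomial (Y c) else 0)) else 0)"

text \<open>A \<open>free_complex\<close> has bases indexed by initial segments of the natural numbers; \<open>enum\<close> provides the numbering of the
  cubes, and \<open>to_vec\<close> and \<open>of_vec\<close> translate between chains and coordinate vectors.\<close>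

definition resolution :: "('v, 'k::comm_ring_1) free_complex" where
  "resolution =
     \<lparr>rk = (\<lambda>n. card (basis n)),
      twist = (\<lambda>n q. int (monomial_degree (case_prod label (enum n q)))),
      aug = (\<lambda>q. monomial (case_prod label (enum 0 q))),
      diff = (\<lambda>n p q. entry (enum n p) (enum (Suc n) q))\<rparr>"

definition to_vec :: "nat \<Rightarrow> ((nat \<Rightarrow> nat) \<Rightarrow> nat set \<Rightarrow> ('v, 'k::comm_ring_1) mpoly) \<Rightarrow> nat \<Rightarrow> ('v, 'k) mpoly" where
  "to_vec n z q = (if q < card (basis n) then case_prod z (enum n q) else 0)"

definition of_vec :: "nat \<Rightarrow> (nat \<Rightarrow> ('v, 'k::comm_ring_1) mpoly) \<Rightarrow> (nat \<Rightarrow> nat) \<Rightarrow> nat set \<Rightarrow> ('v, 'k) mpoly" where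
  "of_vec n c a S = (if (a, S) \<in> basis n then c (the_inv_into {..<card (basis n)} (enum n) (a, S)) else 0)"

lemma of_vec_enum: "q < card (basis n) \<Longrightarrow> case_prod (of_vec n c) (enum n q) = c q"
  using bij_enum[of n] enum_in[of q n]
  by (auto simp: of_vec_def case_prod_beta the_inv_into_f_f bij_betw_def)

lemma to_vec_of_vec: "c \<in> free_module (card (basis n)) \<Longrightarrow> to_vec n (of_vec n c) = c"
  by (auto simp: fun_eq_iff to_vec_def of_vec_enum free_module_def)

lemma to_vec_in: "to_vec n z \<in> free_module (card (basis n))"
  by (simp add: to_vec_def free_module_def)

lemma chain_of_vec: "chain n (of_vec n c)"
  by (simp add: chain_def of_vec_def)

lemma of_vec_to_vec:
  assumes "chain n z"
  shows "of_vec n (to_vec n z) = z"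
proof (intro ext)
  fix a S
  show "of_vec n (to_vec n z) a S = z a S"
  proof (cases "(a, S) \<in> basis n")
    case True
    then obtain q where "q < card (basis n)" "(a, S) = enum n q"
      using bij_enum[of n] unfolding bij_betw_def by (metis imageE lessThan_iff)
    then show ?thesis using of_vec_enum[of q n "to_vec n z"] by (simp add: to_vec_def split: prod.splits)
  next
    case False
    then show ?thesis using assms by (auto simp: of_vec_def chain_def)
  qed
qed

lemma to_vec_eq_iff: "chain n y \<Longrightarrow> chain n z \<Longrightarrow> to_vec n y = to_vec n z \<longleftrightarrow> y = z"
  using of_vec_to_vec by metis

lemma to_vec_zero: "to_vec n (\<lambda>_ _. 0) = (\<lambda>_. 0)"
  by (simp add: to_vec_def fun_eq_iff split: prod.splits)

lemma chain_zero: "chain n (\<lambda>_ _. 0)"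
  by (simp add: chain_def)

lemma sum_basis_delta:
  assumes "chain n z"
  shows "(\<Sum>y\<in>basis n. if snd y = T \<and> Q \<and> fst y = b then g * case_prod z y else 0) =
    (if Q then g * z b T else 0)"
proof -
  have "(\<Sum>y\<in>basis n. if snd y = T \<and> Q \<and> fst y = b then g * case_prod z y else 0) =
      (\<Sum>y\<in>basis n. if y = (b, T) then (if Q then g * z b T else 0) else 0)"
    by (intro sum.cong) auto
  also have "\<dots> = (if (b, T) \<in> basis n then (if Q then g * z b T else 0) else 0)"
    using finite_basis by (simp add: sum.delta)
  also have "\<dots> = (if Q then g * z b T else 0)"
    using assms unfolding chain_def by (cases "z b T = 0") auto
  finally show ?thesis .
qed

lemma sum_entry:
  assumes "chain n z"
  shows "(\<Sum>y\<in>basis n. entry (a, S) y * case_prod z y) = boundary z a S"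
proof -
  have "(\<Sum>y\<in>basis n. entry (a, S) y * case_prod z y) =
      (\<Sum>y\<in>basis n. \<Sum>c\<in>{..<m} - S.
        (if snd y = insert c S \<and> True \<and> fst y = a then (cube_sign c S * monomial (X c)) * case_prod z y else 0) -
        (if snd y = insert c S \<and> a c \<noteq> 0 \<and> fst y = a(c := a c - 1)
         then (cube_sign c S * monomial (Y c)) * case_prod z y else 0))"
    unfolding entry_def sum_distrib_right
    by (intro sum.cong refl) (auto simp: algebra_simps)
  also have "\<dots> = (\<Sum>c\<in>{..<m} - S. \<Sum>y\<in>basis n.
        (if snd y = insert c S \<and> True \<and> fst y = a then (cube_sign c S * monomial (X c)) * case_prod z y else 0) -
        (if snd y = insert c S \<and> a c \<noteq> 0 \<and> fst y = a(c := a c - 1)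
         then (cube_sign c S * monomial (Y c)) * case_prod z y else 0))"
    by (rule sum.swap)
  also have "\<dots> = boundary z a S"
    unfolding boundary_def sum_subtractf[of _ _ "basis n"] sum_basis_delta[OF assms]
    by (intro sum.cong refl) (auto simp: algebra_simps)
  finally show ?thesis .
qed

lemma diff_map_resolution: "diff_map resolution n c = to_vec n (boundary (of_vec (Suc n) c))"
proof
  fix p
  show "diff_map resolution n c p = to_vec n (boundary (of_vec (Suc n) c)) p"
  proof (cases "p < card (basis n)")
    case True
    obtain a S where x: "enum n p = (a, S)" by fastforce
    have "(\<Sum>q<card (basis (Suc n)). entry (enum n p) (enum (Suc n) q) * c q) =
        (\<Sum>q<card (basis (Suc n)). entry (a, S) (enum (Suc n) q) * case_prod (of_vec (Suc n) c) (enum (Suc n) q))"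
      by (simp add: x of_vec_enum)
    also have "\<dots> = (\<Sum>y\<in>basis (Suc n). entry (a, S) y * case_prod (of_vec (Suc n) c) y)"
      by (rule sum.reindex_bij_betw[OF bij_enum])
    also have "\<dots> = boundary (of_vec (Suc n) c) a S"
      by (rule sum_entry[OF chain_of_vec])
    finally show ?thesis using True by (simp add: diff_map_def resolution_def to_vec_def x)
  qed (simp add: diff_map_def resolution_def to_vec_def)
qed

lemma aug_map_resolution: "aug_map resolution c = (\<Sum>a\<in>P. translate (of_vec 0 c) a {})"
proof -
  have "aug_map resolution c = (\<Sum>q<card (basis 0).
      monomial (case_prod label (enum 0 q)) * case_prod (of_vec 0 c) (enum 0 q))"
    by (simp add: aug_map_def resolution_def of_vec_enum)
  also have "\<dots> = (\<Sum>y\<in>basis 0. monomial (case_prod label y) * case_prod (of_vec 0 c) y)"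
    by (rule sum.reindex_bij_betw[OF bij_enum])
  also have "\<dots> = (\<Sum>a\<in>P. translate (of_vec 0 c) a {})"
    unfolding basis_0 by (subst sum.reindex) (auto simp: inj_on_def translate_def)
  finally show ?thesis .
qed

definition generated_ideal :: "('v, 'k::comm_ring_1) mpoly set" where
  "generated_ideal = {f. Poly_Mapping.keys f \<subseteq> {t. \<exists>a\<in>P. divides_exp (label a {}) t}}"

lemma is_ideal_generated_ideal: "is_ideal generated_ideal"
  unfolding generated_ideal_def
  by (rule subspace_keys_subset) (auto simp: divides_exp_def lookup_add intro: trans_le_add2)

lemma label_in_generated_ideal: "a \<in> P \<Longrightarrow> monomial (label a {}) \<in> generated_ideal"
  by (auto simp: generated_ideal_def divides_exp_def)

lemma boundary_zero_iff:
  assumes "chain (Suc n) z"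
  shows "boundary z = (\<lambda>_ _. 0) \<longleftrightarrow> cube_boundary m (translate z) = (\<lambda>_ _. 0)"
  using translate_inject[of "boundary z" "\<lambda>_ _. 0"] translate_boundary[OF assms]
  by (simp add: translate_def[of "\<lambda>_ _. 0", abs_def])

lemma resolves_resolution: "resolves (resolution :: ('v, 'k::comm_ring_1) free_complex) generated_ideal"
proof -
  let ?G = "resolution :: ('v, 'k) free_complex"
  have rk: "rk (resolution :: ('v, 'k) free_complex) n = card (basis n)" for n
    by (simp add: resolution_def)
  show ?thesis
    unfolding resolves_def rk
  proof (intro conjI allI)
    show "aug_map ?G ` free_module (card (basis 0)) = (generated_ideal :: ('v, 'k) mpoly set)"
    proof (intro equalityI subsetI)
      fix f :: "('v, 'k) mpoly" assume "f \<in> aug_map ?G ` free_module (card (basis 0))"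
      then obtain c where f: "f = (\<Sum>a\<in>P. translate (of_vec 0 c) a {})" by (auto simp: aug_map_resolution)
      show "f \<in> generated_ideal"
        unfolding f translate_def
        by (intro ring_module.subspace_sum[OF is_ideal_generated_ideal])
          (metis is_ideal_generated_ideal label_in_generated_ideal mult.commute ring_module.subspace_scale)
    next
      have ideal: "is_ideal (aug_map ?G ` free_module (card (basis 0)) :: ('v, 'k) mpoly set)"
      proof (rule ring_module.subspaceI)
        show "(0 :: ('v, 'k) mpoly) \<in> aug_map ?G ` free_module (card (basis 0))"
          by (intro image_eqI[of _ _ "\<lambda>_. 0"]) (auto simp: aug_map_def free_module_def)
      next
        fix x y :: "('v, 'k) mpoly"
        assume "x \<in> aug_map ?G ` free_module (card (basis 0))"
          "y \<in> aug_map ?G ` free_module (card (basis 0))"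
        then obtain c d where "x = aug_map ?G c" "y = aug_map ?G d"
          "c \<in> free_module (card (basis 0))" "d \<in> free_module (card (basis 0))" by blast
        then show "x + y \<in> aug_map ?G ` free_module (card (basis 0))"
          by (intro image_eqI[of _ _ "\<lambda>q. c q + d q"])
            (auto simp: aug_map_def free_module_def distrib_left sum.distrib)
      next
        fix r x :: "('v, 'k) mpoly"
        assume "x \<in> aug_map ?G ` free_module (card (basis 0))"
        then obtain c where "x = aug_map ?G c"
          "c \<in> free_module (card (basis 0))" by blast
        then show "r * x \<in> aug_map ?G ` free_module (card (basis 0))"
          by (intro image_eqI[of _ _ "\<lambda>q. r * c q"])
            (auto simp: aug_map_def free_module_def sum_distrib_left mult.left_commute)
      qed
      fix f :: "('v, 'k) mpoly" assume f: "f \<in> generated_ideal"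
      show "f \<in> aug_map ?G ` free_module (card (basis 0))"
      proof (rule in_ideal_if_monomials[OF ideal])
        fix t assume "t \<in> Poly_Mapping.keys f"
        with f obtain a u where a: "a \<in> P" "t = label a {} + u"
          by (auto simp: generated_ideal_def divides_exp_iff)
        then have "(a, {}) \<in> basis 0" by (simp add: basis_0)
        then obtain q where q: "q < card (basis 0)" "enum 0 q = (a, {})"
          using bij_enum[of 0] unfolding bij_betw_def by (metis imageE lessThan_iff)
        have "monomial t = aug_map ?G (\<lambda>p. monomial u * unit_vec q p :: ('v, 'k) mpoly)"
          using q sum_unit_vec'[of q "card (basis 0)" "\<lambda>p. monomial (case_prod label (enum 0 p)) * (monomial u :: ('v, 'k) mpoly)"]
          by (simp add: aug_map_def resolution_def a mult_single mult.assoc[symmetric])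
        moreover have "(\<lambda>p. monomial u * unit_vec q p :: ('v, 'k) mpoly) \<in> free_module (card (basis 0))"
          using q by (auto simp: free_module_def unit_vec_def)
        ultimately show "(monomial t :: ('v, 'k) mpoly) \<in> aug_map ?G ` free_module (card (basis 0))"
          by (rule image_eqI)
      qed
    qed
    show "{c \<in> free_module (card (basis 0)). aug_map ?G c = 0} =
        diff_map ?G 0 ` free_module (card (basis 1))"
    proof (intro equalityI subsetI)
      fix c :: "nat \<Rightarrow> ('v, 'k) mpoly"
      assume "c \<in> {c \<in> free_module (card (basis 0)). aug_map ?G c = 0}"
      then have c: "c \<in> free_module (card (basis 0))" "(\<Sum>a\<in>P. translate (of_vec 0 c) a {}) = 0"
        by (auto simp: aug_map_resolution)
      have nz: "translate (of_vec 0 c) b T = 0" if "T \<noteq> {}" for b T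
        using that by (auto simp: translate_def of_vec_def basis_0)
      have "cube_boundary m (translate (of_vec 0 c)) = (\<lambda>_ _. 0)"
        by (intro ext) (simp add: cube_boundary_def step_down_def nz)
      from cycle_is_boundary[OF chain_of_vec this c(2)]
      obtain w where "chain (Suc 0) w" "boundary w = of_vec 0 c" by blast
      then have "c = diff_map ?G 0 (to_vec 1 w)"
        using to_vec_of_vec[OF c(1)] by (simp add: diff_map_resolution of_vec_to_vec)
      then show "c \<in> diff_map ?G 0 ` free_module (card (basis 1))"
        by (elim ssubst) (rule imageI[OF to_vec_in])
    next
      fix c :: "nat \<Rightarrow> ('v, 'k) mpoly"
      assume "c \<in> diff_map ?G 0 ` free_module (card (basis 1))"
      then obtain d where "c = to_vec 0 (boundary (of_vec 1 d))" by (auto simp: diff_map_resolution)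
      then show "c \<in> {c \<in> free_module (card (basis 0)). aug_map ?G c = 0}"
        using augmentation_boundary[OF chain_of_vec, of d]
          of_vec_to_vec[OF chain_boundary, of 0 "of_vec 1 d"] chain_of_vec[of 1 d]
        by (simp add: aug_map_resolution to_vec_in)
    qed
    fix n
    show "{c \<in> free_module (card (basis (Suc n))). diff_map ?G n c = (\<lambda>_. 0)} =
        diff_map ?G (Suc n) ` free_module (card (basis (Suc (Suc n))))"
    proof (intro equalityI subsetI)
      fix c :: "nat \<Rightarrow> ('v, 'k) mpoly"
      assume "c \<in> {c \<in> free_module (card (basis (Suc n))). diff_map ?G n c = (\<lambda>_. 0)}"
      then have c: "c \<in> free_module (card (basis (Suc n)))"
        and "to_vec n (boundary (of_vec (Suc n) c)) = to_vec n (\<lambda>_ _. 0)"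
        by (auto simp: diff_map_resolution to_vec_zero)
      then have "boundary (of_vec (Suc n) c) = (\<lambda>_ _. 0)"
        by (subst (asm) to_vec_eq_iff[OF chain_boundary[OF chain_of_vec] chain_zero])
      then have "cube_boundary m (translate (of_vec (Suc n) c)) = (\<lambda>_ _. 0)"
        by (simp add: boundary_zero_iff[OF chain_of_vec])
      from cycle_is_boundary[OF chain_of_vec this]
      obtain w where "chain (Suc (Suc n)) w" "boundary w = of_vec (Suc n) c" by blast
      then have "c = diff_map ?G (Suc n) (to_vec (Suc (Suc n)) w)"
        using to_vec_of_vec[OF c(1)] by (simp add: diff_map_resolution of_vec_to_vec)
      then show "c \<in> diff_map ?G (Suc n) ` free_module (card (basis (Suc (Suc n))))"
        by (elim ssubst) (rule imageI[OF to_vec_in])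
    next
      fix c :: "nat \<Rightarrow> ('v, 'k) mpoly"
      assume "c \<in> diff_map ?G (Suc n) ` free_module (card (basis (Suc (Suc n))))"
      then obtain d where "c = to_vec (Suc n) (boundary (of_vec (Suc (Suc n)) d))" by (auto simp: diff_map_resolution)
      then show "c \<in> {c \<in> free_module (card (basis (Suc n))). diff_map ?G n c = (\<lambda>_. 0)}"
        using of_vec_to_vec[OF chain_boundary[OF chain_of_vec], of "Suc n" d] boundary_boundary[OF chain_of_vec, of n d]
        by (simp add: diff_map_resolution to_vec_in to_vec_zero)
    qed
  qed
qed

lemma minimal_resolution:
  "minimal_graded_free_resolution (resolution :: ('v, 'k::comm_ring_1) free_complex) generated_ideal"
  unfolding minimal_graded_free_resolution_def
proof (intro conjI allI impI)
  show "graded_complex (resolution :: ('v, 'k) free_complex)"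
    unfolding graded_complex_def
  proof (intro conjI allI impI)
    show "homogeneous (twist (resolution :: ('v, 'k) free_complex) 0 q) (aug (resolution :: ('v, 'k) free_complex) q)" for q
      by (simp add: resolution_def homogeneous_monomial)
  next
    fix n p q
    assume "p < rk (resolution :: ('v, 'k) free_complex) n" "q < rk (resolution :: ('v, 'k) free_complex) (Suc n)"
    then have in_basis: "enum n p \<in> basis n" "enum (Suc n) q \<in> basis (Suc n)"
      using enum_in by (auto simp: resolution_def)
    obtain a S b T where x: "enum n p = (a, S)" "enum (Suc n) q = (b, T)" by fastforce
    let ?d = "int (monomial_degree (label b T)) - int (monomial_degree (label a S))"
    have "homogeneous ?d (entry (a, S) (b, T) :: ('v, 'k) mpoly)"
      unfolding entry_def
    proof (rule homogeneous_sum)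
      fix c assume c: "c \<in> {..<m} - snd (a, S)"
      have "homogeneous ?d (monomial (X c) :: ('v, 'k) mpoly)" if "T = insert c S" "b = a"
        using c that by (simp add: homogeneous_monomial label_insert)
      moreover have "homogeneous ?d (monomial (Y c) :: ('v, 'k) mpoly)"
        if "T = insert c S" "a c \<noteq> 0" "b = a(c := a c - 1)"
      proof -
        have "a c \<le> N" using P_le[of a c] in_basis(1) x(1) c by (auto simp: basis_def)
        then show ?thesis using c that label_down_insert[of c S a] by (simp add: homogeneous_monomial)
      qed
      ultimately show "homogeneous ?d (if snd (b, T) = insert c (snd (a, S)) then cube_sign c (snd (a, S)) *
          ((if fst (b, T) = fst (a, S) then monomial (X c) else 0) -
           (if fst (a, S) c \<noteq> 0 \<and> fst (b, T) = (fst (a, S))(c := fst (a, S) c - 1) then monomial (Y c) else 0))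
          else 0 :: ('v, 'k) mpoly)"
        by (auto intro!: homogeneous_cube_sign_times homogeneous_diff homogeneous_uminus)
    qed
    then show "homogeneous (twist (resolution :: ('v, 'k) free_complex) (Suc n) q - twist (resolution :: ('v, 'k) free_complex) n p)
        (diff (resolution :: ('v, 'k) free_complex) n p q)"
      by (simp add: resolution_def x)
  qed
  show "diff (resolution :: ('v, 'k) free_complex) n p q \<in> irrelevant_ideal" for n p q
  proof -
    have sub: "is_ideal (irrelevant_ideal :: ('v, 'k) mpoly set)" by (simp add: irrelevant_ideal_def)
    have "entry x y \<in> (irrelevant_ideal :: ('v, 'k) mpoly set)" for x y
      unfolding entry_def
      by (intro ring_module.subspace_sum[OF sub])
        (auto intro!: ring_module.subspace_scale[OF sub] ring_module.subspace_diff[OF sub]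
          ring_module.subspace_0[OF sub] monomial_in_irrelevant_ideal X_nonzero Y_nonzero
          ring_module.subspace_neg[OF sub])
    then show ?thesis by (simp add: resolution_def)
  qed
qed (rule resolves_resolution)

section \<open>Regularity and generators of the cubical ideal\<close>

text \<open>The twist of a cube exceeds the degree of the generator at its lower corner by the dimension
  of the cube, so the points alone determine the regularity. The twists of an arbitrary minimal
  resolution are among those of the cubical resolution.\<close>

theorem regularity_generated:
  assumes X: "\<And>i. i < m \<Longrightarrow> monomial_degree (X i) = 1"
    and a: "a \<in> P" and max: "\<And>b. b \<in> P \<Longrightarrow> monomial_degree (label b {}) \<le> monomial_degree (label a {})"
  shows "regularity (generated_ideal :: ('v, 'k::comm_ring_1) mpoly set) = int (monomial_degree (label a {}))"
  unfolding regularity_def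
proof (rule cSup_eq_maximum)
  have "(a, {}) \<in> basis 0" using a by (simp add: basis_0)
  then obtain q where "q < card (basis 0)" "enum 0 q = (a, {})"
    using bij_enum[of 0] unfolding bij_betw_def by (metis imageE lessThan_iff)
  then have "int (monomial_degree (label a {})) = twist (resolution :: ('v, 'k) free_complex) 0 q"
    "q < rk (resolution :: ('v, 'k) free_complex) 0" by (auto simp: resolution_def)
  then have "int (monomial_degree (label a {})) \<in> betti_degrees (generated_ideal :: ('v, 'k) mpoly set) 0"
    unfolding betti_degrees_def using minimal_resolution by blast
  then show "int (monomial_degree (label a {})) \<in> {j - int i |i j. j \<in> betti_degrees (generated_ideal :: ('v, 'k) mpoly set) i}"
    by (intro CollectI exI[of _ "int (monomial_degree (label a {}))"] exI[of _ 0]) simp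
next
  fix x assume "x \<in> {j - int i |i j. j \<in> betti_degrees (generated_ideal :: ('v, 'k) mpoly set) i}"
  then obtain i F q where F: "minimal_graded_free_resolution F (generated_ideal :: ('v, 'k) mpoly set)" "q < rk F i"
    "x = twist F i q - int i" by (auto simp: betti_degrees_def)
  have G: "graded_complex (resolution :: ('v, 'k) free_complex)" "resolves (resolution :: ('v, 'k) free_complex) generated_ideal"
    using minimal_resolution unfolding minimal_graded_free_resolution_def by blast+
  obtain p where p: "p < card (basis i)" "twist F i q = int (monomial_degree (case_prod label (enum i p)))"
    using minimal_resolution_twist_occurs[OF F(1) G F(2)] by (auto simp: resolution_def)
  obtain b S where bS: "enum i p = (b, S)" "b \<in> P" "S \<subseteq> {..<m}" "card S = i"
    using enum_in[OF p(1)] by (auto simp: basis_def)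
  have "(\<Sum>i\<in>S. monomial_degree (X i)) = i"
    using X bS by (simp add: subset_iff)
  then show "x \<le> int (monomial_degree (label a {}))"
    using max[OF bS(2)] by (simp add: F(3) p(2) bS(1) monomial_degree_label[OF bS(3), of b])
qed

text \<open>The exponents of \<open>X i\<close> and \<open>Y i\<close> move in opposite directions, so no generator divides another one.\<close>

lemma divides_label_imp_eq:
  assumes "a \<in> P" "b \<in> P" "divides_exp (label b {}) (label a {})"
  shows "a = b"
proof
  fix i
  show "a i = b i"
  proof (cases "i < m")
    case True
    note lk_i = lookup_label_at[OF True, of _ a "{}", simplified]
    obtain v where v: "Poly_Mapping.lookup (X i) v \<noteq> 0"
      using X_nonzero[OF True] by (auto simp: poly_mapping_eq_iff fun_eq_iff)
    have "Poly_Mapping.lookup (Y i) v = 0"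
      using X_Y[OF True True] v by (auto simp: in_keys_iff disjoint_iff)
    moreover have "divides_exp (exp_mult (b i) (X i)) (label a {})"
      using assms(3) True unfolding divides_label_iff by auto
    ultimately have "b i * Poly_Mapping.lookup (X i) v \<le> a i * Poly_Mapping.lookup (X i) v"
      using lk_i[of v] v by (auto simp: divides_exp_def dest: spec[of _ v])
    then have "b i \<le> a i" using v by simp
    obtain v where v: "Poly_Mapping.lookup (Y i) v \<noteq> 0"
      using Y_nonzero[OF True] by (auto simp: poly_mapping_eq_iff fun_eq_iff)
    have "Poly_Mapping.lookup (X i) v = 0"
      using X_Y[OF True True] v by (auto simp: in_keys_iff disjoint_iff)
    moreover have "divides_exp (exp_mult (N - b i) (Y i)) (label a {})"
      using assms(3) True unfolding divides_label_iff by auto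
    ultimately have "(N - b i) * Poly_Mapping.lookup (Y i) v \<le> (N - a i) * Poly_Mapping.lookup (Y i) v"
      using lk_i[of v] v by (auto simp: divides_exp_def dest: spec[of _ v])
    then have "N - b i \<le> N - a i" using v by simp
    then show ?thesis
      using \<open>b i \<le> a i\<close> P_le[OF assms(1) True] P_le[OF assms(2) True] by simp
  next
    case False
    then show ?thesis using P_zero[OF assms(1)] P_zero[OF assms(2)] by (simp add: not_less)
  qed
qed

lemma minimal_generators_generated:
  "minimal_homogeneous_generators (generated_ideal :: ('v, 'k::comm_ring_1) mpoly set) ((\<lambda>a. monomial (label a {})) ` P)"
  unfolding minimal_homogeneous_generators_def
proof (intro conjI allI impI)
  let ?S = "(\<lambda>a. monomial (label a {}) :: ('v, 'k) mpoly) ` P"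
  show "\<forall>f\<in>?S. \<exists>d. homogeneous d f" by (auto simp: homogeneous_monomial)
  show "ideal_gen ?S = generated_ideal"
  proof
    show "ideal_gen ?S \<subseteq> generated_ideal"
      by (rule ring_module.span_minimal[OF _ is_ideal_generated_ideal]) (auto intro: label_in_generated_ideal)
    show "generated_ideal \<subseteq> ideal_gen ?S"
    proof
      fix f :: "('v, 'k) mpoly" assume f: "f \<in> generated_ideal"
      show "f \<in> ideal_gen ?S"
      proof (rule in_ideal_if_monomials)
        fix t assume "t \<in> Poly_Mapping.keys f"
        with f obtain a u where a: "a \<in> P" "t = label a {} + u"
          by (auto simp: generated_ideal_def divides_exp_iff)
        have "monomial t = monomial u * (monomial (label a {}) :: ('v, 'k) mpoly)"
          by (simp add: a(2) mult_single add.commute)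
        also have "\<dots> \<in> ideal_gen ?S"
          using a(1) by (intro ring_module.span_scale ring_module.span_base) blast
        finally show "monomial t \<in> ideal_gen ?S" .
      qed simp
    qed
  qed
  fix T assume T: "T \<subset> ?S"
  then obtain a where a: "a \<in> P" "monomial (label a {}) \<notin> T" by blast
  let ?M = "{t. \<exists>b\<in>P. monomial (label b {}) \<in> T \<and> divides_exp (label b {}) t}"
  have ideal: "is_ideal {f :: ('v, 'k) mpoly. Poly_Mapping.keys f \<subseteq> ?M}"
    by (rule subspace_keys_subset) (auto simp: divides_exp_def lookup_add intro: trans_le_add2)
  have "T \<subseteq> {f. Poly_Mapping.keys f \<subseteq> ?M}"
  proof
    fix f assume f: "f \<in> T"
    then obtain b where "b \<in> P" "f = monomial (label b {})" using T by blast
    then show "f \<in> {f. Poly_Mapping.keys f \<subseteq> ?M}" using f by (auto simp: divides_exp_def)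
  qed
  then have sub: "ideal_gen T \<subseteq> {f. Poly_Mapping.keys f \<subseteq> ?M}"
    by (rule ring_module.span_minimal[OF _ ideal])
  show "ideal_gen T \<noteq> generated_ideal"
  proof
    assume "ideal_gen T = generated_ideal"
    then have "(monomial (label a {}) :: ('v, 'k) mpoly) \<in> {f. Poly_Mapping.keys f \<subseteq> ?M}"
      using label_in_generated_ideal[OF a(1)] sub by blast
    then obtain b where "b \<in> P" "monomial (label b {}) \<in> T" "divides_exp (label b {}) (label a {})"
      by auto
    then show False using divides_label_imp_eq a by blast
  qed
qed

theorem max_generator_degree_generated:
  assumes "a \<in> P" and "\<And>b. b \<in> P \<Longrightarrow> monomial_degree (label b {}) \<le> monomial_degree (label a {})"
  shows "max_generator_degree (generated_ideal :: ('v, 'k::comm_ring_1) mpoly set) = int (monomial_degree (label a {}))"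
proof (rule max_generator_degree_eq[OF minimal_generators_generated])
  show "(monomial (label a {}) :: ('v, 'k) mpoly) \<in> (\<lambda>a. monomial (label a {})) ` P" using assms(1) by blast
qed (use assms in \<open>auto simp: homogeneous_monomial\<close>)

end

section \<open>Coronas of complete graphs\<close>

text \<open>At most one of the numbers is less than \<open>k\<close>. If \<open>b i\<close> is, then each of the others is at least \<open>k - b i\<close>, and
  since \<open>b i \<le> 0\<close> the gain of the others compensates the loss at \<open>i\<close>.\<close>

lemma sum_of_pairwise_bounded:
  fixes b :: "nat \<Rightarrow> int"
  assumes "m \<ge> 2" "k \<le> 1" "\<And>i j. i < m \<Longrightarrow> j < m \<Longrightarrow> i \<noteq> j \<Longrightarrow> k \<le> b i + b j" "0 \<le> k"
  shows "k * (int m - 1) \<le> (\<Sum>i<m. b i)"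
proof (cases "\<forall>i<m. k \<le> b i")
  case True
  then have "(\<Sum>i<m. k) \<le> (\<Sum>i<m. b i)" by (intro sum_mono) auto
  then show ?thesis using assms(4) by (simp add: algebra_simps)
next
  case False
  then obtain i where i: "i < m" "b i \<le> 0" using assms(2) by force
  have "(\<Sum>j\<in>{..<m} - {i}. k - b i) \<le> (\<Sum>j\<in>{..<m} - {i}. b j)"
    using assms(3) i(1) by (intro sum_mono) (auto simp: algebra_simps)
  moreover have "(\<Sum>i<m. b i) = b i + (\<Sum>j\<in>{..<m} - {i}. b j)"
    using i(1) by (intro sum.remove) auto
  moreover have "(\<Sum>j\<in>{..<m} - {i}. k - b i) = (int m - 1) * (k - b i)"
    using i(1) by (simp add: of_nat_diff)
  moreover have "(int m - 2) * b i \<le> 0"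
    using assms(1) i(2) by (intro mult_nonneg_nonpos) auto
  ultimately show ?thesis by (simp add: algebra_simps)
qed

text \<open>Both parities at once: with \<open>N = 2 q + k\<close>, the degree of the generator at \<open>a\<close> is a constant minus \<open>s - 1\<close> times
  the sum of the \<open>a i - q\<close>, and membership in \<open>P\<close> says that these differences have pairwise sums at least \<open>k\<close>.\<close>

theorem corona_symbolic_power:
  fixes C :: "'v::finite set" and E :: "'v set set" and m s N :: nat
  assumes m: "m \<ge> 2" and s: "s \<ge> 1" and C: "card C = m"
    and E: "is_corona C (complete_graph_edges C) s E"
  defines "J \<equiv> cover_ideal E :: ('v, 'k::idom) mpoly set"
  defines "d \<equiv> int m * (int s + 1) * int (N div 2) + int (N mod 2) * (int m + int s - 1)"
  shows "regularity (symbolic_power J N) = d \<and> max_generator_degree (symbolic_power J N) = d"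
proof -
  obtain base where base: "\<And>v. v \<notin> C \<Longrightarrow> base v \<in> C" "\<And>c. c \<in> C \<Longrightarrow> card {v. v \<notin> C \<and> base v = c} = s"
    and E_eq: "E = complete_graph_edges C \<union> {{v, base v} | v. v \<notin> C}"
    using E unfolding is_corona_def by blast
  obtain g where g: "bij_betw g {..<m} C"
    using ex_bij_betw_nat_finite[of C] C by (auto simp: atLeast0LessThan)
  have g_in: "g i \<in> C" if "i < m" for i using bij_betwE[OF g] that by blast
  have g_inj: "g i = g j \<longleftrightarrow> i = j" if "i < m" "j < m" for i j
    using g that by (auto simp: bij_betw_def inj_on_def)
  have g_surj: "\<exists>i<m. v = g i" if "v \<in> C" for v
    using g that by (auto simp: bij_betw_def)
  define X where "X = (\<lambda>i. Poly_Mapping.single (g i) 1 :: 'v \<Rightarrow>\<^sub>0 nat)"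
  define Y where "Y = (\<lambda>i. \<Sum>p\<in>{v. v \<notin> C \<and> base v = g i}. Poly_Mapping.single p 1 :: 'v \<Rightarrow>\<^sub>0 nat)"
  have X: "Poly_Mapping.lookup (X i) v = (if v = g i then 1 else 0)" for i v
    by (simp add: X_def lookup_single when_def)
  have Y: "Poly_Mapping.lookup (Y i) v = (if v \<notin> C \<and> base v = g i then 1 else 0)" for i v
    by (simp add: Y_def lookup_sum lookup_single when_def sum.delta)
  define P where "P = {a :: nat \<Rightarrow> nat. (\<forall>i<m. a i \<le> N) \<and> (\<forall>i\<ge>m. a i = 0) \<and>
      (\<forall>i<m. \<forall>j<m. i \<noteq> j \<longrightarrow> N \<le> a i + a j)}"
  interpret cubical_ideal m N X Y P
  proof
    show "b \<in> P" if a: "a \<in> P" and le: "\<And>i. a i \<le> b i" and "\<And>i. i < m \<Longrightarrow> b i \<le> N" "\<And>i. m \<le> i \<Longrightarrow> b i = 0" for a b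
    proof -
      have "N \<le> b i + b j" if "i < m" "j < m" "i \<noteq> j" for i j
      proof -
        have "N \<le> a i + a j" using a that by (simp add: P_def)
        also have "\<dots> \<le> b i + b j" by (intro add_mono le)
        finally show ?thesis .
      qed
      with that show ?thesis by (simp add: P_def)
    qed
    show "X i \<noteq> 0" if "i < m" for i by (auto simp: poly_mapping_eq_iff fun_eq_iff X)
    show "Y i \<noteq> 0" if "i < m" for i
    proof -
      have "{v. v \<notin> C \<and> base v = g i} \<noteq> {}" using base(2)[OF g_in[OF that]] s by force
      then obtain v where "v \<notin> C \<and> base v = g i" by blast
      then have "Poly_Mapping.lookup (Y i) v \<noteq> 0" by (simp add: Y)
      then show ?thesis by auto
    qed
  qed (use g_in g_inj in \<open>auto simp: P_def in_keys_iff X Y split: if_splits\<close>)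
  have lookup_label: "Poly_Mapping.lookup (label a {}) v =
      (\<Sum>i<m. a i * (if v = g i then 1 else 0) + (N - a i) * (if v \<notin> C \<and> base v = g i then 1 else 0))" for a v
    by (simp add: label_def lookup_sum lookup_add X Y)
  have label_g: "Poly_Mapping.lookup (label a {}) (g i) = a i" if "i < m" for a i
  proof -
    have "Poly_Mapping.lookup (label a {}) (g i) = (\<Sum>j<m. if j = i then a j else 0)"
      unfolding lookup_label using that g_in by (intro sum.cong) (auto simp: g_inj)
    then show ?thesis using that by simp
  qed
  have label_p: "Poly_Mapping.lookup (label a {}) v = N - a i" if "i < m" "v \<notin> C" "base v = g i" for a i v
  proof -
    have "Poly_Mapping.lookup (label a {}) v = (\<Sum>j<m. if j = i then N - a j else 0)"
      unfolding lookup_label using that g_in by (intro sum.cong) (auto simp: g_inj)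
    then show ?thesis using that by simp
  qed
  have base_neq: "v \<noteq> base v" if "v \<notin> C" for v using base(1)[OF that] that by metis
  have E2: "card e = 2" if "e \<in> E" for e
    using that base_neq unfolding E_eq complete_graph_edges_def by (auto simp: card_insert_if)
  have exponents: "(\<exists>a\<in>P. divides_exp (label a {}) t) \<longleftrightarrow> (\<forall>e\<in>E. N \<le> degree_in e t)" for t
  proof
    assume "\<exists>a\<in>P. divides_exp (label a {}) t"
    then obtain a where a: "a \<in> P" "\<And>v. Poly_Mapping.lookup (label a {}) v \<le> Poly_Mapping.lookup t v"
      by (auto simp: divides_exp_def)
    have tg: "a i \<le> Poly_Mapping.lookup t (g i)" if "i < m" for i
      using a(2)[of "g i"] label_g[OF that] by simp
    show "\<forall>e\<in>E. N \<le> degree_in e t"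
    proof
      fix e assume "e \<in> E"
      then consider u v where "e = {u, v}" "u \<in> C" "v \<in> C" "u \<noteq> v" | v where "e = {v, base v}" "v \<notin> C"
        unfolding E_eq complete_graph_edges_def by blast
      then show "N \<le> degree_in e t"
      proof cases
        case 1
        then obtain i j where ij: "i < m" "j < m" "u = g i" "v = g j" using g_surj by metis
        then have "N \<le> a i + a j" using a(1) 1 by (auto simp: P_def)
        also have "\<dots> \<le> degree_in e t" using 1 ij tg[of i] tg[of j] by (simp add: degree_in_def)
        finally show ?thesis .
      next
        case 2
        then obtain i where i: "i < m" "base v = g i" using g_surj base(1) by metis
        have "degree_in e t = Poly_Mapping.lookup t v + Poly_Mapping.lookup t (g i)"
          using 2 i base_neq[of v] by (simp add: degree_in_def)
        moreover have "N - a i \<le> Poly_Mapping.lookup t v"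
          using a(2)[of v] label_p[OF i(1) 2(2) i(2)] by simp
        ultimately show ?thesis using tg[OF i(1)] by simp
      qed
    qed
  next
    assume t: "\<forall>e\<in>E. N \<le> degree_in e t"
    \<comment> \<open>Truncation at \<open>N\<close> keeps the point in the box; a coordinate equal to \<open>N\<close> satisfies all
      of its constraints.\<close>
    define a where "a = (\<lambda>i. if i < m then min N (Poly_Mapping.lookup t (g i)) else 0)"
    have "N \<le> Poly_Mapping.lookup t (g i) + Poly_Mapping.lookup t (g j)" if "i < m" "j < m" "i \<noteq> j" for i j
    proof -
      have "{g i, g j} \<in> E"
        using that g_in g_inj unfolding E_eq complete_graph_edges_def by blast
      then have "N \<le> degree_in {g i, g j} t" using t by blast
      then show ?thesis using that by (simp add: degree_in_def g_inj)
    qed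
    then have "a \<in> P" by (auto simp: P_def a_def min_def)
    moreover have "divides_exp (label a {}) t"
      unfolding divides_exp_def
    proof
      fix v
      show "Poly_Mapping.lookup (label a {}) v \<le> Poly_Mapping.lookup t v"
      proof (cases "v \<in> C")
        case True
        then obtain i where "i < m" "v = g i" using g_surj by blast
        then show ?thesis by (simp add: label_g a_def)
      next
        case False
        then obtain i where i: "i < m" "base v = g i" using g_surj base(1) by metis
        have "{v, base v} \<in> E" using False unfolding E_eq by blast
        then have "N \<le> degree_in {v, base v} t" using t by blast
        then have "N \<le> Poly_Mapping.lookup t v + Poly_Mapping.lookup t (g i)"
          using base_neq[OF False] by (simp add: degree_in_def i(2))
        then show ?thesis using label_p[OF i(1) False i(2)] i(1) by (simp add: a_def)
      qed
    qed
    ultimately show "\<exists>a\<in>P. divides_exp (label a {}) t" by blast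
  qed
  have gen: "symbolic_power J N = generated_ideal"
    unfolding J_def generated_ideal_def exponents by (rule symbolic_power_cover_ideal[OF E2])
  define q k where "q = int (N div 2)" and "k = int (N mod 2)"
  have N: "int N = 2 * q + k" and k: "0 \<le> k" "k \<le> 1"
    unfolding q_def k_def by presburger+
  have degree_X: "monomial_degree (X i) = 1" for i by (simp add: X_def)
  have degree_Y: "monomial_degree (Y i) = s" if "i < m" for i
    using base(2)[OF g_in[OF that]] by (simp add: Y_def monomial_degree_sum)
  have degree: "int (monomial_degree (label a {})) =
      int m * (q + (q + k) * int s) - (int s - 1) * (\<Sum>i<m. int (a i) - q)" if "a \<in> P" for a
  proof -
    have "int (monomial_degree (label a {})) = (\<Sum>i<m. int (a i + (N - a i) * s))"
      by (simp add: label_def monomial_degree_sum degree_X degree_Y)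
    also have "\<dots> = (\<Sum>i<m. (q + (q + k) * int s) - (int s - 1) * (int (a i) - q))"
    proof (rule sum.cong[OF refl])
      fix i assume "i \<in> {..<m}"
      then have "int (a i + (N - a i) * s) = int (a i) + (int N - int (a i)) * int s"
        using P_le[OF that, of i] by (simp add: of_nat_diff)
      then show "int (a i + (N - a i) * s) = (q + (q + k) * int s) - (int s - 1) * (int (a i) - q)"
        unfolding N by (simp add: algebra_simps)
    qed
    also have "\<dots> = (\<Sum>i<m. q + (q + k) * int s) - (\<Sum>i<m. (int s - 1) * (int (a i) - q))"
      by (rule sum_subtractf)
    finally show ?thesis by (simp only: sum_distrib_left sum_constant card_lessThan)
  qed
  have d: "d = int m * (q + (q + k) * int s) - (int s - 1) * (k * (int m - 1))"
    by (simp add: d_def q_def[symmetric] k_def[symmetric] algebra_simps)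
  have upper: "int (monomial_degree (label a {})) \<le> d" if a: "a \<in> P" for a
  proof -
    have "k * (int m - 1) \<le> (\<Sum>i<m. int (a i) - q)"
    proof (rule sum_of_pairwise_bounded[OF m k(2) _ k(1)])
      fix i j assume "i < m" "j < m" "i \<noteq> j"
      then have "N \<le> a i + a j" using a by (simp add: P_def)
      then show "k \<le> int (a i) - q + (int (a j) - q)" using N by linarith
    qed
    then have "(int s - 1) * (k * (int m - 1)) \<le> (int s - 1) * (\<Sum>i<m. int (a i) - q)"
      using s by (intro mult_left_mono) auto
    then show ?thesis using degree[OF a] d by simp
  qed
  \<comment> \<open>All coordinates are \<open>N / 2\<close> rounded up, except that coordinate 0 is rounded down.\<close>
  define a where "a = (\<lambda>i. if i = 0 then N div 2 else if i < m then N div 2 + N mod 2 else 0)"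
  have halves: "N div 2 + N div 2 + N mod 2 = N" by presburger
  have a_P: "a \<in> P" using halves m unfolding P_def a_def by (auto split: if_splits)
  have "(\<Sum>i<m. int (a i) - q) = (\<Sum>i\<in>{..<m} - {0}. k)"
    using m by (intro sum.mono_neutral_cong_right) (auto simp: a_def q_def k_def)
  also have "\<dots> = k * (int m - 1)" using m by (simp add: of_nat_diff)
  finally have a_d: "int (monomial_degree (label a {})) = d" using degree[OF a_P] d by simp
  have max: "monomial_degree (label b {}) \<le> monomial_degree (label a {})" if "b \<in> P" for b
    using upper[OF that] a_d by linarith
  show ?thesis
    unfolding gen using regularity_generated[OF degree_X a_P max] max_generator_degree_generated[OF a_P max] a_d
    by simp
qed

theorem theorem1p6:
  fixes m s :: nat
    and C :: "'v::finite set"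
    and E :: "'v set set"
    and J :: "('v, 'k::field) mpoly set"
  assumes "m \<ge> 3"
    and "s \<ge> 2"
    and "card C = m"
    and "is_corona C (complete_graph_edges C) s E"
    and "J = cover_ideal E"
  shows "(\<forall>n. regularity (symbolic_power J (2 * n)) = max_generator_degree (symbolic_power J (2 * n)) \<and>
              max_generator_degree (symbolic_power J (2 * n)) = int m * (int s + 1) * int n) \<and>
         (\<forall>n. regularity (symbolic_power J (2 * n + 1)) = max_generator_degree (symbolic_power J (2 * n + 1)) \<and>
              max_generator_degree (symbolic_power J (2 * n + 1))
                = int m * (int s + 1) * int n + int m + int s - 1) \<and>
         (\<forall>n. regularity (symbolic_power J n) = max_generator_degree (symbolic_power J n) \<and>
              max_generator_degree (symbolic_power J n)
                = (int m + int s - 1) * int n + (int m - 2) * (int s - 1) * \<lfloor>real n / 2\<rfloor>) \<and>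
         \<not> eventually_linear (\<lambda>n. real_of_int (regularity (symbolic_power J n)))"
proof -
  define d where "d = (\<lambda>n. int m * (int s + 1) * int (n div 2) + int (n mod 2) * (int m + int s - 1))"
  have J: "regularity (symbolic_power J n) = d n" "max_generator_degree (symbolic_power J n) = d n" for n
    using corona_symbolic_power[of m s C E n, where ?'k = 'k] assms by (simp_all add: d_def)
  have even: "d (2 * n) = int m * (int s + 1) * int n"
    and odd: "d (2 * n + 1) = int m * (int s + 1) * int n + int m + int s - 1" for n
    by (simp_all add: d_def)
  have uniform: "d n = (int m + int s - 1) * int n + (int m - 2) * (int s - 1) * \<lfloor>real n / 2\<rfloor>" for n
  proof -
    have "\<lfloor>real n / 2\<rfloor> = int (n div 2)"
      using floor_divide_of_nat_eq[of n 2, where 'a = real] by simp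
    moreover have "int n = 2 * int (n div 2) + int (n mod 2)" by presburger
    ultimately show ?thesis
      unfolding d_def by (simp add: algebra_simps del: of_nat_div of_nat_mod)
  qed
  have "\<not> eventually_linear (\<lambda>n. real_of_int (d n))"
  proof
    assume "eventually_linear (\<lambda>n. real_of_int (d n))"
    then obtain a b n where lin: "\<And>i. i \<ge> n \<Longrightarrow> real_of_int (d i) = a * real i + b"
      by (auto simp: eventually_linear_def eventually_sequentially)
    have "real_of_int (d (2 * n)) = a * real (2 * n) + b"
      "real_of_int (d (2 * n + 1)) = a * real (2 * n + 1) + b"
      "real_of_int (d (2 * Suc n)) = a * real (2 * Suc n) + b"
      by (rule lin; simp)+
    then have "real m * (real s + 1) = 2 * (real m + real s - 1)"
      unfolding even odd by (simp add: algebra_simps)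
    then have "(real m - 2) * (real s - 1) = 0" by (simp add: algebra_simps)
    then show False using assms(1,2) by simp
  qed
  then show ?thesis using J even odd uniform by simp
qed

end
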